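(* Let $\ell\ge0$ and $q\in[0,1)$. The dense Fréchet $*$-subalgebra $\mathcal A_\ell^\infty$ of $A_\ell$ is closed under holomorphic functional calculus in $A_\ell$. Moreover, $\mathcal A_\ell^\infty$ contains the generators $Y_{1,q},\ldots,Y_{\ell+1,q}$.
   Context: **Basic notation.** $\mathbb N=\{0,1,2,\dots\}$. On $\ell_2(\mathbb N)$ and $\ell_2(\mathbb Z)$, with standard basis $(e_n)$, $N$ is the number operator $Ne_n=ne_n$ and $S$ is the left shift $Se_n=e_{n-1}$ (with $Se_0=0$ on $\ell_2(\mathbb N)$); $p_0$ is the projection onto $\mathbb C e_0$. Put $\mathcal H_\ell=\ell_2(\mathbb N)^{\otimes \ell}\otimes\ell_2(\mathbb Z)$. **The algebras $A_\ell$ and $\mathcal A_\ell^\infty$.** For $q\in[0,1)$ let $Y_{k,q}=(q^N)^{\otimes(k-1)}\otimes\sqrt{1-q^{2N}}\,S^*\otimes I^{\otimes(\ell+1-k)}$ for $1\le k\le\ell$ and $Y_{\ell+1,q}=(q^N)^{\otimes\ell}\otimes S^*$ on $\mathcal H_\ell$, where $q^N:=p_0$ if $q=0$. The $C^*$-algebra generated by $Y_{1,q},\dots,Y_{\ell+1,q}$ does not depend on $q\in[0,1)$ and is denoted $A_\ell$ (it is the image of the quantum sphere algebra $C(S_q^{2\ell+1})$ under the faithful representation $z_k\mapsto Y_{k,q}$). Define Fréchet algebras $(\mathcal A_\ell^\infty,(\|\cdot\|_m)_{m\in\mathbb N})$ inductively: $\mathcal A_0^\infty=C^\infty(\mathbb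 T)$ acting on $\ell_2(\mathbb Z)$, i.e. all $\sum_{n\in\mathbb Z}a_n\mathbf z^n$ with $(a_n)$ rapidly decreasing and $\mathbf z=S^*$ the right shift, with $\|\sum a_n\mathbf z^n\|_m=\sum(1+|n|)^m|a_n|$. For $\ell\ge1$, with $\alpha_1=Y_{1,0}^*=S\otimes I$, $\mathcal A_\ell^\infty$ is the set of all $$a=\sum_{j,k\in\mathbb N}\alpha_1^{*j}(p_0\otimes a_{jk})\alpha_1^k+\sum_{k\ge0}\lambda_k\alpha_1^k+\sum_{k>0}\lambda_{-k}\alpha_1^{*k}$$ with $a_{jk}\in\mathcal A_{\ell-1}^\infty$, $\sum_{j,k}(1+j+k)^n\|a_{jk}\|_m<\infty$ for all $n,m$, and $(\lambda_k)_{k\in\mathbb Z}$ rapidly decreasing; $\|a\|_m=\max_{r,s\le m}\big(\sum_{j,k}(1+j+k)^r\|a_{jk}\|_s\big)+\sum_{k\in\mathbb Z}(1+|k|)^m|\lambda_k|$. *)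

theory Defs
  imports "HOL-Complex_Analysis.Complex_Analysis"
begin

section \<open>The Hilbert space of square-summable complex families\<close>

typedef 'i ell2 = "{f :: 'i \<Rightarrow> complex. (\<lambda>i. (cmod (f i))\<^sup>2) summable_on UNIV}"
  morphisms coord Abs_ell2
  by (intro exI[of _ "\<lambda>_. 0"]) simp

setup_lifting type_definition_ell2

lemma coord_summable: "(\<lambda>i. (cmod (coord x i))\<^sup>2) summable_on UNIV"
  using coord[of x] by simp

lemma coord_eqI: "(\<And>i. coord x i = coord y i) \<Longrightarrow> x = y"
  by (simp add: coord_inject[symmetric] fun_eq_iff)

lemma sq_summable_add:
  fixes f g :: "'i \<Rightarrow> complex"
  assumes "(\<lambda>i. (cmod (f i))\<^sup>2) summable_on UNIV" "(\<lambda>i. (cmod (g i))\<^sup>2) summable_on UNIV"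
  shows "(\<lambda>i. (cmod (f i + g i))\<^sup>2) summable_on UNIV"
proof (rule summable_on_comparison_test)
  show "(\<lambda>i. 2 * ((cmod (f i))\<^sup>2 + (cmod (g i))\<^sup>2)) summable_on UNIV"
    by (intro summable_on_cmult_right summable_on_add assms)
  show "(cmod (f i + g i))\<^sup>2 \<le> 2 * ((cmod (f i))\<^sup>2 + (cmod (g i))\<^sup>2)" for i
  proof -
    have "(cmod (f i + g i))\<^sup>2 \<le> (cmod (f i) + cmod (g i))\<^sup>2"
      by (intro power_mono norm_triangle_ineq) simp
    also have "\<dots> \<le> 2 * ((cmod (f i))\<^sup>2 + (cmod (g i))\<^sup>2)"
      using sum_squares_bound[of "cmod (f i)" "cmod (g i)"] by (simp add: power2_sum)
    finally show ?thesis .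
  qed
qed auto

lemma sq_summable_scale:
  fixes f :: "'i \<Rightarrow> complex"
  assumes "(\<lambda>i. (cmod (f i))\<^sup>2) summable_on UNIV"
  shows "(\<lambda>i. (cmod (c * f i))\<^sup>2) summable_on UNIV"
  unfolding norm_mult power_mult_distrib by (intro summable_on_cmult_right assms)

lemma sq_summable_diff:
  fixes f g :: "'i \<Rightarrow> complex"
  assumes "(\<lambda>i. (cmod (f i))\<^sup>2) summable_on UNIV" "(\<lambda>i. (cmod (g i))\<^sup>2) summable_on UNIV"
  shows "(\<lambda>i. (cmod (f i - g i))\<^sup>2) summable_on UNIV"
  using sq_summable_add[of f "\<lambda>i. - g i"] assms by simp

lemma prod_abs_summable:
  fixes f g :: "'i \<Rightarrow> complex"
  assumes "(\<lambda>i. (cmod (f i))\<^sup>2) summable_on UNIV" "(\<lambda>i. (cmod (g i))\<^sup>2) summable_on UNIV"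
  shows "(\<lambda>i. cmod (f i) * cmod (g i)) summable_on UNIV"
proof (rule summable_on_comparison_test)
  show "(\<lambda>i. (cmod (f i))\<^sup>2 + (cmod (g i))\<^sup>2) summable_on UNIV"
    by (intro summable_on_add assms)
  show "cmod (f i) * cmod (g i) \<le> (cmod (f i))\<^sup>2 + (cmod (g i))\<^sup>2" for i
  proof -
    have "0 \<le> cmod (f i) * cmod (g i)" by simp
    then show ?thesis
      using sum_squares_bound[of "cmod (f i)" "cmod (g i)"] unfolding mult.assoc by linarith
  qed
qed auto

lemma inner_coord_summable: "(\<lambda>i. inner (coord x i) (coord y i)) summable_on UNIV"
proof (rule abs_summable_summable)
  show "(\<lambda>i. norm (inner (coord x i) (coord y i))) summable_on UNIV"
    by (rule summable_on_comparison_test[OF prod_abs_summable[OF coord_summable[of x] coord_summable[of y]]])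
       (auto simp: Cauchy_Schwarz_ineq2)
qed

instantiation ell2 :: (type) real_vector
begin
lift_definition zero_ell2 :: "'a ell2" is "\<lambda>_. 0" by simp
lift_definition plus_ell2 :: "'a ell2 \<Rightarrow> 'a ell2 \<Rightarrow> 'a ell2" is "\<lambda>f g i. f i + g i"
  unfolding mem_Collect_eq by (rule sq_summable_add)
lift_definition uminus_ell2 :: "'a ell2 \<Rightarrow> 'a ell2" is "\<lambda>f i. - f i" by simp
lift_definition minus_ell2 :: "'a ell2 \<Rightarrow> 'a ell2 \<Rightarrow> 'a ell2" is "\<lambda>f g i. f i - g i"
  unfolding mem_Collect_eq by (rule sq_summable_diff)
lift_definition scaleR_ell2 :: "real \<Rightarrow> 'a ell2 \<Rightarrow> 'a ell2" is "\<lambda>r f i. complex_of_real r * f i"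
  unfolding mem_Collect_eq by (rule sq_summable_scale)
instance
  by standard (transfer; simp add: fun_eq_iff algebra_simps)+
end

lemma coord_simps [simp]:
  "coord 0 i = 0" "coord (x + y) i = coord x i + coord y i"
  "coord (- x) i = - coord x i" "coord (x - y) i = coord x i - coord y i"
  "coord (r *\<^sub>R x) i = complex_of_real r * coord x i"
  by (transfer; simp)+

text \<open>The real inner product is the real part of the complex one, so both induce the
  \<open>\<ell>\<^sub>2\<close> norm.\<close>

instantiation ell2 :: (type) real_inner
begin
definition inner_ell2 :: "'a ell2 \<Rightarrow> 'a ell2 \<Rightarrow> real"
  where "inner_ell2 x y = (\<Sum>\<^sub>\<infinity>i. inner (coord x i) (coord y i))"
definition norm_ell2 :: "'a ell2 \<Rightarrow> real"
  where "norm_ell2 x = sqrt (inner x x)"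
definition dist_ell2 :: "'a ell2 \<Rightarrow> 'a ell2 \<Rightarrow> real"
  where "dist_ell2 x y = norm (x - y)"
definition sgn_ell2 :: "'a ell2 \<Rightarrow> 'a ell2"
  where "sgn_ell2 x = x /\<^sub>R norm x"
definition uniformity_ell2 :: "('a ell2 \<times> 'a ell2) filter"
  where "uniformity_ell2 = (INF e\<in>{0<..}. principal {(x, y). dist x y < e})"
definition open_ell2 :: "'a ell2 set \<Rightarrow> bool"
  where "open_ell2 U = (\<forall>x\<in>U. \<forall>\<^sub>F (x', y) in uniformity. x' = x \<longrightarrow> y \<in> U)"
instance
proof
  fix x y z :: "'a ell2" and r :: real and U :: "'a ell2 set"
  show "dist x y = norm (x - y)" by (rule dist_ell2_def)
  show "sgn x = x /\<^sub>R norm x" by (rule sgn_ell2_def)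
  show "uniformity = (INF e\<in>{0<..}. principal {(x::'a ell2, y). dist x y < e})"
    by (rule uniformity_ell2_def)
  show "open U = (\<forall>x\<in>U. \<forall>\<^sub>F (x', y) in uniformity. x' = x \<longrightarrow> y \<in> U)"
    by (rule open_ell2_def)
  show "norm x = sqrt (inner x x)" by (rule norm_ell2_def)
  show "inner x y = inner y x" by (simp add: inner_ell2_def inner_commute)
  show "inner (x + y) z = inner x z + inner y z"
    by (simp add: inner_ell2_def inner_add_left infsum_add inner_coord_summable)
  show "inner (r *\<^sub>R x) y = r * inner x y"
  proof -
    have "inner (complex_of_real r * a) b = r * inner a b" for a b
      by (simp add: inner_complex_def algebra_simps)
    then show ?thesis by (simp add: inner_ell2_def infsum_cmult_right')
  qed
  show "0 \<le> inner x x" by (simp add: inner_ell2_def infsum_nonneg)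
  show "inner x x = 0 \<longleftrightarrow> x = 0"
  proof
    assume "inner x x = 0"
    then have "inner (coord x i) (coord x i) = 0" for i
      unfolding inner_ell2_def
      by (intro nonneg_infsum_le_0D[where A=UNIV, OF _ inner_coord_summable]) auto
    then show "x = 0" by (intro coord_eqI) simp
  qed (simp add: inner_ell2_def)
qed
end

lemma norm_ell2_sq: "(norm x)\<^sup>2 = (\<Sum>\<^sub>\<infinity>i. (cmod (coord x i))\<^sup>2)"
  by (simp only: power2_norm_eq_inner inner_ell2_def)

lemma sum_coord_le: "finite F \<Longrightarrow> (\<Sum>i\<in>F. (cmod (coord x i))\<^sup>2) \<le> (norm x)\<^sup>2"
  unfolding norm_ell2_sq by (rule finite_sum_le_infsum[OF coord_summable]) auto

lemma norm_coord_le: "cmod (coord x i) \<le> norm x"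
  using sum_coord_le[of "{i}" x] by (simp add: power2_le_iff_abs_le)

instance ell2 :: (type) banach
proof
  fix X :: "nat \<Rightarrow> 'a ell2"
  assume X: "Cauchy X"
  have "Cauchy (\<lambda>n. coord (X n) i)" for i
  proof (rule metric_CauchyI)
    fix e :: real assume "e > 0"
    then obtain M where "\<forall>m\<ge>M. \<forall>n\<ge>M. dist (X m) (X n) < e"
      using metric_CauchyD[OF X] by blast
    moreover have "dist (coord (X m) i) (coord (X n) i) \<le> dist (X m) (X n)" for m n
      using norm_coord_le[of "X m - X n" i] by (simp add: dist_norm)
    ultimately show "\<exists>M. \<forall>m\<ge>M. \<forall>n\<ge>M. dist (coord (X m) i) (coord (X n) i) < e"
      by (meson order_le_less_trans)
  qed
  then have conv: "convergent (\<lambda>n. coord (X n) i)" for i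
    by (simp add: Cauchy_convergent_iff)
  define f where "f i = lim (\<lambda>n. coord (X n) i)" for i
  have f: "(\<lambda>n. coord (X n) i) \<longlonglongrightarrow> f i" for i
    using conv[of i] by (simp add: f_def convergent_LIMSEQ_iff)
  have fin: "(\<Sum>i\<in>F. (cmod (coord (X m) i - f i))\<^sup>2) \<le> e\<^sup>2"
    if "finite F" and M: "\<forall>n\<ge>M. dist (X m) (X n) < e" for F m M e
  proof (rule tendsto_upperbound)
    show "(\<lambda>n. \<Sum>i\<in>F. (cmod (coord (X m) i - coord (X n) i))\<^sup>2)
        \<longlonglongrightarrow> (\<Sum>i\<in>F. (cmod (coord (X m) i - f i))\<^sup>2)"
      by (intro tendsto_intros f)
    show "\<forall>\<^sub>F n in sequentially. (\<Sum>i\<in>F. (cmod (coord (X m) i - coord (X n) i))\<^sup>2) \<le> e\<^sup>2"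
      using eventually_ge_at_top[of M]
    proof eventually_elim
      case (elim n)
      have "(\<Sum>i\<in>F. (cmod (coord (X m - X n) i))\<^sup>2) \<le> (norm (X m - X n))\<^sup>2"
        by (rule sum_coord_le) fact
      also have "\<dots> \<le> e\<^sup>2"
        using M elim by (intro power_mono) (auto simp: dist_norm less_imp_le)
      finally show ?case by simp
    qed
  qed simp
  have summ: "(\<lambda>i. (cmod (coord (X m) i - f i))\<^sup>2) summable_on UNIV"
    if "\<forall>n\<ge>M. dist (X m) (X n) < e" for m M e
    by (rule nonneg_bdd_above_summable_on) (auto intro!: bdd_aboveI2[of _ _ "e\<^sup>2"] fin[OF _ that])
  obtain M0 where M0: "\<forall>m\<ge>M0. \<forall>n\<ge>M0. dist (X m) (X n) < 1"
    using metric_CauchyD[OF X zero_less_one] by blast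
  have "(\<lambda>i. (cmod (f i))\<^sup>2) summable_on UNIV"
  proof -
    have "(\<lambda>i. (cmod (coord (X M0) i - f i))\<^sup>2) summable_on UNIV"
      using summ[of M0 M0 1] M0 by simp
    then have "(\<lambda>i. (cmod (f i - coord (X M0) i))\<^sup>2) summable_on UNIV"
      by (simp add: norm_minus_commute)
    from sq_summable_add[OF this coord_summable[of "X M0"]] show ?thesis by simp
  qed
  then have cf: "coord (Abs_ell2 f) = f"
    by (simp add: Abs_ell2_inverse)
  have "X \<longlonglongrightarrow> Abs_ell2 f"
  proof (rule metric_LIMSEQ_I)
    fix e :: real assume "e > 0"
    then obtain M where M: "\<forall>m\<ge>M. \<forall>n\<ge>M. dist (X m) (X n) < e / 2"
      using metric_CauchyD[OF X, of "e / 2"] by auto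
    have "dist (X m) (Abs_ell2 f) < e" if "m \<ge> M" for m
    proof -
      have "(norm (X m - Abs_ell2 f))\<^sup>2 \<le> (e / 2)\<^sup>2"
        unfolding norm_ell2_sq using M that
        by (intro infsum_le_finite_sums coord_summable) (auto simp: cf intro!: fin[of _ M])
      then have "norm (X m - Abs_ell2 f) \<le> e / 2"
        using \<open>e > 0\<close> by (simp add: power2_le_iff_abs_le)
      then show ?thesis using \<open>e > 0\<close> by (simp add: dist_norm)
    qed
    then show "\<exists>M. \<forall>m\<ge>M. dist (X m) (Abs_ell2 f) < e" by blast
  qed
  then show "convergent X" by (auto simp: convergent_def)
qed

lemma sq_summable_delta:
  "(\<lambda>j. (cmod (if j = i then 1 else 0))\<^sup>2) summable_on UNIV"
proof -
  have "(\<lambda>j. (cmod (if j = i then 1 else 0))\<^sup>2) summable_on UNIV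
      \<longleftrightarrow> (\<lambda>j. (cmod (if j = i then 1 else 0))\<^sup>2) summable_on {i}"
    by (rule summable_on_cong_neutral) auto
  then show ?thesis by simp
qed

lift_definition ket :: "'i \<Rightarrow> 'i ell2" is "\<lambda>i j. if j = i then 1 else 0"
  unfolding mem_Collect_eq by (rule sq_summable_delta)

lift_definition cscale :: "complex \<Rightarrow> 'i ell2 \<Rightarrow> 'i ell2" is "\<lambda>c f i. c * f i"
  unfolding mem_Collect_eq by (rule sq_summable_scale)

definition cinner :: "'i ell2 \<Rightarrow> 'i ell2 \<Rightarrow> complex"
  where "cinner x y = (\<Sum>\<^sub>\<infinity>i. cnj (coord x i) * coord y i)"


section \<open>Bounded operators\<close>

text \<open>Elements of \<open>'i op\<close> are only real-linear; the complex-linear ones are singled out by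
  \<open>complex_linear\<close>. The norm is the operator norm.\<close>

type_synonym 'i op = "'i ell2 \<Rightarrow>\<^sub>L 'i ell2"

definition complex_linear :: "'i op \<Rightarrow> bool"
  where "complex_linear T \<longleftrightarrow> (\<forall>c x. T (cscale c x) = cscale c (T x))"

lemma coord_cscale [simp]: "coord (cscale c x) i = c * coord x i"
  by transfer simp

lemma norm_cscale: "norm (cscale c x) = cmod c * norm x"
proof (rule power2_eq_imp_eq)
  show "(norm (cscale c x))\<^sup>2 = (cmod c * norm x)\<^sup>2"
    by (simp add: norm_ell2_sq norm_mult power_mult_distrib infsum_cmult_right')
qed auto

lemma bounded_linear_cscale: "bounded_linear (cscale c)"
  by (rule bounded_linear_intro[where K = "cmod c"])
     (auto intro!: coord_eqI simp: algebra_simps norm_cscale)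

definition op_scale :: "complex \<Rightarrow> 'i op \<Rightarrow> 'i op" (infixr \<open>\<cdot>\<^sub>C\<close> 75)
  where "c \<cdot>\<^sub>C T = Blinfun (\<lambda>x. cscale c (T x))"

lemma op_scale_apply [simp]: "(c \<cdot>\<^sub>C T) x = cscale c (T x)"
  unfolding op_scale_def
  by (subst bounded_linear_Blinfun_apply)
     (simp_all add: bounded_linear_compose[OF bounded_linear_cscale] blinfun.bounded_linear_right)

definition adj :: "'i op \<Rightarrow> 'i op"
  where "adj T = (THE T' :: 'i op. \<forall>x y. cinner (T x) y = cinner x (T' y))"

text \<open>The bounded complex-linear operator with prescribed values on the basis vectors.\<close>

definition op_on_basis :: "('i \<Rightarrow> 'i ell2) \<Rightarrow> 'i op"
  where "op_on_basis F = (THE T. complex_linear T \<and> (\<forall>i. T (ket i) = F i))"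

definition star_subalgebra :: "'i op set \<Rightarrow> bool"
  where "star_subalgebra B \<longleftrightarrow>
    (\<forall>T\<in>B. complex_linear T) \<and> 0 \<in> B \<and>
    (\<forall>T\<in>B. \<forall>T'\<in>B. T + T' \<in> B \<and> T o\<^sub>L T' \<in> B) \<and>
    (\<forall>c. \<forall>T\<in>B. c \<cdot>\<^sub>C T \<in> B) \<and> (\<forall>T\<in>B. adj T \<in> B)"

definition cstar_generated :: "'i op set \<Rightarrow> 'i op set"
  where "cstar_generated G = \<Inter>{B. star_subalgebra B \<and> closed B \<and> G \<subseteq> B}"

definition op_power :: "'i op \<Rightarrow> 'i op \<Rightarrow> nat \<Rightarrow> 'i op"
  where "op_power u T n = (blinfun_compose T ^^ n) u"


section \<open>Tensor products\<close>

text \<open>All the spaces \<open>\<H>\<^sub>l = \<ell>\<^sub>2(\<nat>)\<^sup>\<otimes>\<^sup>l \<otimes> \<ell>\<^sub>2(\<int>)\<close> are realised inside one Hilbert space: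
  \<open>\<H>\<^sub>l\<close> is the closed span of the basis vectors indexed by pairs \<open>(ns, z)\<close> with \<open>length ns = l\<close>.
  An operator on \<open>\<H>\<^sub>l\<close> is extended by zero to the orthogonal complement; in particular
  the identity of \<open>\<H>\<^sub>l\<close> becomes the projection \<open>unit_op l\<close> below.\<close>

type_synonym idx = "nat list \<times> int"

text \<open>\<open>ell2_int_vec x\<close> is \<open>x\<close> seen in \<open>\<H>\<^sub>0\<close>, and \<open>tensor_vec x y\<close> is \<open>x \<otimes> y\<close>.\<close>

definition ell2_int_vec :: "int ell2 \<Rightarrow> idx ell2"
  where "ell2_int_vec x = Abs_ell2 (\<lambda>(ns, z). if ns = [] then coord x z else 0)"

definition tensor_vec :: "nat ell2 \<Rightarrow> idx ell2 \<Rightarrow> idx ell2"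
  where "tensor_vec x y =
    Abs_ell2 (\<lambda>(ns, z). case ns of [] \<Rightarrow> 0 | n # ms \<Rightarrow> coord x n * coord y (ms, z))"

definition ell2_int_op :: "int op \<Rightarrow> idx op"
  where "ell2_int_op T =
    op_on_basis (\<lambda>(ns, z). if ns = [] then ell2_int_vec (T (ket z)) else 0)"

definition tensor_op :: "nat op \<Rightarrow> idx op \<Rightarrow> idx op"  (infixr \<open>\<otimes>\<^sub>o\<close> 80)
  where "T \<otimes>\<^sub>o R =
    op_on_basis (\<lambda>(ns, z). case ns of [] \<Rightarrow> 0 | n # ms \<Rightarrow> tensor_vec (T (ket n)) (R (ket (ms, z))))"

definition tensor_list :: "nat op list \<Rightarrow> int op \<Rightarrow> idx op"
  where "tensor_list Ts R = foldr (\<otimes>\<^sub>o) Ts (ell2_int_op R)"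

definition unit_op :: "nat \<Rightarrow> idx op"
  where "unit_op l = tensor_list (replicate l id_blinfun) id_blinfun"


section \<open>The quantum sphere algebras\<close>

definition S_nat :: "nat op"
  where "S_nat = op_on_basis (\<lambda>n. if n = 0 then 0 else ket (n - 1))"

definition S_int :: "int op"
  where "S_int = op_on_basis (\<lambda>n. ket (n - 1))"

definition p0 :: "nat op"
  where "p0 = op_on_basis (\<lambda>n. if n = 0 then ket 0 else 0)"

text \<open>\<open>q\<^sup>N\<close>; for \<open>q = 0\<close> this is \<open>p0\<close>, because \<open>0 ^ 0 = 1\<close>.\<close>

definition q_pow_N :: "real \<Rightarrow> nat op"
  where "q_pow_N q = op_on_basis (\<lambda>n. q ^ n *\<^sub>R ket n)"

definition sqrt_one_minus_q_2N :: "real \<Rightarrow> nat op"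
  where "sqrt_one_minus_q_2N q = op_on_basis (\<lambda>n. sqrt (1 - q ^ (2 * n)) *\<^sub>R ket n)"

definition Y :: "nat \<Rightarrow> real \<Rightarrow> nat \<Rightarrow> idx op"
  where "Y l q k =
    (if k \<le> l
     then tensor_list
       (replicate (k - 1) (q_pow_N q) @ [sqrt_one_minus_q_2N q o\<^sub>L adj S_nat]
          @ replicate (l - k) id_blinfun) id_blinfun
     else tensor_list (replicate l (q_pow_N q)) (adj S_int))"

definition sphere_cstar :: "nat \<Rightarrow> real \<Rightarrow> idx op set"
  where "sphere_cstar l q = cstar_generated (Y l q ` {1..l + 1})"


section \<open>The smooth subalgebras\<close>

definition rapidly_decreasing :: "(int \<Rightarrow> complex) \<Rightarrow> bool"
  where "rapidly_decreasing c \<longleftrightarrow> (\<forall>m::nat. \<exists>C. \<forall>n. (1 + \<bar>real_of_int n\<bar>) ^ m * cmod (c n) \<le> C)"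

definition weighted_sum :: "nat \<Rightarrow> (int \<Rightarrow> complex) \<Rightarrow> real"
  where "weighted_sum m c = (\<Sum>\<^sub>\<infinity>n. (1 + \<bar>real_of_int n\<bar>) ^ m * cmod (c n))"

definition z_pow :: "int \<Rightarrow> idx op"
  where "z_pow n = (let z = ell2_int_op (adj S_int) in
    if 0 \<le> n then op_power (unit_op 0) z (nat n) else op_power (unit_op 0) (adj z) (nat (- n)))"

definition fourier_expansion :: "(int \<Rightarrow> complex) \<Rightarrow> idx op \<Rightarrow> bool"
  where "fourier_expansion c a \<longleftrightarrow> rapidly_decreasing c \<and> a = (\<Sum>\<^sub>\<infinity>n. c n \<cdot>\<^sub>C z_pow n)"

text \<open>The series defining the elements of the algebra at level \<open>l + 1\<close>, where \<open>(A, nrm)\<close> is the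
  algebra at level \<open>l\<close> with its seminorms. The decay conditions make all three series
  (and the one above) absolutely convergent in operator norm; the coefficients
  \<open>b\<close> and \<open>c\<close> are determined by \<open>a\<close>, so the seminorms below are well defined.\<close>

definition double_sum :: "(nat \<Rightarrow> idx op \<Rightarrow> real) \<Rightarrow> nat \<Rightarrow> nat \<Rightarrow> (nat \<Rightarrow> nat \<Rightarrow> idx op) \<Rightarrow> real"
  where "double_sum nrm r s b = (\<Sum>\<^sub>\<infinity>(j, k). (1 + real j + real k) ^ r * nrm s (b j k))"

definition toeplitz_expansion ::
  "nat \<Rightarrow> idx op set \<Rightarrow> (nat \<Rightarrow> idx op \<Rightarrow> real) \<Rightarrow> (nat \<Rightarrow> nat \<Rightarrow> idx op) \<Rightarrow> (int \<Rightarrow> complex)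
     \<Rightarrow> idx op \<Rightarrow> bool"
  where "toeplitz_expansion l A nrm b c a \<longleftrightarrow>
    (\<forall>j k. b j k \<in> A) \<and>
    (\<forall>n m. (\<lambda>(j, k). (1 + real j + real k) ^ n * nrm m (b j k)) summable_on UNIV) \<and>
    rapidly_decreasing c \<and>
    (let \<alpha> = S_nat \<otimes>\<^sub>o unit_op l; pw = op_power (unit_op (l + 1)) in
      a = (\<Sum>\<^sub>\<infinity>(j, k). pw (adj \<alpha>) j o\<^sub>L (p0 \<otimes>\<^sub>o b j k) o\<^sub>L pw \<alpha> k)
        + (\<Sum>\<^sub>\<infinity>k. c (int k) \<cdot>\<^sub>C pw \<alpha> k)
        + (\<Sum>\<^sub>\<infinity>k\<in>{0<..}. c (- int k) \<cdot>\<^sub>C pw (adj \<alpha>) k))"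

primrec smooth_data :: "nat \<Rightarrow> idx op set \<times> (nat \<Rightarrow> idx op \<Rightarrow> real)"
  where
    "smooth_data 0 =
      ({a. \<exists>c. fourier_expansion c a},
       \<lambda>m a. THE r. \<exists>c. fourier_expansion c a \<and> r = weighted_sum m c)"
  | "smooth_data (Suc l) = (case smooth_data l of (A, nrm) \<Rightarrow>
      ({a. \<exists>b c. toeplitz_expansion l A nrm b c a},
       \<lambda>m a. THE r. \<exists>b c. toeplitz_expansion l A nrm b c a \<and>
         r = Max {double_sum nrm r s b | r s. r \<le> m \<and> s \<le> m} + weighted_sum m c))"

definition smooth_algebra :: "nat \<Rightarrow> idx op set"
  where "smooth_algebra l = fst (smooth_data l)"

definition smooth_norm :: "nat \<Rightarrow> nat \<Rightarrow> idx op \<Rightarrow> real"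
  where "smooth_norm l = snd (smooth_data l)"


section \<open>Frechet \<open>*\<close>-algebras and holomorphic functional calculus\<close>

definition frechet_star_algebra :: "'i op set \<Rightarrow> (nat \<Rightarrow> 'i op \<Rightarrow> real) \<Rightarrow> bool"
  where "frechet_star_algebra A nrm \<longleftrightarrow>
    star_subalgebra A \<and>
    (\<forall>m. \<forall>a\<in>A. \<forall>b\<in>A. nrm m (a + b) \<le> nrm m a + nrm m b) \<and>
    (\<forall>m c. \<forall>a\<in>A. nrm m (c \<cdot>\<^sub>C a) = cmod c * nrm m a) \<and>
    (\<forall>a\<in>A. (\<forall>m. nrm m a = 0) \<longrightarrow> a = 0) \<and>
    (\<forall>X :: nat \<Rightarrow> 'i op. range X \<subseteq> A \<longrightarrow>
       (\<forall>m. \<forall>e>0. \<exists>M. \<forall>i\<ge>M. \<forall>j\<ge>M. nrm m (X i - X j) < e) \<longrightarrow>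
       (\<exists>a\<in>A. \<forall>m. (\<lambda>i. nrm m (X i - a)) \<longlonglongrightarrow> 0)) \<and>
    (\<forall>m. \<exists>m' C. \<forall>a\<in>A. \<forall>b\<in>A. nrm m (a o\<^sub>L b) \<le> C * nrm m' a * nrm m' b) \<and>
    (\<forall>m. \<exists>m' C. \<forall>a\<in>A. nrm m (adj a) \<le> C * nrm m' a)"

text \<open>Below, \<open>B\<close> is an algebra of operators with unit \<open>u\<close> (not necessarily the identity of the
  ambient space).\<close>

definition inverse_in :: "'i op set \<Rightarrow> 'i op \<Rightarrow> 'i op \<Rightarrow> 'i op \<Rightarrow> bool"
  where "inverse_in B u a b \<longleftrightarrow> b \<in> B \<and> a o\<^sub>L b = u \<and> b o\<^sub>L a = u"

definition spectrum_in :: "'i op set \<Rightarrow> 'i op \<Rightarrow> 'i op \<Rightarrow> complex set"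
  where "spectrum_in B u a = {z. \<nexists>b. inverse_in B u (z \<cdot>\<^sub>C u - a) b}"

definition resolvent_in :: "'i op set \<Rightarrow> 'i op \<Rightarrow> 'i op \<Rightarrow> complex \<Rightarrow> 'i op"
  where "resolvent_in B u a z = (THE b. inverse_in B u (z \<cdot>\<^sub>C u - a) b)"

text \<open>\<open>\<Gamma>\<close> is a finite cycle in \<open>U - K\<close> winding once around each point of \<open>K\<close> and
  not at all around the points outside \<open>U\<close>.\<close>

definition surrounding_cycle :: "complex set \<Rightarrow> complex set \<Rightarrow> (real \<Rightarrow> complex) list \<Rightarrow> bool"
  where "surrounding_cycle U K \<Gamma> \<longleftrightarrow>
    (\<forall>\<gamma>\<in>set \<Gamma>. valid_path \<gamma> \<and> pathfinish \<gamma> = pathstart \<gamma> \<and> path_image \<gamma> \<subseteq> U - K) \<and>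
    (\<forall>z\<in>K. (\<Sum>\<gamma>\<leftarrow>\<Gamma>. winding_number \<gamma> z) = 1) \<and>
    (\<forall>z\<in>- U. (\<Sum>\<gamma>\<leftarrow>\<Gamma>. winding_number \<gamma> z) = 0)"

text \<open>\<open>f(a) = 1 / (2 \<pi> \<i>) \<integral>\<^sub>\<Gamma> f(z) (z - a)\<inverse> dz\<close>, with the contour integral written out as for
  \<open>contour_integral\<close>, which is restricted to complex-valued integrands.\<close>

definition holomorphic_calculus ::
  "'i op set \<Rightarrow> 'i op \<Rightarrow> 'i op \<Rightarrow> (complex \<Rightarrow> complex) \<Rightarrow> (real \<Rightarrow> complex) list \<Rightarrow> 'i op"
  where "holomorphic_calculus B u a f \<Gamma> =
    (1 / (2 * of_real pi * \<i>)) \<cdot>\<^sub>C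
      (\<Sum>\<gamma>\<leftarrow>\<Gamma>. integral {0..1}
         (\<lambda>t. (f (\<gamma> t) * vector_derivative \<gamma> (at t within {0..1})) \<cdot>\<^sub>C resolvent_in B u a (\<gamma> t)))"

definition closed_under_holomorphic_calculus :: "'i op set \<Rightarrow> 'i op \<Rightarrow> 'i op set \<Rightarrow> bool"
  where "closed_under_holomorphic_calculus B u A \<longleftrightarrow>
    (\<forall>a\<in>A. \<forall>f U \<Gamma>. open U \<longrightarrow> spectrum_in B u a \<subseteq> U \<longrightarrow> f holomorphic_on U \<longrightarrow>
       surrounding_cycle U (spectrum_in B u a) \<Gamma> \<longrightarrow> holomorphic_calculus B u a f \<Gamma> \<in> A)"

end

theory Submission
  imports Defs
begin

text \<open>The algebra \<open>\<A>\<^sub>l\<^sup>\<infinity>\<close> is characterised by commutator estimates. Let \<open>N\<^sub>i\<close> be the number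
  operator of the \<open>i\<close>-th leg and \<open>\<alpha>\<^sub>r\<close> the shift on the \<open>r\<close>-th leg. Then \<open>x\<close> is smooth iff it commutes
  with the shift of the last leg, all iterated commutators with the \<open>N\<^sub>i\<close> are bounded, and for
  \<open>y = [\<alpha>\<^sub>r, x]\<close> and \<open>y = [\<alpha>\<^sub>r\<^sup>*, x]\<close>, as well as for the commutator \<open>y\<close> of \<open>x\<close> with the number operator
  of the last leg, the same holds even after multiplying \<open>y\<close> by powers of those \<open>N\<^sub>i\<close> with \<open>i \<le> r\<close>
  (respectively, of all but the last). Truncating the \<open>N\<^sub>i\<close> to bounded operators, uniformly in the
  truncation, avoids unbounded operators altogether.

  Such estimates pass to products, adjoints and norm limits, and to inverses because
  \<open>[g, b] = - b [g, a] b\<close> for \<open>b = a\<^sup>-\<^sup>1\<close>. This gives the Frechet algebra structure and inverse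
  closedness at once; a contour integral stays in the algebra because each estimate describes a
  closed convex set.

  For the characterisation write \<open>x\<close> as a matrix \<open>(x\<^sub>j\<^sub>k)\<close> over the first leg. The estimate for
  \<open>[\<alpha>\<^sub>1\<^sup>*, x]\<close> says that \<open>x\<^sub>j\<^sub>k - x\<^sub>j\<^sub>+\<^sub>1\<^sub>,\<^sub>k\<^sub>+\<^sub>1\<close> decays rapidly, so that the limits along the diagonals exist;
  the remaining estimates force them to be scalars \<open>\<lambda>\<^sub>k\<^sub>-\<^sub>j\<close>, and \<open>x\<^sub>j\<^sub>k - \<lambda>\<^sub>k\<^sub>-\<^sub>j\<close> is smooth one level below with
  rapidly decreasing bounds.\<close>


section \<open>Square-summable families and operators\<close>

text \<open>The weights stop at leg r because of how the expansions nest. At level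
  \<open>Suc l\<close> the terms \<lambda>_k \<alpha>_1^k and their adjoints commute with everything
  that acts on later legs only, so a commutator with such an operator sees only the terms p0
  \<otimes> a_jk, which decay in leg 1. Repeating this inside a_jk, a commutator with the shift of
  leg r (whose commutator with powers of its adjoint is a finite matrix in that leg) leaves decay in
  the legs 1, ..., r, and one with the number operator of the last leg leaves decay in all other
  legs. The seminorms are THE-terms over all expansions of an element, so uniqueness of the
  coefficients has to travel along with the estimates. The induction on l therefore carries a
  two-sided comparison: every estimate is controlled by some seminorm and every seminorm by some
  estimate, with constants independent of the element. This uniformity is needed for the
  truncations, for the sum over all blocks, and along a contour, where uncountably many resolvents
  must share one bound.\<close>

lemma coord_ket: "coord (ket i) j = (if j = i then 1 else 0)"
  by transfer simp

lemma bounded_linear_coord: "bounded_linear (\<lambda>x. coord x i)"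
  by (rule bounded_linear_intro[where K = 1]) (auto simp: norm_coord_le scaleR_conv_of_real)

lemma coord_sum: "coord (\<Sum>k\<in>F. f k) i = (\<Sum>k\<in>F. coord (f k) i)"
  by (induction F rule: infinite_finite_induct) auto

lemma cscale_simps [simp]:
  "cscale 1 x = x" "cscale 0 x = 0" "cscale c 0 = 0" "cscale c (cscale d x) = cscale (c * d) x"
  "cscale c (x + y) = cscale c x + cscale c y" "cscale c (x - y) = cscale c x - cscale c y"
  "cscale c (- x) = - cscale c x"
  by (auto intro!: coord_eqI simp: algebra_simps)

lemma cscale_of_real: "cscale (of_real r) x = r *\<^sub>R x"
  by (auto intro!: coord_eqI)

text \<open>For a finite set F of indices, the squared norm of the remainder is the part of the
  convergent sum of |x_i|^2 that lies outside F.\<close>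

lemma ket_expansion: "((\<lambda>i. cscale (coord x i) (ket i)) has_sum x) UNIV"
proof -
  define g where "g i = (cmod (coord x i))\<^sup>2" for i
  have sg: "g summable_on UNIV" unfolding g_def by (rule coord_summable)
  have n: "(norm (x - (\<Sum>i\<in>F. cscale (coord x i) (ket i))))\<^sup>2 = infsum g UNIV - sum g F"
    if "finite F" for F
  proof -
    have c: "coord (x - (\<Sum>i\<in>F. cscale (coord x i) (ket i))) j = (if j \<in> F then 0 else coord x j)" for j
      using that by (simp add: coord_sum coord_ket if_distrib[of "\<lambda>y. _ * y"] cong: if_cong)
    have "(norm (x - (\<Sum>i\<in>F. cscale (coord x i) (ket i))))\<^sup>2 = infsum (\<lambda>j. if j \<in> F then 0 else g j) UNIV"
      unfolding norm_ell2_sq c by (intro infsum_cong) (auto simp: g_def)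
    also have "\<dots> = infsum g (UNIV - F)"
      by (rule infsum_cong_neutral) auto
    also have "\<dots> = infsum g UNIV - infsum g F"
      by (rule infsum_Diff) (use sg that in auto)
    finally show ?thesis using that by simp
  qed
  have "(sum g \<longlongrightarrow> infsum g UNIV) (finite_subsets_at_top UNIV)"
    using has_sum_infsum[OF sg] by (simp add: has_sum_def)
  then have "((\<lambda>F. sqrt (infsum g UNIV - sum g F)) \<longlongrightarrow> sqrt (infsum g UNIV - infsum g UNIV)) (finite_subsets_at_top UNIV)"
    by (intro tendsto_intros)
  then have "((\<lambda>F. sqrt (infsum g UNIV - sum g F)) \<longlongrightarrow> 0) (finite_subsets_at_top UNIV)" by simp
  moreover have "\<forall>\<^sub>F F in finite_subsets_at_top UNIV. sqrt (infsum g UNIV - sum g F) = norm (x - (\<Sum>i\<in>F. cscale (coord x i) (ket i)))"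
    by (rule eventually_finite_subsets_at_top_weakI) (simp add: n[symmetric])
  ultimately have "((\<lambda>F. norm (x - (\<Sum>i\<in>F. cscale (coord x i) (ket i)))) \<longlongrightarrow> 0) (finite_subsets_at_top UNIV)"
    by (rule Lim_transform_eventually)
  then have "((\<lambda>F. x - (\<Sum>i\<in>F. cscale (coord x i) (ket i))) \<longlongrightarrow> 0) (finite_subsets_at_top UNIV)"
    by (rule tendsto_norm_zero_cancel)
  from tendsto_diff[OF tendsto_const[of x] this] show ?thesis
    unfolding has_sum_def by simp
qed

lemma cinner_summable: "(\<lambda>i. cnj (coord x i) * coord y i) summable_on UNIV"
proof (rule abs_summable_summable)
  show "(\<lambda>i. norm (cnj (coord x i) * coord y i)) summable_on UNIV"
    using prod_abs_summable[OF coord_summable[of x] coord_summable[of y]] by (simp add: norm_mult)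
qed

lemma cinner_add_left: "cinner (x + y) z = cinner x z + cinner y z"
  unfolding cinner_def by (subst infsum_add[symmetric]) (auto simp: distrib_right intro!: cinner_summable)

lemma cinner_add_right: "cinner z (x + y) = cinner z x + cinner z y"
  unfolding cinner_def by (subst infsum_add[symmetric]) (auto simp: distrib_left intro!: cinner_summable)

lemma cinner_scale_left: "cinner (cscale c x) z = cnj c * cinner x z"
  by (simp add: cinner_def mult.assoc infsum_cmult_right')

lemma cinner_scale_right: "cinner z (cscale c x) = c * cinner z x"
  by (simp add: cinner_def mult.left_commute[of _ c] infsum_cmult_right')

lemma Re_cinner: "Re (cinner x y) = inner x y"
proof -
  have "Re (cinner x y) = (\<Sum>\<^sub>\<infinity>i. Re (cnj (coord x i) * coord y i))"
    unfolding cinner_def by (rule infsum_Re[symmetric]) (rule cinner_summable)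
  then show ?thesis by (simp add: inner_ell2_def inner_complex_def)
qed

text \<open>The real Cauchy-Schwarz inequality bounds only the real part; rotating x by a phase of
  modulus one makes \<open>cinner x y\<close> real and nonnegative.\<close>

lemma cinner_bound: "cmod (cinner x y) \<le> norm x * norm y"
proof (cases "cinner x y = 0")
  case False
  define c where "c = cnj (sgn (cinner x y))"
  have "cnj (sgn z) * z = of_real (cmod z)" for z
    by (cases "z = 0") (auto simp: sgn_div_norm scaleR_conv_of_real mult.commute[of "cnj z"]
      complex_norm_square[symmetric] power2_eq_square field_simps)
  then have "cmod (cinner x y) = Re (cinner (cscale (cnj c) x) y)"
    by (simp add: cinner_scale_left c_def)
  also have "\<dots> \<le> norm (cscale (cnj c) x) * norm y"
    unfolding Re_cinner by (rule norm_cauchy_schwarz)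
  also have "\<dots> = norm x * norm y"
    using False by (simp add: norm_cscale c_def norm_sgn)
  finally show ?thesis .
qed simp

lemma cinner_ket_left: "cinner (ket i) y = coord y i"
proof -
  have "cinner (ket i) y = (\<Sum>\<^sub>\<infinity>j\<in>{i}. coord y j)"
    unfolding cinner_def by (rule infsum_cong_neutral) (auto simp: coord_ket)
  then show ?thesis by simp
qed

lemma bounded_linear_cinner_left: "bounded_linear (\<lambda>x. cinner x y)"
proof (rule bounded_linear_intro[where K = "norm y"])
  show "cinner (r *\<^sub>R x) y = r *\<^sub>R cinner x y" for r x
    using cinner_scale_left[of "of_real r" x y] by (simp add: cscale_of_real scaleR_conv_of_real)
qed (auto simp: cinner_add_left cinner_bound)

section \<open>Matrix entries and complex-linear operators\<close>

definition ent :: "'i op \<Rightarrow> 'i \<Rightarrow> 'i \<Rightarrow> complex"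
  where "ent T i j = coord (T (ket j)) i"

lemma complex_linearD: "complex_linear T \<Longrightarrow> T (cscale c x) = cscale c (T x)"
  by (simp add: complex_linear_def)

lemma op_has_sum:
  fixes T :: "'i op"
  assumes "complex_linear T"
  shows "((\<lambda>j. cscale (coord x j) (T (ket j))) has_sum T x) UNIV"
  using has_sum_bounded_linear[OF blinfun.bounded_linear_right[of T] ket_expansion[of x]]
  by (simp add: complex_linearD[OF assms])

lemma op_ket_eqI:
  fixes T R :: "'i op"
  assumes "complex_linear T" "complex_linear R" "\<And>j. T (ket j) = R (ket j)"
  shows "T = R"
proof (rule blinfun_eqI)
  fix x
  show "T x = R x"
    using op_has_sum[OF assms(1), of x] op_has_sum[OF assms(2), of x]
    by (simp add: assms(3) has_sum_unique)
qed

lemma op_eqI: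
  fixes T R :: "'i op"
  assumes "complex_linear T" "complex_linear R" "\<And>i j. ent T i j = ent R i j"
  shows "T = R"
  using assms(1,2) by (rule op_ket_eqI) (auto intro!: coord_eqI simp: assms(3)[unfolded ent_def])

text \<open>\<open>op_on_basis\<close> is a THE-term, so each operator built with it has to be
  recognised by exhibiting a bounded complex-linear operator with the same values on the basis; by
  \<open>op_has_sum\<close> these values determine the operator.\<close>

lemma op_on_basis_eqI:
  assumes "complex_linear T" "\<And>i. T (ket i) = F i"
  shows "op_on_basis F = T"
  unfolding op_on_basis_def
  by (rule the_equality) (use assms op_ket_eqI in \<open>auto intro: op_ket_eqI\<close>)

lemma complex_linear_simps [simp, intro]:
  "complex_linear 0" "complex_linear id_blinfun"
  "complex_linear T \<Longrightarrow> complex_linear R \<Longrightarrow> complex_linear (T + R)"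
  "complex_linear T \<Longrightarrow> complex_linear R \<Longrightarrow> complex_linear (T - R)"
  "complex_linear T \<Longrightarrow> complex_linear R \<Longrightarrow> complex_linear (T o\<^sub>L R)"
  "complex_linear T \<Longrightarrow> complex_linear (- T)"
  "complex_linear T \<Longrightarrow> complex_linear (c \<cdot>\<^sub>C T)"
  by (auto simp: complex_linear_def blinfun.add_left blinfun.diff_left blinfun.minus_left mult.commute)

lemma op_scale_of_real: "of_real r \<cdot>\<^sub>C T = r *\<^sub>R T"
  by (rule blinfun_eqI) (simp add: cscale_of_real blinfun.scaleR_left)

lemma complex_linear_sum [intro]:
  "(\<And>k. k \<in> F \<Longrightarrow> complex_linear (f k)) \<Longrightarrow> complex_linear (\<Sum>k\<in>F. f k)"
  by (induction F rule: infinite_finite_induct) auto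

lemma complex_linear_scaleR [simp, intro]: "complex_linear T \<Longrightarrow> complex_linear (r *\<^sub>R T)"
  by (metis complex_linear_simps(7) op_scale_of_real)

lemma op_scale_simps [simp]:
  "1 \<cdot>\<^sub>C T = T" "0 \<cdot>\<^sub>C T = 0" "c \<cdot>\<^sub>C 0 = 0" "c \<cdot>\<^sub>C d \<cdot>\<^sub>C T = (c * d) \<cdot>\<^sub>C T"
  by (rule blinfun_eqI; simp)+

lemma op_scale_distrib:
  "c \<cdot>\<^sub>C (T + R) = c \<cdot>\<^sub>C T + c \<cdot>\<^sub>C R" "c \<cdot>\<^sub>C (T - R) = c \<cdot>\<^sub>C T - c \<cdot>\<^sub>C R"
  "(c + d) \<cdot>\<^sub>C T = c \<cdot>\<^sub>C T + d \<cdot>\<^sub>C T" "(c - d) \<cdot>\<^sub>C T = c \<cdot>\<^sub>C T - d \<cdot>\<^sub>C T"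
  "(- c) \<cdot>\<^sub>C T = - (c \<cdot>\<^sub>C T)"
  by (rule blinfun_eqI, auto intro!: coord_eqI simp: blinfun.add_left blinfun.diff_left blinfun.minus_left algebra_simps)+

lemma op_scale_compose_left: "(c \<cdot>\<^sub>C T) o\<^sub>L R = c \<cdot>\<^sub>C (T o\<^sub>L R)"
  by (rule blinfun_eqI) simp

lemma op_scale_compose_right: "complex_linear T \<Longrightarrow> T o\<^sub>L (c \<cdot>\<^sub>C R) = c \<cdot>\<^sub>C (T o\<^sub>L R)"
  by (rule blinfun_eqI) (simp add: complex_linearD)

lemma norm_op_scale_le: "norm (c \<cdot>\<^sub>C T) \<le> cmod c * norm T"
  by (rule norm_blinfun_bound)
     (auto simp: norm_cscale mult.assoc intro!: mult_left_mono norm_blinfun)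

lemma bounded_linear_op_scale: "bounded_linear (\<lambda>T. c \<cdot>\<^sub>C T)"
proof (rule bounded_linear_intro[where K = "cmod c"])
  show "c \<cdot>\<^sub>C (r *\<^sub>R T) = r *\<^sub>R (c \<cdot>\<^sub>C T)" for r T
    by (simp add: op_scale_of_real[symmetric] mult.commute)
qed (use norm_op_scale_le in \<open>auto simp: op_scale_distrib mult.commute\<close>)

lemma bounded_linear_op_scale_left: "bounded_linear (\<lambda>c. c \<cdot>\<^sub>C T)"
proof (rule bounded_linear_intro[where K = "norm T"])
  show "(r *\<^sub>R c) \<cdot>\<^sub>C T = r *\<^sub>R (c \<cdot>\<^sub>C T)" for r c
    by (simp add: op_scale_of_real[symmetric] scaleR_conv_of_real)
qed (use norm_op_scale_le in \<open>auto simp: op_scale_distrib\<close>)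

lemma norm_compose: "norm (T o\<^sub>L R) \<le> norm T * norm R"
  by (rule norm_blinfun_compose)

lemma bounded_linear_compose_left: "bounded_linear (\<lambda>T. T o\<^sub>L R)"
  by (rule bounded_bilinear.bounded_linear_left[OF bounded_bilinear_blinfun_compose])

lemma bounded_linear_compose_right: "bounded_linear (\<lambda>R. T o\<^sub>L R)"
  by (rule bounded_bilinear.bounded_linear_right[OF bounded_bilinear_blinfun_compose])

lemmas compose_distrib =
  bounded_bilinear.add_left[OF bounded_bilinear_blinfun_compose]
  bounded_bilinear.add_right[OF bounded_bilinear_blinfun_compose]
  bounded_bilinear.diff_left[OF bounded_bilinear_blinfun_compose]
  bounded_bilinear.diff_right[OF bounded_bilinear_blinfun_compose]
  bounded_bilinear.minus_left[OF bounded_bilinear_blinfun_compose]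
  bounded_bilinear.minus_right[OF bounded_bilinear_blinfun_compose]
  bounded_bilinear.scaleR_left[OF bounded_bilinear_blinfun_compose]
  bounded_bilinear.scaleR_right[OF bounded_bilinear_blinfun_compose]
  bounded_bilinear.zero_left[OF bounded_bilinear_blinfun_compose]
  bounded_bilinear.zero_right[OF bounded_bilinear_blinfun_compose]

lemma compose_assoc: "(T o\<^sub>L R) o\<^sub>L Q = T o\<^sub>L (R o\<^sub>L Q)"
  by (rule blinfun_eqI) simp

lemma closed_complex_linear: "closed {T :: 'i op. complex_linear T}"
proof -
  have "{T :: 'i op. complex_linear T} = (\<Inter>c. \<Inter>x. {T :: 'i op. T (cscale c x) = cscale c (T x)})"
    by (auto simp: complex_linear_def)
  moreover have "closed {T :: 'i op. T (cscale c x) = cscale c (T x)}" for c x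
    by (intro closed_Collect_eq continuous_intros bounded_linear.continuous_on[OF bounded_linear_cscale])
  ultimately show ?thesis by (metis (no_types, lifting) closed_INT)
qed

lemma bounded_linear_ent: "bounded_linear (\<lambda>T. ent T i j)"
  unfolding ent_def
  by (rule bounded_linear_compose[OF bounded_linear_coord blinfun.bounded_linear_left])

lemma ent_simps [simp]:
  "ent 0 i j = 0" "ent (T + R) i j = ent T i j + ent R i j" "ent (T - R) i j = ent T i j - ent R i j"
  "ent (- T) i j = - ent T i j" "ent (c \<cdot>\<^sub>C T) i j = c * ent T i j"
  "ent id_blinfun i j = (if i = j then 1 else 0)"
  by (auto simp: ent_def blinfun.add_left blinfun.diff_left blinfun.minus_left coord_ket)

lemma norm_ket [simp]: "norm (ket i) = 1"
proof -
  have "(norm (ket i))\<^sup>2 = Re (cinner (ket i) (ket i))"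
    by (simp add: Re_cinner power2_norm_eq_inner)
  then have "(norm (ket i))\<^sup>2 = 1\<^sup>2" by (simp add: cinner_ket_left coord_ket)
  then show ?thesis by (metis norm_ge_zero power2_eq_imp_eq zero_le_one)
qed

lemma norm_ent_le: "cmod (ent T i j) \<le> norm T"
  unfolding ent_def using norm_coord_le[of "T (ket j)" i] norm_blinfun[of T "ket j"] by simp


section \<open>Adjoints\<close>

lemma cinner_eqI: "(\<And>z. cinner z x = cinner z y) \<Longrightarrow> x = y"
  by (rule coord_eqI) (metis cinner_ket_left)

lemma adj_eqI:
  fixes T R :: "'i op"
  assumes "\<And>x y. cinner (T x) y = cinner x (R y)"
  shows "adj T = R"
  unfolding adj_def
proof (rule the_equality)
  fix R' :: "'i op" assume "\<forall>x y. cinner (T x) y = cinner x (R' y)"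
  then show "R' = R" by (intro blinfun_eqI cinner_eqI) (metis assms)
qed (use assms in blast)

text \<open>The adjoint is built coordinatewise: its k-th coordinate at y has to be
  \<open>cinner (T (ket k)) y\<close>, and what needs proof is that these numbers are
  square-summable.\<close>

lemma ex_adj:
  fixes T :: "'i op"
  assumes T: "complex_linear T"
  shows "\<exists>R :: 'i op. (\<forall>x y. cinner (T x) y = cinner x (blinfun_apply R y)) \<and> norm R \<le> norm T"
proof -
  define f where "f y k = cinner (T (ket k)) y" for y k
  have fin: "(\<Sum>k\<in>F. (cmod (f y k))\<^sup>2) \<le> (norm T * norm y)\<^sup>2" if F: "finite F" for F y
  proof -
    \<comment> \<open>Test T on the vector v whose coordinates on F are the wanted ones: |v|^2 =
      \<open>cinner (T v) y\<close> \<le> |T| |v| |y|, and one factor |v| cancels.\<close>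
    define v where "v = (\<Sum>k\<in>F. cscale (f y k) (ket k))"
    define s where "s = (\<Sum>k\<in>F. (cmod (f y k))\<^sup>2)"
    have s0: "s \<ge> 0" by (simp add: s_def sum_nonneg)
    have cv: "coord v j = (if j \<in> F then f y j else 0)" for j
      using F by (simp add: v_def coord_sum coord_ket if_distrib[of "\<lambda>y. _ * y"] cong: if_cong)
    have "(norm v)\<^sup>2 = (\<Sum>\<^sub>\<infinity>j\<in>F. (cmod (f y j))\<^sup>2)"
      unfolding norm_ell2_sq by (rule infsum_cong_neutral) (auto simp: cv)
    then have nv: "(norm v)\<^sup>2 = s" using F by (simp add: s_def)
    have "T v = (\<Sum>k\<in>F. cscale (f y k) (T (ket k)))"
      by (simp add: v_def blinfun.sum_right complex_linearD[OF T])
    then have "cinner (T v) y = (\<Sum>k\<in>F. cnj (f y k) * f y k)"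
      by (simp add: linear_sum[OF bounded_linear.linear[OF bounded_linear_cinner_left]] cinner_scale_left f_def)
    also have "\<dots> = of_real s"
      unfolding s_def of_real_sum by (intro sum.cong refl) (simp only: complex_norm_square mult.commute)
    finally have "s \<le> norm (T v) * norm y"
      using cinner_bound[of "T v" y] s0 by simp
    also have "\<dots> \<le> norm T * norm v * norm y"
      by (intro mult_right_mono norm_blinfun) simp
    finally have le: "s \<le> norm v * (norm T * norm y)" by (simp add: mult_ac)
    show ?thesis
    proof (cases "norm v = 0")
      case True
      then show ?thesis using nv by (simp add: s_def[symmetric])
    next
      case False
      then have "norm v * norm v \<le> norm v * (norm T * norm y)"
        using le nv by (simp add: power2_eq_square)
      then have "norm v \<le> norm T * norm y" using False by simp
      then have "(norm v)\<^sup>2 \<le> (norm T * norm y)\<^sup>2" by (intro power_mono) auto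
      then show ?thesis using nv by (simp add: s_def)
    qed
  qed
  have sm: "(\<lambda>k. (cmod (f y k))\<^sup>2) summable_on UNIV" for y
    by (rule nonneg_bdd_above_summable_on) (auto intro!: bdd_aboveI2 fin)
  define R where "R y = Abs_ell2 (f y)" for y
  have cR: "coord (R y) = f y" for y using sm[of y] by (simp add: R_def Abs_ell2_inverse)
  have "norm (R y) \<le> norm y * norm T" for y
  proof -
    have "(norm (R y))\<^sup>2 \<le> (norm T * norm y)\<^sup>2"
      unfolding norm_ell2_sq cR by (intro infsum_le_finite_sums sm fin)
    then show ?thesis by (metis mult.commute mult_nonneg_nonneg norm_ge_zero power2_le_imp_le)
  qed
  moreover have "R (x + y) = R x + R y" for x y
    by (rule coord_eqI) (simp add: cR f_def cinner_add_right)
  moreover have "R (r *\<^sub>R x) = r *\<^sub>R R x" for r x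
    by (rule coord_eqI) (simp add: cR f_def cscale_of_real[symmetric] cinner_scale_right)
  ultimately have bl: "bounded_linear R" and nR: "onorm R \<le> norm T"
    by (auto intro!: bounded_linear_intro[where K = "norm T"] onorm_bound) (simp_all add: mult.commute)
  have "cinner (T x) y = cinner x (R y)" for x y
  proof -
    have "((\<lambda>j. cinner (cscale (coord x j) (T (ket j))) y) has_sum cinner (T x) y) UNIV"
      by (rule has_sum_bounded_linear[OF bounded_linear_cinner_left op_has_sum[OF T]])
    then have "cinner (T x) y = (\<Sum>\<^sub>\<infinity>j. cinner (cscale (coord x j) (T (ket j))) y)"
      by (simp add: infsumI)
    then show ?thesis by (simp add: cinner_scale_left cinner_def[of x] cR f_def)
  qed
  with bl nR show ?thesis
    by (intro exI[of _ "Blinfun R"]) (simp add: bounded_linear_Blinfun_apply norm_blinfun.rep_eq)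
qed

lemma cinner_adj: "complex_linear T \<Longrightarrow> cinner (T x) y = cinner x (adj T y)"
  using ex_adj adj_eqI by metis

lemma norm_adj_le: "complex_linear T \<Longrightarrow> norm (adj T) \<le> norm T"
  using ex_adj adj_eqI by metis

lemma complex_linear_adj [simp, intro]:
  assumes "complex_linear T" shows "complex_linear (adj T)"
  unfolding complex_linear_def
  by (intro allI cinner_eqI) (simp add: cinner_adj[OF assms, symmetric] cinner_scale_right)

lemma ent_adj: "complex_linear T \<Longrightarrow> ent (adj T) i j = cnj (ent T j i)"
proof -
  assume T: "complex_linear T"
  have "ent (adj T) i j = cinner (T (ket i)) (ket j)"
    by (simp add: ent_def cinner_ket_left[symmetric] cinner_adj[OF T])
  also have "\<dots> = (\<Sum>\<^sub>\<infinity>k\<in>{j}. cnj (coord (T (ket i)) k))"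
    unfolding cinner_def by (rule infsum_cong_neutral) (auto simp: coord_ket)
  finally show ?thesis by (simp add: ent_def)
qed

lemma adj_simps:
  assumes "complex_linear T" "complex_linear R"
  shows "adj (T + R) = adj T + adj R" "adj (T - R) = adj T - adj R" "adj (c \<cdot>\<^sub>C T) = cnj c \<cdot>\<^sub>C adj T"
    "adj (- T) = - adj T"
  using assms by (auto intro!: op_eqI simp: ent_adj)

lemma adj_adj: "complex_linear T \<Longrightarrow> adj (adj T) = T"
  by (rule op_eqI) (auto simp: ent_adj)

lemma adj_zero [simp]: "adj 0 = 0"
  by (rule op_eqI) (auto simp: ent_adj)

lemma adj_compose:
  assumes "complex_linear T" "complex_linear R"
  shows "adj (T o\<^sub>L R) = adj R o\<^sub>L adj T"
  by (rule adj_eqI) (simp add: assms cinner_adj)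

lemma star_subalgebra_complex_linear: "star_subalgebra {T. complex_linear T}"
  by (auto simp: star_subalgebra_def)

text \<open>An intersection over an empty family would be everything, including operators that are
  not complex-linear; the algebra of all complex-linear operators shows that the family is
  nonempty.\<close>

lemma cstar_generated_star_subalgebra:
  assumes "\<And>T. T \<in> G \<Longrightarrow> complex_linear T"
  shows "star_subalgebra (cstar_generated G)" "closed (cstar_generated G)" "G \<subseteq> cstar_generated G"
proof -
  have m: "{T. complex_linear T} \<in> {B. star_subalgebra B \<and> closed B \<and> G \<subseteq> B}"
    using assms by (auto simp: star_subalgebra_complex_linear closed_complex_linear)
  have "T \<in> cstar_generated G \<Longrightarrow> complex_linear T" for T
    using InterD[OF _ m, of T] by (auto simp: cstar_generated_def)
  then show "star_subalgebra (cstar_generated G)"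
    unfolding cstar_generated_def star_subalgebra_def by blast
  show "closed (cstar_generated G)" "G \<subseteq> cstar_generated G"
    by (auto simp: cstar_generated_def intro!: closed_Inter)
qed

lemma cstar_generated_least:
  "star_subalgebra B \<Longrightarrow> closed B \<Longrightarrow> G \<subseteq> B \<Longrightarrow> cstar_generated G \<subseteq> B"
  by (auto simp: cstar_generated_def)


section \<open>Weighted composition operators\<close>

text \<open>The shifts, projections, truncated number operators and insertions of a leg used below
  all have the coordinate form x \<mapsto> (w_i x_{h i})_i. Injectivity of h is asked only where the
  weight is nonzero, because the index map of a one-sided shift need not be injective where the
  weight vanishes.\<close>

definition weighted_comp_ok :: "('i \<Rightarrow> complex) \<Rightarrow> ('i \<Rightarrow> 'i) \<Rightarrow> bool"
  where "weighted_comp_ok w h \<longleftrightarrow> bounded (range w) \<and> inj_on h {i. w i \<noteq> 0}"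

definition weighted_comp :: "('i \<Rightarrow> complex) \<Rightarrow> ('i \<Rightarrow> 'i) \<Rightarrow> 'i op"
  where "weighted_comp w h = Blinfun (\<lambda>x. Abs_ell2 (\<lambda>i. w i * coord x (h i)))"

lemma
  assumes h: "inj_on h {i. w i \<noteq> 0}" and B: "\<And>i. cmod (w i) \<le> B"
  shows coord_weighted_comp': "coord (weighted_comp w h x) i = w i * coord x (h i)" and norm_weighted_comp': "norm (weighted_comp w h) \<le> B"
proof -
  have B0: "B \<ge> 0" using B[of undefined] norm_ge_zero order_trans by blast
  have fin: "(\<Sum>i\<in>F. (cmod (w i * coord x (h i)))\<^sup>2) \<le> (B * norm x)\<^sup>2" if F: "finite F" for F x
  proof -
    let ?F = "{i \<in> F. w i \<noteq> 0}"
    have "(\<Sum>i\<in>F. (cmod (w i * coord x (h i)))\<^sup>2) = (\<Sum>i\<in>?F. (cmod (w i * coord x (h i)))\<^sup>2)"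
      by (rule sum.mono_neutral_right) (use F in auto)
    also have "\<dots> \<le> (\<Sum>i\<in>?F. B\<^sup>2 * (cmod (coord x (h i)))\<^sup>2)"
      by (intro sum_mono) (auto simp: norm_mult power_mult_distrib intro!: mult_right_mono power_mono B)
    also have "\<dots> = B\<^sup>2 * (\<Sum>j\<in>h ` ?F. (cmod (coord x j))\<^sup>2)"
      by (subst sum.reindex) (auto simp: sum_distrib_left intro: inj_on_subset[OF h])
    also have "\<dots> \<le> B\<^sup>2 * (norm x)\<^sup>2"
      by (intro mult_left_mono sum_coord_le) (use F in auto)
    finally show ?thesis by (simp add: power_mult_distrib)
  qed
  have sm: "(\<lambda>i. (cmod (w i * coord x (h i)))\<^sup>2) summable_on UNIV" for x
    by (rule nonneg_bdd_above_summable_on) (auto intro!: bdd_aboveI2 fin)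
  define R where "R x = Abs_ell2 (\<lambda>i. w i * coord x (h i))" for x
  have cR: "coord (R x) = (\<lambda>i. w i * coord x (h i))" for x
    using sm[of x] by (simp add: R_def Abs_ell2_inverse)
  have nR: "norm (R x) \<le> norm x * B" for x
  proof -
    have "(norm (R x))\<^sup>2 \<le> (B * norm x)\<^sup>2"
      unfolding norm_ell2_sq cR by (intro infsum_le_finite_sums sm fin)
    then show ?thesis using B0 by (metis mult.commute mult_nonneg_nonneg norm_ge_zero power2_le_imp_le)
  qed
  have bl: "bounded_linear R"
    by (rule bounded_linear_intro[OF _ _ nR]) (auto intro!: coord_eqI simp: cR algebra_simps)
  have "blinfun_apply (weighted_comp w h) = R"
    unfolding weighted_comp_def R_def[symmetric] using bl by (simp add: bounded_linear_Blinfun_apply)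
  then show "coord (weighted_comp w h x) i = w i * coord x (h i)" "norm (weighted_comp w h) \<le> B"
    using norm_blinfun_bound[OF B0, of "weighted_comp w h"] nR[unfolded mult.commute[where b = B]] by (simp_all add: cR)
qed

lemma coord_weighted_comp: "weighted_comp_ok w h \<Longrightarrow> coord (weighted_comp w h x) i = w i * coord x (h i)"
  unfolding weighted_comp_ok_def bounded_iff using coord_weighted_comp'[of h w] by blast

lemma complex_linear_weighted_comp: "weighted_comp_ok w h \<Longrightarrow> complex_linear (weighted_comp w h)"
  by (auto simp: complex_linear_def coord_weighted_comp intro!: coord_eqI)

lemma ent_weighted_comp: "weighted_comp_ok w h \<Longrightarrow> ent (weighted_comp w h) i j = (if h i = j then w i else 0)"
  by (simp add: ent_def coord_weighted_comp coord_ket)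

lemma weighted_comp_okI:
  "(\<And>i. cmod (w i) \<le> B) \<Longrightarrow> (\<And>i j. w i \<noteq> 0 \<Longrightarrow> w j \<noteq> 0 \<Longrightarrow> h i = h j \<Longrightarrow> i = j) \<Longrightarrow> weighted_comp_ok w h"
  by (auto simp: weighted_comp_ok_def bounded_iff inj_on_def)

lemma norm_weighted_comp: "weighted_comp_ok w h \<Longrightarrow> (\<And>i. cmod (w i) \<le> B) \<Longrightarrow> norm (weighted_comp w h) \<le> B"
  by (auto simp: weighted_comp_ok_def intro: norm_weighted_comp')

lemma adj_weighted_comp:
  assumes "weighted_comp_ok w h" "weighted_comp_ok w' h'"
    and "\<And>i j. (if h j = i then cnj (w j) else 0) = (if h' i = j then w' i else 0)"
  shows "adj (weighted_comp w h) = weighted_comp w' h'"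
  by (rule op_eqI) (simp_all add: complex_linear_weighted_comp assms(1,2) ent_adj ent_weighted_comp flip: assms(3))


section \<open>Iterated commutator bounds\<close>

text \<open>The ball of radius C for the supremum of |w x| over all words w of length at most m in
  the letters L. Balls are used instead of the supremum because L will contain infinitely many
  truncations, so that the supremum may be infinite.\<close>

primrec iter_bound :: "('i op \<Rightarrow> 'i op) set \<Rightarrow> nat \<Rightarrow> real \<Rightarrow> 'i op \<Rightarrow> bool"
  where
    "iter_bound L 0 C x \<longleftrightarrow> norm x \<le> C"
  | "iter_bound L (Suc m) C x \<longleftrightarrow> norm x \<le> C \<and> (\<forall>\<phi>\<in>L. iter_bound L m C (\<phi> x))"

definition commutator :: "'i op \<Rightarrow> 'i op \<Rightarrow> 'i op"
  where "commutator g x = (g o\<^sub>L x) - (x o\<^sub>L g)"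

definition left_mult :: "'i op \<Rightarrow> 'i op \<Rightarrow> 'i op"
  where "left_mult g x = g o\<^sub>L x"

definition op_linear :: "('i op \<Rightarrow> 'i op) \<Rightarrow> bool"
  where "op_linear \<phi> \<longleftrightarrow> bounded_linear \<phi> \<and> (\<forall>c x. \<phi> (c \<cdot>\<^sub>C x) = c \<cdot>\<^sub>C \<phi> x)"

lemma op_linear_scale: "op_linear \<phi> \<Longrightarrow> \<phi> (c \<cdot>\<^sub>C x) = c \<cdot>\<^sub>C \<phi> x"
  and op_linear_bounded_linear: "op_linear \<phi> \<Longrightarrow> bounded_linear \<phi>"
  by (auto simp: op_linear_def)

lemma op_linear_left_mult: "complex_linear g \<Longrightarrow> op_linear (left_mult g)"
  unfolding op_linear_def left_mult_def
  by (auto simp: op_scale_compose_right intro: bounded_linear_compose_right)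

lemma op_linear_commutator: "complex_linear g \<Longrightarrow> op_linear (commutator g)"
  unfolding op_linear_def commutator_def
  by (auto simp: op_scale_compose_right op_scale_compose_left op_scale_distrib
      intro!: bounded_linear_sub bounded_linear_compose_right bounded_linear_compose_left)

lemma iter_bound_norm: "iter_bound L m C x \<Longrightarrow> norm x \<le> C"
  by (cases m) auto

lemma iter_bound_nonneg: "iter_bound L m C x \<Longrightarrow> 0 \<le> C"
  using iter_bound_norm norm_ge_zero order_trans by blast

lemma iter_bound_mono: "iter_bound L m C x \<Longrightarrow> C \<le> C' \<Longrightarrow> iter_bound L m C' x"
  by (induction m arbitrary: x) auto

lemma iter_bound_Suc_D: "iter_bound L (Suc m) C x \<Longrightarrow> iter_bound L m C x"
  by (induction m arbitrary: x) auto

lemma iter_bound_le: "iter_bound L m C x \<Longrightarrow> m' \<le> m \<Longrightarrow> iter_bound L m' C x"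
  by (induction m) (auto simp: le_Suc_eq dest: iter_bound_Suc_D simp del: iter_bound.simps)

lemma iter_bound_subset: "iter_bound L m C x \<Longrightarrow> L' \<subseteq> L \<Longrightarrow> iter_bound L' m C x"
  by (induction m arbitrary: x) auto

lemma iter_bound_zero: "(\<And>\<phi>. \<phi> \<in> L \<Longrightarrow> op_linear \<phi>) \<Longrightarrow> 0 \<le> C \<Longrightarrow> iter_bound L m C 0"
  by (induction m) (auto simp: op_linear_def linear_simps)

lemma iter_bound_add:
  "(\<And>\<phi>. \<phi> \<in> L \<Longrightarrow> op_linear \<phi>) \<Longrightarrow> iter_bound L m C x \<Longrightarrow> iter_bound L m C' y \<Longrightarrow> iter_bound L m (C + C') (x + y)"
proof (induction m arbitrary: x y)
  case (Suc m)
  then show ?case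
    by (auto simp: linear_simps(1)[OF op_linear_bounded_linear] intro!: norm_triangle_le add_mono)
qed (auto intro!: norm_triangle_le add_mono)

lemma iter_bound_scale:
  assumes "\<And>\<phi>. \<phi> \<in> L \<Longrightarrow> op_linear \<phi>"
  shows "iter_bound L m C x \<Longrightarrow> iter_bound L m (cmod c * C) (c \<cdot>\<^sub>C x)"
proof (induction m arbitrary: x)
  case (Suc m)
  have "norm (c \<cdot>\<^sub>C x) \<le> cmod c * C"
    using Suc.prems by (auto intro!: order_trans[OF norm_op_scale_le] mult_left_mono)
  then show ?case using Suc assms by (auto simp: op_linear_scale)
qed (auto intro!: order_trans[OF norm_op_scale_le] mult_left_mono)

lemma iter_bound_minus: "(\<And>\<phi>. \<phi> \<in> L \<Longrightarrow> op_linear \<phi>) \<Longrightarrow> iter_bound L m C x \<Longrightarrow> iter_bound L m C (- x)"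
  using iter_bound_scale[of L m C x "-1"] by (simp add: op_scale_distrib)

lemma iter_bound_diff:
  "(\<And>\<phi>. \<phi> \<in> L \<Longrightarrow> op_linear \<phi>) \<Longrightarrow> iter_bound L m C x \<Longrightarrow> iter_bound L m C' y \<Longrightarrow> iter_bound L m (C + C') (x - y)"
  using iter_bound_add[of L m C x C' "- y"] iter_bound_minus[of L m C' y] by simp

lemma closed_iter_bound: "(\<And>\<phi>. \<phi> \<in> L \<Longrightarrow> op_linear \<phi>) \<Longrightarrow> closed {x. iter_bound L m C x}"
proof (induction m)
  case 0
  then show ?case by (auto intro!: closed_Collect_le continuous_intros)
next
  case (Suc m)
  have "closed {x. iter_bound L m C (\<phi> x)}" if "\<phi> \<in> L" for \<phi>
  proof -
    have "continuous_on UNIV \<phi>"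
      using Suc.prems[OF that] by (simp add: op_linear_def linear_continuous_on)
    from closed_vimage[OF Suc.IH[OF Suc.prems] this] show ?thesis by (simp add: vimage_def)
  qed
  then have "closed ({x. norm x \<le> C} \<inter> (\<Inter>\<phi>\<in>L. {x. iter_bound L m C (\<phi> x)}))"
    by (intro closed_Int closed_INT closed_Collect_le continuous_intros) auto
  moreover have "{x. iter_bound L (Suc m) C x} = {x. norm x \<le> C} \<inter> (\<Inter>\<phi>\<in>L. {x. iter_bound L m C (\<phi> x)})"
    by auto
  ultimately show ?case by (simp only:)
qed

text \<open>Made for the maps \<open>embed j k\<close> and \<open>slice j k\<close> between levels:
  a contraction that turns each letter of one level into a letter of the other or into a scalar of
  modulus at most w, so that m letters cost at most w^m.\<close>

lemma iter_bound_transfer: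
  assumes \<psi>: "\<And>x. norm (\<psi> x) \<le> norm x" and w: "1 \<le> w"
    and L': "\<And>\<phi>'. \<phi>' \<in> L' \<Longrightarrow> op_linear \<phi>'"
    and step: "\<And>\<phi>'. \<phi>' \<in> L' \<Longrightarrow>
      (\<exists>\<phi>\<in>L. \<forall>x. \<phi>' (\<psi> x) = \<psi> (\<phi> x)) \<or> (\<exists>c. cmod c \<le> w \<and> (\<forall>x. \<phi>' (\<psi> x) = c \<cdot>\<^sub>C \<psi> x))"
  shows "iter_bound L m C x \<Longrightarrow> iter_bound L' m (w ^ m * C) (\<psi> x)"
proof (induction m arbitrary: x)
  case 0
  then show ?case using \<psi>[of x] by simp
next
  case (Suc m)
  have C: "0 \<le> C" using Suc.prems by (rule iter_bound_nonneg)
  have "norm (\<psi> x) \<le> 1 * C" using Suc.prems \<psi>[of x] by simp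
  also have "\<dots> \<le> w ^ Suc m * C"
    using w C by (intro mult_right_mono one_le_power) auto
  finally have n: "norm (\<psi> x) \<le> w ^ Suc m * C" .
  have "iter_bound L' m (w ^ Suc m * C) (\<phi>' (\<psi> x))" if \<phi>': "\<phi>' \<in> L'" for \<phi>'
    using step[OF \<phi>']
  proof
    assume "\<exists>\<phi>\<in>L. \<forall>x. \<phi>' (\<psi> x) = \<psi> (\<phi> x)"
    then obtain \<phi> where "\<phi> \<in> L" and eq: "\<phi>' (\<psi> x) = \<psi> (\<phi> x)" by blast
    then have "iter_bound L' m (w ^ m * C) (\<psi> (\<phi> x))" using Suc by simp
    then show ?thesis unfolding eq
      by (rule iter_bound_mono) (use w C in \<open>intro mult_right_mono power_increasing; simp\<close>)
  next
    assume "\<exists>c. cmod c \<le> w \<and> (\<forall>x. \<phi>' (\<psi> x) = c \<cdot>\<^sub>C \<psi> x)"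
    then obtain c where c: "cmod c \<le> w" and eq: "\<phi>' (\<psi> x) = c \<cdot>\<^sub>C \<psi> x" by blast
    have "iter_bound L' m (cmod c * (w ^ m * C)) (c \<cdot>\<^sub>C \<psi> x)"
      by (rule iter_bound_scale[OF L' Suc.IH[OF iter_bound_Suc_D[OF Suc.prems]]])
    then show ?thesis unfolding eq
      by (rule iter_bound_mono) (use c w C in \<open>simp add: mult.assoc mult_right_mono\<close>)
  qed
  with n show ?case by simp
qed


section \<open>The basic operators\<close>

text \<open>Positions past the end of the list fall back on the integer coordinate. Removing the
  first leg then lowers every positive position by one whatever the level is, and at level l all
  positions i \<ge> l mean the last leg.\<close>

definition leg :: "nat \<Rightarrow> idx \<Rightarrow> int"
  where "leg i J = (if i < length (fst J) then int (fst J ! i) else snd J)"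

text \<open>Truncation is 1-Lipschitz (\<open>clip_diff\<close>) and exact on [-M, M]
  (\<open>clip_eq\<close>). The first makes bounds on commutators independent of M, the second
  recovers the number operator on any given pair of indices.\<close>

definition clip :: "nat \<Rightarrow> int \<Rightarrow> real"
  where "clip M n = max (- real M) (min (real M) (real_of_int n))"

definition num_op :: "nat \<Rightarrow> nat \<Rightarrow> idx op"
  where "num_op i M = weighted_comp (\<lambda>J. complex_of_real (clip M (leg i J))) id"

definition level_proj :: "nat \<Rightarrow> idx op"
  where "level_proj l = weighted_comp (\<lambda>J. if length (fst J) = l then 1 else 0) id"

definition raise_op :: "nat \<Rightarrow> idx op"
  where "raise_op r = weighted_comp (\<lambda>J. if r < length (fst J) \<and> 0 < fst J ! r then 1 else 0)
    (\<lambda>J. ((fst J)[r := fst J ! r - Suc 0], snd J))"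

definition lower_op :: "nat \<Rightarrow> idx op"
  where "lower_op r = weighted_comp (\<lambda>J. if r < length (fst J) then 1 else 0)
    (\<lambda>J. ((fst J)[r := Suc (fst J ! r)], snd J))"

definition z_up :: "idx op"
  where "z_up = weighted_comp (\<lambda>J. 1) (\<lambda>J. (fst J, snd J - 1))"

definition z_down :: "idx op"
  where "z_down = weighted_comp (\<lambda>J. 1) (\<lambda>J. (fst J, snd J + 1))"

text \<open>\<open>ins_op k\<close> is \<open>y \<mapsto> e\<^sub>k \<otimes> y\<close> on all levels at once, and \<open>del_op k\<close> is its adjoint.\<close>

definition ins_op :: "nat \<Rightarrow> idx op"
  where "ins_op k = weighted_comp (\<lambda>J. if fst J \<noteq> [] \<and> hd (fst J) = k then 1 else 0) (\<lambda>J. (tl (fst J), snd J))"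

definition del_op :: "nat \<Rightarrow> idx op"
  where "del_op j = weighted_comp (\<lambda>J. 1) (\<lambda>J. (j # fst J, snd J))"

lemma clip_bound: "\<bar>clip M n\<bar> \<le> real M"
  by (auto simp: clip_def)

lemma clip_diff: "\<bar>clip M m - clip M n\<bar> \<le> \<bar>real_of_int m - real_of_int n\<bar>"
  by (auto simp: clip_def)

lemma clip_eq: "\<bar>n\<bar> \<le> int M \<Longrightarrow> clip M n = real_of_int n"
  by (auto simp: clip_def min_def max_def)

lemma list_update_Suc_inj:
  fixes xs ys :: "nat list"
  assumes "r < length xs" "r < length ys" "xs[r := Suc (xs ! r)] = ys[r := Suc (ys ! r)]"
  shows "xs = ys"
proof -
  have "xs ! r = ys ! r"
    using arg_cong[OF assms(3), of "\<lambda>l. l ! r"] assms(1,2) by simp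
  then show ?thesis
    using arg_cong[OF assms(3), of "\<lambda>l. l[r := xs ! r]"] by (metis list_update_id list_update_overwrite)
qed

lemma list_update_pred_inj:
  fixes xs ys :: "nat list"
  assumes "r < length xs" "r < length ys" "0 < xs ! r" "0 < ys ! r"
    "xs[r := xs ! r - Suc 0] = ys[r := ys ! r - Suc 0]"
  shows "xs = ys"
proof -
  have "xs ! r - Suc 0 = ys ! r - Suc 0"
    using arg_cong[OF assms(5), of "\<lambda>l. l ! r"] assms(1,2) by simp
  then have "xs ! r = ys ! r" using assms(3,4) by linarith
  then show ?thesis
    using arg_cong[OF assms(5), of "\<lambda>l. l[r := xs ! r]"] by (metis list_update_id list_update_overwrite)
qed

lemma weighted_comp_ok_num_op: "weighted_comp_ok (\<lambda>J. complex_of_real (clip M (leg i J))) id"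
  by (rule weighted_comp_okI[where B = "real M"]) (auto simp: clip_bound)

lemma weighted_comp_ok_level_proj: "weighted_comp_ok (\<lambda>J::idx. if length (fst J) = l then 1 else 0) id"
  by (rule weighted_comp_okI[where B = 1]) auto

lemma weighted_comp_ok_raise_op: "weighted_comp_ok (\<lambda>J::idx. if r < length (fst J) \<and> 0 < fst J ! r then 1 else 0)
    (\<lambda>J. ((fst J)[r := fst J ! r - Suc 0], snd J))"
  by (rule weighted_comp_okI[where B = 1]) (auto split: if_splits intro!: prod_eqI intro: list_update_pred_inj)

lemma weighted_comp_ok_lower_op: "weighted_comp_ok (\<lambda>J::idx. if r < length (fst J) then 1 else 0)
    (\<lambda>J. ((fst J)[r := Suc (fst J ! r)], snd J))"
  by (rule weighted_comp_okI[where B = 1]) (auto split: if_splits intro!: prod_eqI intro: list_update_Suc_inj)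

lemma weighted_comp_ok_z_up: "weighted_comp_ok (\<lambda>J::idx. 1) (\<lambda>J. (fst J, snd J - 1))"
  and weighted_comp_ok_z_down: "weighted_comp_ok (\<lambda>J::idx. 1) (\<lambda>J. (fst J, snd J + 1))"
  and weighted_comp_ok_del_op: "weighted_comp_ok (\<lambda>J::idx. 1) (\<lambda>J. (j # fst J, snd J))"
  by (rule weighted_comp_okI[where B = 1]; auto intro!: prod_eqI)+

lemma weighted_comp_ok_ins_op: "weighted_comp_ok (\<lambda>J::idx. if fst J \<noteq> [] \<and> hd (fst J) = k then 1 else 0) (\<lambda>J. (tl (fst J), snd J))"
  by (rule weighted_comp_okI[where B = 1]) (auto split: if_splits intro!: prod_eqI intro: list.expand)

lemmas weighted_comp_ok_basic = weighted_comp_ok_num_op weighted_comp_ok_level_proj weighted_comp_ok_raise_op weighted_comp_ok_lower_op weighted_comp_ok_z_up weighted_comp_ok_z_down weighted_comp_ok_ins_op weighted_comp_ok_del_op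

lemma coord_basic:
  "coord (num_op i M x) J = of_real (clip M (leg i J)) * coord x J"
  "coord (level_proj l x) J = (if length (fst J) = l then coord x J else 0)"
  "coord (raise_op r x) J = (if r < length (fst J) \<and> 0 < fst J ! r
     then coord x ((fst J)[r := fst J ! r - Suc 0], snd J) else 0)"
  "coord (lower_op r x) J = (if r < length (fst J) then coord x ((fst J)[r := Suc (fst J ! r)], snd J) else 0)"
  "coord (z_up x) J = coord x (fst J, snd J - 1)"
  "coord (z_down x) J = coord x (fst J, snd J + 1)"
  "coord (ins_op k x) J = (if fst J \<noteq> [] \<and> hd (fst J) = k then coord x (tl (fst J), snd J) else 0)"
  "coord (del_op k x) J = coord x (k # fst J, snd J)"
  unfolding num_op_def level_proj_def raise_op_def lower_op_def z_up_def z_down_def ins_op_def del_op_def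
  by (simp_all add: coord_weighted_comp[OF weighted_comp_ok_num_op] coord_weighted_comp[OF weighted_comp_ok_level_proj] coord_weighted_comp[OF weighted_comp_ok_raise_op]
      coord_weighted_comp[OF weighted_comp_ok_lower_op] coord_weighted_comp[OF weighted_comp_ok_z_up] coord_weighted_comp[OF weighted_comp_ok_z_down] coord_weighted_comp[OF weighted_comp_ok_ins_op]
      coord_weighted_comp[OF weighted_comp_ok_del_op])

lemma complex_linear_basic [simp, intro]:
  "complex_linear (num_op i M)" "complex_linear (level_proj l)" "complex_linear (raise_op r)" "complex_linear (lower_op r)"
  "complex_linear z_up" "complex_linear z_down" "complex_linear (ins_op k)" "complex_linear (del_op k)"
  unfolding num_op_def level_proj_def raise_op_def lower_op_def z_up_def z_down_def ins_op_def del_op_def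
  by (simp_all add: complex_linear_weighted_comp weighted_comp_ok_basic)

lemma norm_basic:
  "norm (level_proj l) \<le> 1" "norm (raise_op r) \<le> 1" "norm (lower_op r) \<le> 1" "norm z_up \<le> 1" "norm z_down \<le> 1"
  "norm (ins_op k) \<le> 1" "norm (del_op k) \<le> 1"
  unfolding level_proj_def raise_op_def lower_op_def z_up_def z_down_def ins_op_def del_op_def
  by (rule norm_weighted_comp, rule weighted_comp_ok_basic, simp)+

lemma adj_basic [simp]:
  "adj (num_op i M) = num_op i M" "adj (level_proj l) = level_proj l" "adj (raise_op r) = lower_op r" "adj (lower_op r) = raise_op r"
  "adj z_up = z_down" "adj z_down = z_up" "adj (ins_op k) = del_op k" "adj (del_op k) = ins_op k"
proof -
  have nz: "ns[r := Suc (ns ! r - Suc 0)] = ns" if "0 < ns ! r" for ns :: "nat list" and r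
    using that by simp
  show 1: "adj (raise_op r) = lower_op r"
    unfolding raise_op_def lower_op_def by (rule adj_weighted_comp[OF weighted_comp_ok_raise_op weighted_comp_ok_lower_op]) (auto simp: nz nth_list_update)
  show 2: "adj z_up = z_down"
    unfolding z_up_def z_down_def by (rule adj_weighted_comp[OF weighted_comp_ok_z_up weighted_comp_ok_z_down]) auto
  show 3: "adj (ins_op k) = del_op k"
    unfolding ins_op_def del_op_def by (rule adj_weighted_comp[OF weighted_comp_ok_ins_op weighted_comp_ok_del_op]) (auto simp: neq_Nil_conv)
  show "adj (num_op i M) = num_op i M"
    unfolding num_op_def by (rule adj_weighted_comp[OF weighted_comp_ok_num_op weighted_comp_ok_num_op]) auto
  show "adj (level_proj l) = level_proj l"
    unfolding level_proj_def by (rule adj_weighted_comp[OF weighted_comp_ok_level_proj weighted_comp_ok_level_proj]) auto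
  show "adj (lower_op r) = raise_op r" "adj z_down = z_up" "adj (del_op k) = ins_op k"
    by (simp_all only: 1[symmetric] 2[symmetric] 3[symmetric] adj_adj[OF complex_linear_basic(3)]
      adj_adj[OF complex_linear_basic(5)] adj_adj[OF complex_linear_basic(7)])
qed

text \<open>These relations drive the induction on the level: operators on a positive leg pass
  through \<open>del_op\<close> and \<open>ins_op\<close> with their position lowered by one, while
  operators on leg 0 only shift or weigh the index of the leg that is removed or inserted.\<close>

lemma slice_rules:
  "del_op j o\<^sub>L ins_op k = (if j = k then id_blinfun else 0)"
  "del_op j o\<^sub>L num_op 0 M = clip M (int j) *\<^sub>R del_op j" "num_op 0 M o\<^sub>L ins_op k = clip M (int k) *\<^sub>R ins_op k"
  "del_op j o\<^sub>L num_op (Suc i) M = num_op i M o\<^sub>L del_op j" "num_op (Suc i) M o\<^sub>L ins_op k = ins_op k o\<^sub>L num_op i M"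
  "del_op j o\<^sub>L raise_op (Suc r) = raise_op r o\<^sub>L del_op j" "raise_op (Suc r) o\<^sub>L ins_op k = ins_op k o\<^sub>L raise_op r"
  "del_op j o\<^sub>L lower_op (Suc r) = lower_op r o\<^sub>L del_op j" "lower_op (Suc r) o\<^sub>L ins_op k = ins_op k o\<^sub>L lower_op r"
  "del_op (Suc j) o\<^sub>L raise_op 0 = del_op j" "del_op 0 o\<^sub>L raise_op 0 = 0" "raise_op 0 o\<^sub>L ins_op k = ins_op (Suc k)"
  "del_op j o\<^sub>L lower_op 0 = del_op (Suc j)" "lower_op 0 o\<^sub>L ins_op (Suc k) = ins_op k" "lower_op 0 o\<^sub>L ins_op 0 = 0"
  "del_op j o\<^sub>L z_up = z_up o\<^sub>L del_op j" "z_up o\<^sub>L ins_op k = ins_op k o\<^sub>L z_up"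
  "del_op j o\<^sub>L z_down = z_down o\<^sub>L del_op j" "z_down o\<^sub>L ins_op k = ins_op k o\<^sub>L z_down"
  "del_op j o\<^sub>L level_proj (Suc l) = level_proj l o\<^sub>L del_op j" "level_proj (Suc l) o\<^sub>L ins_op k = ins_op k o\<^sub>L level_proj l"
  "del_op j o\<^sub>L level_proj 0 = 0"
  by (rule blinfun_eqI, rule coord_eqI,
      auto simp: coord_basic leg_def blinfun.scaleR_left neq_Nil_conv split: if_splits)+

lemma level_proj_rules:
  "level_proj l o\<^sub>L level_proj l = level_proj l" "level_proj l o\<^sub>L num_op i M = num_op i M o\<^sub>L level_proj l" "level_proj l o\<^sub>L raise_op r = raise_op r o\<^sub>L level_proj l"
  "level_proj l o\<^sub>L lower_op r = lower_op r o\<^sub>L level_proj l" "level_proj l o\<^sub>L z_up = z_up o\<^sub>L level_proj l" "level_proj l o\<^sub>L z_down = z_down o\<^sub>L level_proj l"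
  "z_up o\<^sub>L z_down = id_blinfun" "z_down o\<^sub>L z_up = id_blinfun"
  by (rule blinfun_eqI, rule coord_eqI, auto simp: coord_basic leg_def split: if_splits)+


section \<open>Operators with bounded iterated commutators\<close>

definition num_commutators :: "(idx op \<Rightarrow> idx op) set"
  where "num_commutators = {commutator (num_op i M) | i M. True}"

text \<open>Weights on the left suffice: x g = g x - [g, x] turns a right weight into a left weight
  and a commutator.\<close>

definition num_left_mults :: "nat \<Rightarrow> (idx op \<Rightarrow> idx op) set"
  where "num_left_mults r = {left_mult (num_op i M) | i M. i < r}"

text \<open>Rapid decay in the legs 0, ..., r - 1 together with bounded iterated commutators. For r
  = 0 this describes an algebra, and for larger r two-sided ideals over it, as
  \<open>ideal_bound_mult_left\<close> and \<open>ideal_bound_mult_right\<close> make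
  quantitative.\<close>

definition ideal_bound :: "nat \<Rightarrow> nat \<Rightarrow> real \<Rightarrow> idx op \<Rightarrow> bool"
  where "ideal_bound r = iter_bound (num_commutators \<union> num_left_mults r)"

lemma op_linear_letters: "\<phi> \<in> num_commutators \<union> num_left_mults r \<Longrightarrow> op_linear \<phi>"
  by (auto simp: num_commutators_def num_left_mults_def intro: op_linear_commutator op_linear_left_mult)

lemma ideal_bound_0 [simp]: "ideal_bound r 0 C x \<longleftrightarrow> norm x \<le> C"
  by (simp add: ideal_bound_def)

lemma ideal_bound_Suc: "ideal_bound r (Suc m) C x \<longleftrightarrow> norm x \<le> C \<and> (\<forall>i M. ideal_bound r m C (commutator (num_op i M) x))
    \<and> (\<forall>i M. i < r \<longrightarrow> ideal_bound r m C (left_mult (num_op i M) x))"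
proof -
  have "(\<forall>\<phi>\<in>num_commutators \<union> num_left_mults r. P \<phi>) \<longleftrightarrow> (\<forall>i M. P (commutator (num_op i M))) \<and> (\<forall>i M. i < r \<longrightarrow> P (left_mult (num_op i M)))" for P
    unfolding num_commutators_def num_left_mults_def by blast
  then show ?thesis by (simp add: ideal_bound_def)
qed

lemma
  shows ideal_bound_norm: "ideal_bound r m C x \<Longrightarrow> norm x \<le> C"
    and ideal_bound_nonneg: "ideal_bound r m C x \<Longrightarrow> 0 \<le> C"
    and ideal_bound_mono: "ideal_bound r m C x \<Longrightarrow> C \<le> C' \<Longrightarrow> ideal_bound r m C' x"
    and ideal_bound_le: "ideal_bound r m C x \<Longrightarrow> m' \<le> m \<Longrightarrow> ideal_bound r m' C x"
    and ideal_bound_zero: "0 \<le> C \<Longrightarrow> ideal_bound r m C 0"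
    and ideal_bound_add: "ideal_bound r m C x \<Longrightarrow> ideal_bound r m C' y \<Longrightarrow> ideal_bound r m (C + C') (x + y)"
    and ideal_bound_diff: "ideal_bound r m C x \<Longrightarrow> ideal_bound r m C' y \<Longrightarrow> ideal_bound r m (C + C') (x - y)"
    and ideal_bound_minus: "ideal_bound r m C x \<Longrightarrow> ideal_bound r m C (- x)"
    and ideal_bound_scale: "ideal_bound r m C x \<Longrightarrow> ideal_bound r m (cmod c * C) (c \<cdot>\<^sub>C x)"
    and closed_ideal_bound: "closed {x. ideal_bound r m C x}"
  unfolding ideal_bound_def
  by (blast intro: iter_bound_norm iter_bound_nonneg iter_bound_mono iter_bound_le iter_bound_zero iter_bound_add iter_bound_diff iter_bound_minus iter_bound_scale
      closed_iter_bound op_linear_letters)+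

lemma ideal_bound_less: "ideal_bound r m C x \<Longrightarrow> r' \<le> r \<Longrightarrow> ideal_bound r' m C x"
  unfolding ideal_bound_def by (erule iter_bound_subset) (auto simp: num_left_mults_def)

lemma ideal_bound_scaleR: "ideal_bound r m C x \<Longrightarrow> ideal_bound r m (\<bar>a\<bar> * C) (a *\<^sub>R x)"
  using ideal_bound_scale[of r m C x "of_real a"] by (simp add: op_scale_of_real)

section \<open>Products, adjoints and inverses under commutator bounds\<close>

lemma commutator_compose: "commutator g (x o\<^sub>L y) = (commutator g x o\<^sub>L y) + (x o\<^sub>L commutator g y)"
  by (simp add: commutator_def compose_distrib compose_assoc)

lemma left_mult_compose: "left_mult g (x o\<^sub>L y) = (x o\<^sub>L left_mult g y) + (commutator g x o\<^sub>L y)"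
  by (simp add: commutator_def left_mult_def compose_distrib compose_assoc)

lemma left_mult_compose': "left_mult g (x o\<^sub>L y) = left_mult g x o\<^sub>L y"
  by (simp add: left_mult_def compose_assoc)

lemma commutator_add: "commutator g (x + y) = commutator g x + commutator g y"
  and commutator_diff: "commutator g (x - y) = commutator g x - commutator g y"
  and commutator_zero [simp]: "commutator g 0 = 0"
  by (simp_all add: commutator_def compose_distrib)

lemma commutator_scale: "complex_linear g \<Longrightarrow> commutator g (c \<cdot>\<^sub>C x) = c \<cdot>\<^sub>C commutator g x"
  by (rule op_linear_scale[OF op_linear_commutator])

lemma complex_linear_commutator [simp, intro]: "complex_linear g \<Longrightarrow> complex_linear x \<Longrightarrow> complex_linear (commutator g x)"
  by (simp add: commutator_def)

lemma commutator_adj: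
  "complex_linear g \<Longrightarrow> complex_linear x \<Longrightarrow> commutator g (adj x) = - adj (commutator (adj g) x)"
  by (simp add: commutator_def adj_simps adj_adj adj_compose)

lemma ideal_bound_mult_aux:
  fixes C C' :: real
  assumes "norm x \<le> C" "norm y \<le> C'"
  shows "norm (x o\<^sub>L y) \<le> 2 ^ m * C * C'"
proof -
  have C: "0 \<le> C" using assms(1) norm_ge_zero order_trans by blast
  have "norm (x o\<^sub>L y) \<le> norm x * norm y" by (rule norm_compose)
  also have "\<dots> \<le> C * C'" by (intro mult_mono assms C) auto
  also have "\<dots> \<le> 2 ^ m * (C * C')"
    using mult_right_mono[of 1 "2 ^ m" "C * C'"] mult_nonneg_nonneg[OF C order_trans[OF norm_ge_zero assms(2)]] by simp
  finally show ?thesis by (simp add: mult.assoc)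
qed

text \<open>By the Leibniz rules every letter splits a product into two, hence 2^m. A left weight
  moves past x at the price of a commutator, g x y = x g y + [g, x] y, which is why the right factor
  may be the one that carries the weights.\<close>

lemma ideal_bound_mult_left: "ideal_bound 0 m C x \<Longrightarrow> ideal_bound r m C' y \<Longrightarrow> ideal_bound r m (2 ^ m * C * C') (x o\<^sub>L y)"
proof (induction m arbitrary: x y)
  case 0
  then show ?case using ideal_bound_mult_aux[of x C y C' 0] by simp
next
  case (Suc m)
  have n: "norm (x o\<^sub>L y) \<le> 2 ^ Suc m * C * C'"
    using Suc.prems by (intro ideal_bound_mult_aux) (auto dest: ideal_bound_norm)
  have x: "ideal_bound 0 m C x" and y: "ideal_bound r m C' y" using Suc.prems by (auto intro: ideal_bound_le)
  have e: "2 ^ m * C * C' + 2 ^ m * C * C' = 2 ^ Suc m * C * C'" by simp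
  have "ideal_bound r m (2 ^ Suc m * C * C') (commutator (num_op i M) (x o\<^sub>L y))" for i M
    unfolding commutator_compose e[symmetric] using Suc.prems x y
    by (intro ideal_bound_add Suc.IH) (auto simp: ideal_bound_Suc)
  moreover have "ideal_bound r m (2 ^ Suc m * C * C') (left_mult (num_op i M) (x o\<^sub>L y))" if "i < r" for i M
    unfolding left_mult_compose e[symmetric] using Suc.prems x y that
    by (intro ideal_bound_add Suc.IH) (auto simp: ideal_bound_Suc)
  ultimately show ?case using n by (simp add: ideal_bound_Suc)
qed

lemma ideal_bound_mult_right: "ideal_bound r m C y \<Longrightarrow> ideal_bound 0 m C' x \<Longrightarrow> ideal_bound r m (2 ^ m * C * C') (y o\<^sub>L x)"
proof (induction m arbitrary: x y)
  case 0
  then show ?case using ideal_bound_mult_aux[of y C x C' 0] by simp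
next
  case (Suc m)
  have n: "norm (y o\<^sub>L x) \<le> 2 ^ Suc m * C * C'"
    using Suc.prems by (intro ideal_bound_mult_aux) (auto dest: ideal_bound_norm)
  have x: "ideal_bound 0 m C' x" and y: "ideal_bound r m C y" using Suc.prems by (auto intro: ideal_bound_le)
  have e: "2 ^ m * C * C' + 2 ^ m * C * C' = 2 ^ Suc m * C * C'" by simp
  have "ideal_bound r m (2 ^ Suc m * C * C') (commutator (num_op i M) (y o\<^sub>L x))" for i M
    unfolding commutator_compose e[symmetric] using Suc.prems x y
    by (intro ideal_bound_add Suc.IH) (auto simp: ideal_bound_Suc)
  moreover have "ideal_bound r m (2 ^ Suc m * C * C') (left_mult (num_op i M) (y o\<^sub>L x))" if "i < r" for i M
  proof -
    have "ideal_bound r m (2 ^ m * C * C') (left_mult (num_op i M) y o\<^sub>L x)"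
      using Suc.prems x that by (intro Suc.IH) (auto simp: ideal_bound_Suc)
    moreover from this have "0 \<le> 2 ^ m * C * C'" by (rule ideal_bound_nonneg)
    then have "2 ^ m * C * C' \<le> 2 ^ Suc m * C * C'" by (simp only: power_Suc mult.assoc)
    ultimately show ?thesis unfolding left_mult_compose' by (rule ideal_bound_mono)
  qed
  ultimately show ?case using n by (simp add: ideal_bound_Suc)
qed

text \<open>A left weight on the adjoint is the adjoint of a right weight, and y g = g y - [g, y];
  these two terms give the factor 2 for every letter.\<close>

lemma ideal_bound_adj: "complex_linear y \<Longrightarrow> ideal_bound r m C y \<Longrightarrow> ideal_bound r m (2 ^ m * C) (adj y)"
proof (induction m arbitrary: y C)
  case 0
  then show ?case using norm_adj_le[of y] by simp
next
  case (Suc m)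
  have C: "0 \<le> C" using Suc.prems(2) by (rule ideal_bound_nonneg)
  have "norm (adj y) \<le> 1 * C" using norm_adj_le[of y] Suc.prems by (auto dest: ideal_bound_norm)
  also have "\<dots> \<le> 2 ^ Suc m * C"
    using C by (intro mult_right_mono one_le_power) auto
  finally have n: "norm (adj y) \<le> 2 ^ Suc m * C" .
  have "ideal_bound r m (2 ^ Suc m * C) (commutator (num_op i M) (adj y))" for i M
  proof -
    have "ideal_bound r m (2 ^ m * C) (adj (commutator (num_op i M) y))"
      using Suc.prems by (intro Suc.IH) (auto simp: ideal_bound_Suc)
    then have "ideal_bound r m (2 ^ m * C) (commutator (num_op i M) (adj y))"
      using Suc.prems(1) by (simp add: commutator_adj ideal_bound_minus)
    then show ?thesis by (rule ideal_bound_mono) (use C in auto)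
  qed
  moreover have "ideal_bound r m (2 ^ Suc m * C) (left_mult (num_op i M) (adj y))" if "i < r" for i M
  proof -
    have eq: "left_mult (num_op i M) (adj y) = adj (left_mult (num_op i M) y - commutator (num_op i M) y)"
      using Suc.prems(1) by (simp add: left_mult_def commutator_def adj_compose)
    have "ideal_bound r m (2 ^ m * (C + C)) (adj (left_mult (num_op i M) y - commutator (num_op i M) y))"
      using Suc.prems that by (intro Suc.IH ideal_bound_diff) (auto simp: ideal_bound_Suc left_mult_def)
    then show ?thesis unfolding eq by (simp add: mult_ac)
  qed
  ultimately show ?case using n by (simp add: ideal_bound_Suc)
qed

text \<open>Inverses are taken relative to u, which will be the unit of a level and not the identity
  of the ambient space; the derivation formula survives because g commutes with u.\<close>

lemma commutator_inverse:
  assumes "a o\<^sub>L b = u" "b o\<^sub>L a = u" "u o\<^sub>L b = b" "b o\<^sub>L u = b" "g o\<^sub>L u = u o\<^sub>L g"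
  shows "commutator g b = - (b o\<^sub>L commutator g a o\<^sub>L b)"
proof -
  have "b o\<^sub>L g o\<^sub>L a o\<^sub>L b = b o\<^sub>L g"
    by (metis assms(1,4,5) compose_assoc)
  moreover have "b o\<^sub>L a o\<^sub>L g o\<^sub>L b = g o\<^sub>L b"
    by (metis assms(2,3,5) compose_assoc)
  ultimately show ?thesis by (simp add: commutator_def compose_distrib compose_assoc)
qed

lemma num_op_level_proj: "num_op i M o\<^sub>L level_proj l = level_proj l o\<^sub>L num_op i M"
  by (simp add: level_proj_rules)

text \<open>The bound for b may depend on a only through C and \<beta>, since it will be applied to
  all resolvents on a compact set at once. Each induction step gains one order: order m for b and
  for [g, a] gives order m for [g, b], and hence order m + 1 for b.\<close>

lemma ideal_bound_inverse:
  "\<exists>C'. \<forall>a b. ideal_bound 0 m C a \<longrightarrow> norm b \<le> \<beta> \<longrightarrow> a o\<^sub>L b = level_proj l \<longrightarrow> b o\<^sub>L a = level_proj l \<longrightarrow>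
     level_proj l o\<^sub>L b = b \<longrightarrow> b o\<^sub>L level_proj l = b \<longrightarrow> ideal_bound 0 m C' b"
proof (induction m)
  case 0
  then show ?case by auto
next
  case (Suc m)
  then obtain C' where C': "\<And>a b. ideal_bound 0 m C a \<Longrightarrow> norm b \<le> \<beta> \<Longrightarrow> a o\<^sub>L b = level_proj l \<Longrightarrow> b o\<^sub>L a = level_proj l \<Longrightarrow>
     level_proj l o\<^sub>L b = b \<Longrightarrow> b o\<^sub>L level_proj l = b \<Longrightarrow> ideal_bound 0 m C' b" by blast
  \<comment> \<open>The two entries bound b itself and the product b [g, a] b.\<close>
  define D where "D = max \<beta> (2 ^ m * (2 ^ m * C' * C) * C')"
  have "ideal_bound 0 (Suc m) D b"
    if a: "ideal_bound 0 (Suc m) C a" and b: "norm b \<le> \<beta>" "a o\<^sub>L b = level_proj l" "b o\<^sub>L a = level_proj l"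
       "level_proj l o\<^sub>L b = b" "b o\<^sub>L level_proj l = b" for a b
  proof -
    have IH: "ideal_bound 0 m C' b" using a b by (intro C') (auto intro: ideal_bound_le)
    have "ideal_bound 0 m D (commutator (num_op i M) b)" for i M
    proof -
      have "ideal_bound 0 m (2 ^ m * (2 ^ m * C' * C) * C') (b o\<^sub>L commutator (num_op i M) a o\<^sub>L b)"
        using a IH by (intro ideal_bound_mult_left[where r = 0] ideal_bound_mult_right) (auto simp: ideal_bound_Suc)
      then have "ideal_bound 0 m D (b o\<^sub>L commutator (num_op i M) a o\<^sub>L b)"
        by (rule ideal_bound_mono) (simp add: D_def)
      then show ?thesis
        by (subst commutator_inverse[OF b(2-5) num_op_level_proj]) (rule ideal_bound_minus)
    qed
    then show ?thesis using b(1) by (simp add: ideal_bound_Suc D_def)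
  qed
  then show ?case by blast
qed

text \<open>Legs are counted from \<open>0\<close>, so the leg \<open>l\<close> is the \<open>\<ell>\<^sub>2(\<int>)\<close> leg; \<open>raise_op r\<close> and \<open>lower_op r\<close> are the
  \<open>\<alpha>\<^sub>r\<^sub>+\<^sub>1\<^sup>*\<close> and \<open>\<alpha>\<^sub>r\<^sub>+\<^sub>1\<close> of the introduction.\<close>

definition smooth_bound :: "nat \<Rightarrow> nat \<Rightarrow> real \<Rightarrow> idx op \<Rightarrow> bool"
  where "smooth_bound l m C x \<longleftrightarrow> complex_linear x \<and> level_proj l o\<^sub>L x = x \<and> x o\<^sub>L level_proj l = x
    \<and> commutator z_up x = 0 \<and> commutator z_down x = 0 \<and> ideal_bound 0 m C x
    \<and> (\<forall>r<l. ideal_bound (Suc r) m C (commutator (raise_op r) x) \<and> ideal_bound (Suc r) m C (commutator (lower_op r) x))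
    \<and> (\<forall>M. ideal_bound l m C (commutator (num_op l M) x))"

lemma smooth_bound_I:
  assumes "complex_linear x" "level_proj l o\<^sub>L x = x" "x o\<^sub>L level_proj l = x" "commutator z_up x = 0" "commutator z_down x = 0" "ideal_bound 0 m C x"
    "\<And>r. r < l \<Longrightarrow> ideal_bound (Suc r) m C (commutator (raise_op r) x)" "\<And>r. r < l \<Longrightarrow> ideal_bound (Suc r) m C (commutator (lower_op r) x)"
    "\<And>M. ideal_bound l m C (commutator (num_op l M) x)"
  shows "smooth_bound l m C x"
  using assms by (auto simp: smooth_bound_def)

lemma smooth_bound_D:
  assumes "smooth_bound l m C x"
  shows "complex_linear x" "level_proj l o\<^sub>L x = x" "x o\<^sub>L level_proj l = x" "commutator z_up x = 0" "commutator z_down x = 0" "ideal_bound 0 m C x"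
    "r < l \<Longrightarrow> ideal_bound (Suc r) m C (commutator (raise_op r) x)" "r < l \<Longrightarrow> ideal_bound (Suc r) m C (commutator (lower_op r) x)"
    "ideal_bound l m C (commutator (num_op l M) x)"
  using assms by (auto simp: smooth_bound_def)

lemma smooth_bound_norm: "smooth_bound l m C x \<Longrightarrow> norm x \<le> C"
  by (auto simp: smooth_bound_def dest: ideal_bound_norm)

lemma smooth_bound_nonneg: "smooth_bound l m C x \<Longrightarrow> 0 \<le> C"
  by (auto simp: smooth_bound_def dest: ideal_bound_nonneg)

lemma smooth_bound_mono: "smooth_bound l m C x \<Longrightarrow> C \<le> C' \<Longrightarrow> smooth_bound l m C' x"
  unfolding smooth_bound_def by (blast intro: ideal_bound_mono)

lemma smooth_bound_le: "smooth_bound l m C x \<Longrightarrow> m' \<le> m \<Longrightarrow> smooth_bound l m' C x"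
  unfolding smooth_bound_def by (blast intro: ideal_bound_le)

lemma smooth_bound_zero: "0 \<le> C \<Longrightarrow> smooth_bound l m C 0"
  by (auto simp: smooth_bound_def ideal_bound_zero compose_distrib)

lemma smooth_bound_add: "smooth_bound l m C x \<Longrightarrow> smooth_bound l m C' y \<Longrightarrow> smooth_bound l m (C + C') (x + y)"
  by (auto simp: smooth_bound_def commutator_add ideal_bound_add compose_distrib)

lemma smooth_bound_scale: "smooth_bound l m C x \<Longrightarrow> smooth_bound l m (cmod c * C) (c \<cdot>\<^sub>C x)"
  by (auto simp: smooth_bound_def commutator_scale ideal_bound_scale op_scale_compose_left op_scale_compose_right)

lemma smooth_bound_diff: "smooth_bound l m C x \<Longrightarrow> smooth_bound l m C' y \<Longrightarrow> smooth_bound l m (C + C') (x - y)"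
  using smooth_bound_add[OF _ smooth_bound_scale[of l m C' y "-1"], of C x] by (simp add: op_scale_distrib)

lemma closed_commutator_vimage:
  assumes "closed {x. P x}" "complex_linear g"
  shows "closed {x. P (commutator g x)}"
proof -
  have "continuous_on UNIV (commutator g)"
    using op_linear_commutator[OF assms(2)] by (simp add: op_linear_def linear_continuous_on)
  from closed_vimage[OF assms(1) this] show ?thesis by (simp add: vimage_def)
qed

lemma closed_smooth_bound: "closed {x. smooth_bound l m C x}"
proof -
  have e: "continuous_on UNIV (\<lambda>x. level_proj l o\<^sub>L x)" "continuous_on UNIV (\<lambda>x. x o\<^sub>L level_proj l)"
    by (intro linear_continuous_on bounded_linear_compose_left bounded_linear_compose_right)+
  have "closed ({x. complex_linear x} \<inter> {x. level_proj l o\<^sub>L x = x} \<inter> {x. x o\<^sub>L level_proj l = x}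
      \<inter> {x. commutator z_up x = 0} \<inter> {x. commutator z_down x = 0} \<inter> {x. ideal_bound 0 m C x}
      \<inter> (\<Inter>r\<in>{..<l}. {x. ideal_bound (Suc r) m C (commutator (raise_op r) x)}) \<inter> (\<Inter>r\<in>{..<l}. {x. ideal_bound (Suc r) m C (commutator (lower_op r) x)})
      \<inter> (\<Inter>M. {x. ideal_bound l m C (commutator (num_op l M) x)}))"
    by (intro closed_Int closed_INT ballI closed_complex_linear closed_ideal_bound closed_commutator_vimage
        closed_Collect_eq e continuous_intros) (auto intro: closed_commutator_vimage[where P = "\<lambda>x. x = 0"])
  moreover have "{x. smooth_bound l m C x} = ({x. complex_linear x} \<inter> {x. level_proj l o\<^sub>L x = x} \<inter> {x. x o\<^sub>L level_proj l = x}
      \<inter> {x. commutator z_up x = 0} \<inter> {x. commutator z_down x = 0} \<inter> {x. ideal_bound 0 m C x}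
      \<inter> (\<Inter>r\<in>{..<l}. {x. ideal_bound (Suc r) m C (commutator (raise_op r) x)}) \<inter> (\<Inter>r\<in>{..<l}. {x. ideal_bound (Suc r) m C (commutator (lower_op r) x)})
      \<inter> (\<Inter>M. {x. ideal_bound l m C (commutator (num_op l M) x)}))"
    by (auto simp: smooth_bound_def)
  ultimately show ?thesis by (simp only:)
qed

lemma smooth_bound_sum: "finite S \<Longrightarrow> (\<And>k. k \<in> S \<Longrightarrow> smooth_bound l m (c k) (f k)) \<Longrightarrow> smooth_bound l m (\<Sum>k\<in>S. c k) (\<Sum>k\<in>S. f k)"
  by (induction S rule: finite_induct) (auto intro: smooth_bound_zero smooth_bound_add)

text \<open>Closed conditions pass from finite partial sums to infinite sums; this serves for
  bounds, levels, complex-linearity and closed star-subalgebras alike.\<close>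

lemma sum_in_closed:
  assumes cl: "closed {x. P x}" and f: "(f has_sum a) S"
    and P: "\<And>T. finite T \<Longrightarrow> T \<subseteq> S \<Longrightarrow> P (\<Sum>k\<in>T. f k)"
  shows "P a"
proof -
  have "a \<in> {x. P x}"
  proof (rule Lim_in_closed_set[OF cl])
    show "(sum f \<longlongrightarrow> a) (finite_subsets_at_top S)" using f by (simp add: has_sum_def)
    show "\<forall>\<^sub>F x in finite_subsets_at_top S. sum f x \<in> {x. P x}"
      by (rule eventually_finite_subsets_at_top_weakI) (use P in auto)
  qed simp
  then show ?thesis by simp
qed

text \<open>The bounds are nonnegative, so every finite partial sum already obeys the total bound,
  and the operators obeying it form a closed set.\<close>

lemma smooth_bound_has_sum:
  assumes f: "(f has_sum a) S" and c: "(c has_sum C) S"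
    and P: "\<And>k. k \<in> S \<Longrightarrow> smooth_bound l m (c k) (f k)"
  shows "smooth_bound l m C a"
proof (rule sum_in_closed[OF closed_smooth_bound f])
  fix T assume T: "finite T" "T \<subseteq> S"
  have "smooth_bound l m (\<Sum>k\<in>T. c k) (\<Sum>k\<in>T. f k)" using T P by (intro smooth_bound_sum) auto
  then show "smooth_bound l m C (\<Sum>k\<in>T. f k)"
    by (rule smooth_bound_mono) (use T smooth_bound_nonneg[OF P] in \<open>auto intro!: has_sum_mono2[OF has_sum_finite c]\<close>)
qed

lemma ideal_bound_has_sum:
  assumes f: "(f has_sum a) S" and c: "(c has_sum C) S"
    and P: "\<And>k. k \<in> S \<Longrightarrow> ideal_bound r m (c k) (f k)"
  shows "ideal_bound r m C a"
proof (rule sum_in_closed[OF closed_ideal_bound f])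
  fix T assume T: "finite T" "T \<subseteq> S"
  have "ideal_bound r m (\<Sum>k\<in>T. c k) (\<Sum>k\<in>T. f k)" using T
    by (induction T rule: finite_induct) (auto intro: ideal_bound_zero ideal_bound_add P)
  then show "ideal_bound r m C (\<Sum>k\<in>T. f k)"
    by (rule ideal_bound_mono) (use T ideal_bound_nonneg[OF P] in \<open>auto intro!: has_sum_mono2[OF has_sum_finite c]\<close>)
qed

lemma smooth_bound_mult:
  assumes x: "smooth_bound l m C x" and y: "smooth_bound l m C' y"
  shows "smooth_bound l m (2 * 2 ^ m * C * C') (x o\<^sub>L y)"
proof -
  have C: "0 \<le> C" "0 \<le> C'" using x y by (auto dest: smooth_bound_nonneg)
  \<comment> \<open>The outer commutator of a product has two terms by the Leibniz rule, and each of
    them carries the factor 2^m of \<open>ideal_bound_mult_left\<close> or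
    \<open>ideal_bound_mult_right\<close>.\<close>
  have e: "2 * 2 ^ m * C * C' = 2 ^ m * C * C' + 2 ^ m * C * C'" by simp
  have 0: "ideal_bound 0 m C x" "ideal_bound 0 m C' y" using x y by (auto dest: smooth_bound_D)
  show ?thesis
  proof (rule smooth_bound_I)
    have "ideal_bound 0 m (2 ^ m * C * C') (x o\<^sub>L y)" using 0 by (rule ideal_bound_mult_left)
    then show "ideal_bound 0 m (2 * 2 ^ m * C * C') (x o\<^sub>L y)" by (rule ideal_bound_mono) (use C in auto)
    show "ideal_bound (Suc r) m (2 * 2 ^ m * C * C') (commutator (raise_op r) (x o\<^sub>L y))"
         "ideal_bound (Suc r) m (2 * 2 ^ m * C * C') (commutator (lower_op r) (x o\<^sub>L y))" if "r < l" for r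
      unfolding commutator_compose e using smooth_bound_D[OF x] smooth_bound_D[OF y] that 0
      by (intro ideal_bound_add ideal_bound_mult_left ideal_bound_mult_right; simp)+
    show "ideal_bound l m (2 * 2 ^ m * C * C') (commutator (num_op l M) (x o\<^sub>L y))" for M
      unfolding commutator_compose e using smooth_bound_D[OF x] smooth_bound_D[OF y] 0
      by (intro ideal_bound_add ideal_bound_mult_left ideal_bound_mult_right; simp)
    show "level_proj l o\<^sub>L (x o\<^sub>L y) = x o\<^sub>L y" using smooth_bound_D(2)[OF x] by (metis compose_assoc)
    show "(x o\<^sub>L y) o\<^sub>L level_proj l = x o\<^sub>L y" using smooth_bound_D(3)[OF y] by (metis compose_assoc)
  qed (use smooth_bound_D[OF x] smooth_bound_D[OF y] in \<open>auto simp: commutator_compose compose_distrib\<close>)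
qed

lemma smooth_bound_adj:
  assumes x: "smooth_bound l m C x"
  shows "smooth_bound l m (2 ^ m * C) (adj x)"
proof (rule smooth_bound_I)
  note [simp] = smooth_bound_D(1)[OF x]
  show "complex_linear (adj x)" by simp
  show "level_proj l o\<^sub>L adj x = adj x"
    using arg_cong[OF smooth_bound_D(3)[OF x], of adj] by (simp add: adj_compose)
  show "adj x o\<^sub>L level_proj l = adj x"
    using arg_cong[OF smooth_bound_D(2)[OF x], of adj] by (simp add: adj_compose)
  show "commutator z_up (adj x) = 0" "commutator z_down (adj x) = 0"
    using smooth_bound_D(4,5)[OF x] by (simp_all add: commutator_adj)
  show "ideal_bound 0 m (2 ^ m * C) (adj x)" using smooth_bound_D(6)[OF x] by (intro ideal_bound_adj) auto
  show "ideal_bound (Suc r) m (2 ^ m * C) (commutator (raise_op r) (adj x))"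
       "ideal_bound (Suc r) m (2 ^ m * C) (commutator (lower_op r) (adj x))" if "r < l" for r
    using smooth_bound_D(7,8)[OF x that] by (auto simp: commutator_adj intro!: ideal_bound_minus ideal_bound_adj)
  show "ideal_bound l m (2 ^ m * C) (commutator (num_op l M) (adj x))" for M
    using smooth_bound_D(9)[OF x] by (auto simp: commutator_adj intro!: ideal_bound_minus ideal_bound_adj)
qed

lemma commutator_level_proj: "commutator (num_op i M) (level_proj l) = 0" "commutator (raise_op r) (level_proj l) = 0" "commutator (lower_op r) (level_proj l) = 0"
  "commutator z_up (level_proj l) = 0" "commutator z_down (level_proj l) = 0"
  by (simp_all add: commutator_def level_proj_rules)

lemma ideal_bound_level_proj: "ideal_bound 0 m 1 (level_proj l)"
  by (cases m) (auto simp: ideal_bound_Suc commutator_level_proj norm_basic ideal_bound_zero)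

lemma smooth_bound_level_proj: "smooth_bound l m 1 (level_proj l)"
  by (rule smooth_bound_I) (auto simp: commutator_level_proj level_proj_rules ideal_bound_level_proj ideal_bound_zero)

text \<open>All operators g of the outer commutators commute with the unit of the level, so [g, b] =
  - b [g, a] b holds for each of them, and the factors b preserve the ideal that contains
  [g, a].\<close>

lemma smooth_bound_inverse:
  "\<exists>C'. \<forall>a b. smooth_bound l m C a \<longrightarrow> complex_linear b \<longrightarrow> norm b \<le> \<beta> \<longrightarrow> a o\<^sub>L b = level_proj l \<longrightarrow> b o\<^sub>L a = level_proj l \<longrightarrow>
     level_proj l o\<^sub>L b = b \<longrightarrow> b o\<^sub>L level_proj l = b \<longrightarrow> smooth_bound l m C' b"
proof -
  obtain C' where C': "\<And>a b. ideal_bound 0 m C a \<Longrightarrow> norm b \<le> \<beta> \<Longrightarrow> a o\<^sub>L b = level_proj l \<Longrightarrow> b o\<^sub>L a = level_proj l \<Longrightarrow>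
     level_proj l o\<^sub>L b = b \<Longrightarrow> b o\<^sub>L level_proj l = b \<Longrightarrow> ideal_bound 0 m C' b" using ideal_bound_inverse[of m C \<beta> l] by blast
  define D where "D = max C' (2 ^ m * (2 ^ m * C' * C) * C')"
  have "smooth_bound l m D b"
    if a: "smooth_bound l m C a" and cl: "complex_linear b"
      and b: "norm b \<le> \<beta>" "a o\<^sub>L b = level_proj l" "b o\<^sub>L a = level_proj l" "level_proj l o\<^sub>L b = b" "b o\<^sub>L level_proj l = b" for a b
  proof -
    have IH: "ideal_bound 0 m C' b" using smooth_bound_D(6)[OF a] b by (intro C') auto
    have mul: "ideal_bound r m D (b o\<^sub>L y o\<^sub>L b)" if "ideal_bound r m C y" for y r
      by (rule ideal_bound_mono[where C = "2 ^ m * (2 ^ m * C' * C) * C'"], intro ideal_bound_mult_right ideal_bound_mult_left IH that)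
         (simp add: D_def)
    have Z: "z_up o\<^sub>L level_proj l = level_proj l o\<^sub>L z_up" "z_down o\<^sub>L level_proj l = level_proj l o\<^sub>L z_down"
      "raise_op r o\<^sub>L level_proj l = level_proj l o\<^sub>L raise_op r" "lower_op r o\<^sub>L level_proj l = level_proj l o\<^sub>L lower_op r" for r
      by (simp_all add: level_proj_rules)
    show ?thesis
    proof (rule smooth_bound_I)
      show "ideal_bound 0 m D b" using IH by (rule ideal_bound_mono) (simp add: D_def)
      show "commutator z_up b = 0" "commutator z_down b = 0"
        using smooth_bound_D(4,5)[OF a] commutator_inverse[OF b(2-5) Z(1)] commutator_inverse[OF b(2-5) Z(2)]
        by (simp_all add: compose_distrib)
      show "ideal_bound (Suc r) m D (commutator (raise_op r) b)" "ideal_bound (Suc r) m D (commutator (lower_op r) b)" if "r < l" for r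
        using smooth_bound_D(7,8)[OF a that]
        by (simp_all add: commutator_inverse[OF b(2-5) Z(3)] commutator_inverse[OF b(2-5) Z(4)] ideal_bound_minus mul)
      show "ideal_bound l m D (commutator (num_op l M) b)" for M
        using smooth_bound_D(9)[OF a] by (simp add: commutator_inverse[OF b(2-5) num_op_level_proj] ideal_bound_minus mul)
    qed (use b cl in auto)
  qed
  then show ?thesis by blast
qed


section \<open>The operators of the quantum sphere\<close>

lemma weighted_comp_ok_nat:
  "weighted_comp_ok (\<lambda>n::nat. 1) Suc" "weighted_comp_ok (\<lambda>n::nat. if n = 0 then 0 else 1) (\<lambda>n. n - Suc 0)"
  "weighted_comp_ok (\<lambda>n::nat. if n = 0 then 1 else 0) id"
  by (auto intro!: weighted_comp_okI[where B = 1] split: if_splits)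

lemma weighted_comp_ok_q: "0 \<le> q \<Longrightarrow> q < 1 \<Longrightarrow> weighted_comp_ok ((^) (complex_of_real q)) id"
  by (intro weighted_comp_okI[where B = 1]) (auto simp: norm_power power_le_one)

lemma q_sqrt_bounds:
  fixes q :: real
  assumes "0 \<le> q" "q < 1"
  shows "0 \<le> 1 - q ^ (2 * n)" "1 - q ^ (2 * n) \<le> 1"
  using assms by (auto simp: power_le_one)

lemma weighted_comp_ok_sqrt: "0 \<le> q \<Longrightarrow> q < 1 \<Longrightarrow> weighted_comp_ok (\<lambda>n::nat. complex_of_real (sqrt (1 - q ^ (2 * n)))) id"
  using q_sqrt_bounds[of q] by (intro weighted_comp_okI[where B = 1]) auto

lemma S_nat_eq: "S_nat = weighted_comp (\<lambda>n. 1) Suc"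
  unfolding S_nat_def
  by (intro op_on_basis_eqI coord_eqI complex_linear_weighted_comp weighted_comp_ok_nat) (auto simp: coord_weighted_comp weighted_comp_ok_nat coord_ket)

lemma adj_S_nat: "adj S_nat = weighted_comp (\<lambda>n. if n = 0 then 0 else 1) (\<lambda>n. n - Suc 0)"
  unfolding S_nat_eq by (rule adj_weighted_comp) (auto intro: weighted_comp_ok_nat)

lemma p0_eq: "p0 = weighted_comp (\<lambda>n. if n = 0 then 1 else 0) id"
  unfolding p0_def
  by (intro op_on_basis_eqI coord_eqI complex_linear_weighted_comp weighted_comp_ok_nat) (auto simp: coord_weighted_comp weighted_comp_ok_nat coord_ket)

lemma q_pow_N_eq: "0 \<le> q \<Longrightarrow> q < 1 \<Longrightarrow> q_pow_N q = weighted_comp ((^) (complex_of_real q)) id"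
  unfolding q_pow_N_def
  by (intro op_on_basis_eqI coord_eqI complex_linear_weighted_comp weighted_comp_ok_q) (auto simp: coord_weighted_comp[OF weighted_comp_ok_q] coord_ket)

lemma sqrt_eq: "0 \<le> q \<Longrightarrow> q < 1 \<Longrightarrow>
    sqrt_one_minus_q_2N q = weighted_comp (\<lambda>n. of_real (sqrt (1 - q ^ (2 * n)))) id"
  unfolding sqrt_one_minus_q_2N_def
  by (intro op_on_basis_eqI coord_eqI complex_linear_weighted_comp weighted_comp_ok_sqrt) (auto simp: coord_weighted_comp[OF weighted_comp_ok_sqrt] coord_ket)

lemma weighted_comp_ok_int: "weighted_comp_ok (\<lambda>n::int. 1) (\<lambda>n. n + 1)" "weighted_comp_ok (\<lambda>n::int. 1) (\<lambda>n. n - 1)"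
  by (auto intro!: weighted_comp_okI[where B = 1])

lemma S_int_eq: "S_int = weighted_comp (\<lambda>n. 1) (\<lambda>n. n + 1)"
  unfolding S_int_def
  by (intro op_on_basis_eqI coord_eqI complex_linear_weighted_comp weighted_comp_ok_int) (auto simp: coord_weighted_comp weighted_comp_ok_int coord_ket)

lemma adj_S_int: "adj S_int = weighted_comp (\<lambda>n. 1) (\<lambda>n. n - 1)"
  unfolding S_int_eq by (rule adj_weighted_comp) (auto intro: weighted_comp_ok_int)

lemma ket_values:
  "S_nat (ket n) = cscale (if n = 0 then 0 else 1) (ket (n - 1))"
  "adj S_nat (ket n) = cscale 1 (ket (Suc n))"
  "p0 (ket n) = cscale (if n = 0 then 1 else 0) (ket n)"
  "id_blinfun (ket n) = cscale 1 (ket n)"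
  "adj S_int (ket z) = cscale 1 (ket (z + 1))"
  by (rule coord_eqI, auto simp: S_nat_eq p0_eq adj_S_nat[unfolded S_nat_eq] adj_S_int coord_weighted_comp weighted_comp_ok_nat weighted_comp_ok_int coord_ket)+

lemma ket_values_q:
  assumes "0 \<le> q" "q < 1"
  shows "q_pow_N q (ket n) = cscale (of_real (q ^ n)) (ket n)"
    "(sqrt_one_minus_q_2N q o\<^sub>L adj S_nat) (ket n) = cscale (of_real (sqrt (1 - q ^ (2 * Suc n)))) (ket (Suc n))"
  by (rule coord_eqI; auto simp: assms q_pow_N_eq sqrt_eq adj_S_nat coord_weighted_comp[OF weighted_comp_ok_q] coord_weighted_comp[OF weighted_comp_ok_sqrt] coord_weighted_comp[OF weighted_comp_ok_nat(2)] coord_ket)+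

section \<open>Recognising tensor products by their values on basis vectors\<close>

lemma Abs_ell2_eqI: "(\<And>i. f i = coord v i) \<Longrightarrow> Abs_ell2 f = v"
  by (metis coord_inverse ext)

lemma tensor_vec_ket: "tensor_vec (cscale c (ket n)) y = cscale c (ins_op n y)"
  unfolding tensor_vec_def by (rule Abs_ell2_eqI) (auto simp: coord_basic coord_ket split: list.split)

lemma ell2_int_vec_ket: "ell2_int_vec (cscale c (ket n)) = cscale c (ket ([], n))"
  unfolding ell2_int_vec_def by (rule Abs_ell2_eqI) (auto simp: coord_ket split: if_splits)

text \<open>Every first factor that occurs sends basis vectors to multiples of basis vectors, so
  that \<open>tensor_vec\<close> reduces to a scaled \<open>ins_op\<close>.\<close>

lemma tensor_op_eqI:
  fixes T :: "nat op" and X R :: "idx op"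
  assumes "\<And>n. T (ket n) = cscale (w n) (ket (h n))" and "complex_linear X"
    and "\<And>z. X (ket ([], z)) = 0"
    and "\<And>n ms z. X (ket (n # ms, z)) = cscale (w n) (ins_op (h n) (R (ket (ms, z))))"
  shows "T \<otimes>\<^sub>o R = X"
  unfolding tensor_op_def
proof (rule op_on_basis_eqI[OF assms(2)])
  fix J :: idx
  show "X (ket J) = (case J of (ns, z) \<Rightarrow> case ns of [] \<Rightarrow> 0 | n # ms \<Rightarrow> tensor_vec (T (ket n)) (R (ket (ms, z))))"
    by (auto simp: assms tensor_vec_ket split: prod.split list.split)
qed

lemma ell2_int_op_eqI:
  fixes T :: "int op" and X :: "idx op"
  assumes "\<And>z. T (ket z) = cscale (w z) (ket (h z))" and "complex_linear X"
    and "\<And>ns z. X (ket (ns, z)) = (if ns = [] then cscale (w z) (ket ([], h z)) else 0)"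
  shows "ell2_int_op T = X"
  unfolding ell2_int_op_def
  by (rule op_on_basis_eqI[OF assms(2)]) (auto simp: assms ell2_int_vec_ket split: prod.split)

lemma ins_op_ket: "ins_op n (ket J) = ket (n # fst J, snd J)"
  by (rule coord_eqI) (auto simp: coord_basic coord_ket neq_Nil_conv)

lemma del_op_ket: "del_op n (ket (k # ms, z)) = (if k = n then ket (ms, z) else 0)" "del_op n (ket ([], z)) = 0"
  by (rule coord_eqI, auto simp: coord_basic coord_ket)+

lemma level_proj_ket: "level_proj l (ket J) = (if length (fst J) = l then ket J else 0)"
  by (rule coord_eqI) (auto simp: coord_basic coord_ket)

lemma lower_op_ket: "lower_op 0 (ket (n # ms, z)) = (if n = 0 then 0 else ket ((n - 1) # ms, z))" "lower_op 0 (ket ([], z)) = 0"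
  and raise_op_ket: "raise_op 0 (ket (n # ms, z)) = ket (Suc n # ms, z)" "raise_op 0 (ket ([], z)) = 0"
  and z_up_ket: "z_up (ket J) = ket (fst J, snd J + 1)"
  by (rule coord_eqI, auto simp: coord_basic coord_ket neq_Nil_conv)+

lemma unit_op_eq: "unit_op l = level_proj l"
proof (induction l)
  case 0
  have "ell2_int_op id_blinfun = level_proj 0"
    by (rule ell2_int_op_eqI[where w = "\<lambda>_. 1" and h = id]) (auto simp: level_proj_ket)
  then show ?case by (simp add: unit_op_def tensor_list_def)
next
  case (Suc l)
  have "id_blinfun \<otimes>\<^sub>o level_proj l = level_proj (Suc l)"
    by (rule tensor_op_eqI[where w = "\<lambda>_. 1" and h = id])
       (auto simp: level_proj_ket ins_op_ket blinfun.zero_right)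
  then show ?case using Suc by (simp add: unit_op_def tensor_list_def)
qed

lemma alpha_eq: "S_nat \<otimes>\<^sub>o unit_op l = lower_op 0 o\<^sub>L level_proj (Suc l)"
  by (rule tensor_op_eqI[where w = "\<lambda>n. if n = 0 then 0 else 1" and h = "\<lambda>n. n - 1"])
     (auto simp: ket_values unit_op_eq level_proj_ket lower_op_ket ins_op_ket blinfun.zero_right)

lemma adj_alpha_eq: "adj (lower_op 0 o\<^sub>L level_proj l) = raise_op 0 o\<^sub>L level_proj l"
  by (simp add: adj_compose level_proj_rules)

text \<open>With E_jk the matrix units of the first leg this is E_jk \<otimes> b. Conversely
  \<open>slice j k\<close> reads off the (j, k) block of an operator over the first leg.\<close>

definition embed :: "nat \<Rightarrow> nat \<Rightarrow> idx op \<Rightarrow> idx op"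
  where "embed j k b = ins_op j o\<^sub>L b o\<^sub>L del_op k"

definition slice :: "nat \<Rightarrow> nat \<Rightarrow> idx op \<Rightarrow> idx op"
  where "slice j k x = del_op j o\<^sub>L x o\<^sub>L ins_op k"

text \<open>The powers of \<open>\<alpha>\<^sub>1\<close> at level \<open>Suc l\<close>, with the
  unit of that level as power zero, in the shape that the expansion takes after
  \<open>alpha_eq\<close>; \<open>up_pow\<close> does the same for the adjoint.\<close>

definition down_pow :: "nat \<Rightarrow> nat \<Rightarrow> idx op"
  where "down_pow l k = op_power (level_proj (Suc l)) (lower_op 0 o\<^sub>L level_proj (Suc l)) k"

definition up_pow :: "nat \<Rightarrow> nat \<Rightarrow> idx op"
  where "up_pow l k = op_power (level_proj (Suc l)) (raise_op 0 o\<^sub>L level_proj (Suc l)) k"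

text \<open>All integer powers of the generator of level 0 in one formula, confined to that
  level.\<close>

definition z_shift :: "int \<Rightarrow> idx op"
  where "z_shift n = weighted_comp (\<lambda>J. if fst J = [] then 1 else 0) (\<lambda>J. (fst J, snd J - n))"

lemma weighted_comp_ok_z_shift: "weighted_comp_ok (\<lambda>J::idx. if fst J = [] then 1 else 0) (\<lambda>J. (fst J, snd J - n))"
  by (rule weighted_comp_okI[where B = 1]) (auto intro: prod_eqI)

lemma coord_z_shift: "coord (z_shift n x) J = (if fst J = [] then coord x (fst J, snd J - n) else 0)"
  unfolding z_shift_def by (simp add: coord_weighted_comp[OF weighted_comp_ok_z_shift])

lemma complex_linear_z_shift [simp, intro]: "complex_linear (z_shift n)"
  unfolding z_shift_def by (rule complex_linear_weighted_comp[OF weighted_comp_ok_z_shift])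

lemma norm_z_shift: "norm (z_shift n) \<le> 1"
  unfolding z_shift_def by (rule norm_weighted_comp[OF weighted_comp_ok_z_shift]) simp

lemma z_eq: "ell2_int_op (adj S_int) = z_shift 1"
proof (rule ell2_int_op_eqI[where w = "\<lambda>_. 1" and h = "\<lambda>n. n + 1"])
  show "z_shift 1 (ket (ns, z)) = (if ns = [] then cscale 1 (ket ([], z + 1)) else 0)" for ns z
    by (rule coord_eqI) (auto simp: coord_z_shift coord_ket)
qed (auto simp: ket_values)

lemma z_shift_mult: "z_shift m o\<^sub>L z_shift n = z_shift (m + n)"
  by (rule blinfun_eqI, rule coord_eqI) (auto simp: coord_z_shift algebra_simps)

lemma z_shift_0: "z_shift 0 = level_proj 0"
  by (rule blinfun_eqI, rule coord_eqI) (auto simp: coord_z_shift coord_basic)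

lemma adj_z_shift: "adj (z_shift n) = z_shift (- n)"
  unfolding z_shift_def by (rule adj_weighted_comp[OF weighted_comp_ok_z_shift weighted_comp_ok_z_shift]) auto

lemma op_power_simps [simp]: "op_power u T 0 = u" "op_power u T (Suc n) = T o\<^sub>L op_power u T n"
  by (simp_all add: op_power_def)

lemma z_pow_eq: "z_pow n = z_shift n"
proof -
  have p: "op_power (level_proj 0) (z_shift 1) k = z_shift (int k)" for k
    by (induction k) (auto simp: z_shift_mult z_shift_0)
  have m: "op_power (level_proj 0) (z_shift (-1)) k = z_shift (- int k)" for k
    by (induction k) (auto simp: z_shift_mult z_shift_0 algebra_simps)
  show ?thesis by (simp add: z_pow_def z_eq unit_op_eq adj_z_shift p m Let_def)
qed

lemma p0_tensor_eq:
  assumes "complex_linear b"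
  shows "p0 \<otimes>\<^sub>o b = embed 0 0 b"
  by (rule tensor_op_eqI[where w = "\<lambda>n. if n = 0 then 1 else 0" and h = id])
     (use assms in \<open>auto simp: ket_values embed_def del_op_ket blinfun.zero_right\<close>)

lemma complex_linear_sphere [simp, intro]:
  "complex_linear b \<Longrightarrow> complex_linear (embed j k b)" "complex_linear b \<Longrightarrow> complex_linear (slice j k b)"
  "complex_linear (down_pow l k)" "complex_linear (up_pow l k)"
proof -
  have "complex_linear (op_power u T n)" if "complex_linear u" "complex_linear T" for u T :: "idx op" and n
    using that by (induction n) auto
  then show "complex_linear (down_pow l k)" "complex_linear (up_pow l k)" by (auto simp: down_pow_def up_pow_def)
qed (auto simp: embed_def slice_def)

lemma down_pow_level_proj: "down_pow l n o\<^sub>L level_proj (Suc l) = down_pow l n" "level_proj (Suc l) o\<^sub>L down_pow l n = down_pow l n"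
proof (induction n)
  case (Suc n)
  { case 1 show ?case using Suc by (simp add: down_pow_def compose_assoc) }
  { case 2
    have "level_proj (Suc l) o\<^sub>L (lower_op 0 o\<^sub>L level_proj (Suc l)) = lower_op 0 o\<^sub>L level_proj (Suc l)"
      by (metis compose_assoc level_proj_rules(1,4))
    then show ?case by (simp add: down_pow_def compose_assoc[symmetric]) }
qed (simp_all add: down_pow_def level_proj_rules)

lemma up_pow_level_proj: "up_pow l n o\<^sub>L level_proj (Suc l) = up_pow l n" "level_proj (Suc l) o\<^sub>L up_pow l n = up_pow l n"
proof (induction n)
  case (Suc n)
  { case 1 show ?case using Suc by (simp add: up_pow_def compose_assoc) }
  { case 2
    have "level_proj (Suc l) o\<^sub>L (raise_op 0 o\<^sub>L level_proj (Suc l)) = raise_op 0 o\<^sub>L level_proj (Suc l)"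
      by (metis compose_assoc level_proj_rules(1,3))
    then show ?case by (simp add: up_pow_def compose_assoc[symmetric]) }
qed (simp_all add: up_pow_def level_proj_rules)

lemma down_pow_Suc: "down_pow l (Suc n) = lower_op 0 o\<^sub>L down_pow l n"
  and up_pow_Suc: "up_pow l (Suc n) = raise_op 0 o\<^sub>L up_pow l n"
  using down_pow_level_proj(2)[of l n] up_pow_level_proj(2)[of l n] by (simp_all add: down_pow_def up_pow_def compose_assoc)

lemma down_pow_0: "down_pow l 0 = level_proj (Suc l)" and up_pow_0: "up_pow l 0 = level_proj (Suc l)"
  by (simp_all add: down_pow_def up_pow_def)

lemma del_op_down_pow: "del_op j o\<^sub>L down_pow l n = level_proj l o\<^sub>L del_op (j + n)"
proof (induction n arbitrary: j)
  case (Suc n)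
  have "del_op j o\<^sub>L down_pow l (Suc n) = (del_op j o\<^sub>L lower_op 0) o\<^sub>L down_pow l n"
    unfolding down_pow_Suc compose_assoc ..
  then show ?case using Suc by (simp add: slice_rules)
qed (simp add: down_pow_0 slice_rules)

lemma up_pow_ins_op: "up_pow l n o\<^sub>L ins_op k = ins_op (k + n) o\<^sub>L level_proj l"
proof (induction n)
  case (Suc n)
  have "up_pow l (Suc n) o\<^sub>L ins_op k = raise_op 0 o\<^sub>L ins_op (k + n) o\<^sub>L level_proj l"
    unfolding up_pow_Suc using Suc by (simp add: compose_assoc)
  then show ?case by (simp add: slice_rules)
qed (simp add: up_pow_0 slice_rules)

lemma norm_down_pow: "norm (down_pow l n) \<le> 1" and norm_up_pow: "norm (up_pow l n) \<le> 1"
proof -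
  have c: "norm (T o\<^sub>L R) \<le> 1" if "norm T \<le> 1" "norm R \<le> 1" for T R :: "idx op"
    using norm_compose[of T R] mult_le_one[OF that(1) _ that(2)] by simp
  show "norm (down_pow l n) \<le> 1"
    by (induction n) (simp_all add: down_pow_0 down_pow_Suc norm_basic c del: op_power_simps)
  show "norm (up_pow l n) \<le> 1"
    by (induction n) (simp_all add: up_pow_0 up_pow_Suc norm_basic c del: op_power_simps)
qed

text \<open>A power of the adjoint shift, p0 and a power of the shift multiply to the matrix unit
  E_jk on the first leg, so each term of the double series is a single block.\<close>

lemma toeplitz_term_eq:
  assumes b: "complex_linear b" "level_proj l o\<^sub>L b = b" "b o\<^sub>L level_proj l = b"
  shows "up_pow l j o\<^sub>L (p0 \<otimes>\<^sub>o b) o\<^sub>L down_pow l k = embed j k b"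
proof -
  have "up_pow l j o\<^sub>L embed 0 0 b o\<^sub>L down_pow l k = (up_pow l j o\<^sub>L ins_op 0) o\<^sub>L b o\<^sub>L (del_op 0 o\<^sub>L down_pow l k)"
    by (simp add: embed_def compose_assoc)
  also have "\<dots> = ins_op j o\<^sub>L (level_proj l o\<^sub>L b o\<^sub>L level_proj l) o\<^sub>L del_op k"
    by (simp add: up_pow_ins_op del_op_down_pow compose_assoc)
  finally show ?thesis using b by (simp add: p0_tensor_eq embed_def)
qed

lemma slice_embed: "slice j k (embed j' k' b) = (if j = j' \<and> k = k' then b else 0)"
proof -
  have "slice j k (embed j' k' b) = (del_op j o\<^sub>L ins_op j') o\<^sub>L b o\<^sub>L (del_op k' o\<^sub>L ins_op k)"
    by (simp add: slice_def embed_def compose_assoc)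
  then show ?thesis by (auto simp: slice_rules compose_distrib blinfun_eqI)
qed

lemma slice_down_pow: "slice j k (down_pow l n) = (if k = j + n then level_proj l else 0)"
proof -
  have "slice j k (down_pow l n) = level_proj l o\<^sub>L (del_op (j + n) o\<^sub>L ins_op k)"
    by (simp add: slice_def del_op_down_pow compose_assoc)
  then show ?thesis by (auto simp: slice_rules compose_distrib blinfun_eqI)
qed

lemma slice_up_pow: "slice j k (up_pow l n) = (if j = k + n then level_proj l else 0)"
proof -
  have "slice j k (up_pow l n) = (del_op j o\<^sub>L ins_op (k + n)) o\<^sub>L level_proj l"
    by (simp add: slice_def up_pow_ins_op compose_assoc)
  then show ?thesis by (auto simp: slice_rules compose_distrib blinfun_eqI)
qed

lemma norm_embed: "norm (embed j k b) \<le> norm b"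
proof -
  have "norm (embed j k b) \<le> norm (ins_op j o\<^sub>L b) * norm (del_op k)" unfolding embed_def by (rule norm_compose)
  also have "\<dots> \<le> (norm (ins_op j) * norm b) * norm (del_op k)" by (intro mult_right_mono norm_compose) simp
  also have "\<dots> \<le> (1 * norm b) * 1" by (intro mult_mono norm_basic) auto
  finally show ?thesis by simp
qed

lemma norm_slice: "norm (slice j k b) \<le> norm b"
proof -
  have "norm (slice j k b) \<le> norm (del_op j o\<^sub>L b) * norm (ins_op k)" unfolding slice_def by (rule norm_compose)
  also have "\<dots> \<le> (norm (del_op j) * norm b) * norm (ins_op k)" by (intro mult_right_mono norm_compose) simp
  also have "\<dots> \<le> (1 * norm b) * 1" by (intro mult_mono norm_basic) auto
  finally show ?thesis by simp
qed

lemma bounded_linear_slice: "bounded_linear (slice j k)"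
  unfolding slice_def[abs_def]
  by (rule bounded_linear_compose[OF bounded_linear_compose_left bounded_linear_compose_right])

lemma bounded_linear_embed: "bounded_linear (embed j k)"
  unfolding embed_def[abs_def]
  by (rule bounded_linear_compose[OF bounded_linear_compose_left bounded_linear_compose_right])

lemma slice_scale: "slice j k (c \<cdot>\<^sub>C x) = c \<cdot>\<^sub>C slice j k x"
  and embed_scale: "embed j k (c \<cdot>\<^sub>C x) = c \<cdot>\<^sub>C embed j k x"
  by (simp_all add: slice_def embed_def op_scale_compose_left op_scale_compose_right)

lemmas slice_linear = linear_simps[OF bounded_linear_slice]

lemma ent_slice: "ent (slice j k x) J K = ent x (j # fst J, snd J) (k # fst K, snd K)"
  by (simp add: ent_def slice_def coord_basic ins_op_ket)

lemma ent_level_proj: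
  "level_proj l o\<^sub>L x = x \<Longrightarrow> length (fst J) \<noteq> l \<Longrightarrow> ent x J K = 0"
  "x o\<^sub>L level_proj l = x \<Longrightarrow> length (fst K) \<noteq> l \<Longrightarrow> ent x J K = 0"
proof -
  assume "level_proj l o\<^sub>L x = x" "length (fst J) \<noteq> l"
  moreover have "ent (level_proj l o\<^sub>L x) J K = (if length (fst J) = l then ent x J K else 0)"
    by (simp add: ent_def coord_basic)
  ultimately show "ent x J K = 0" by simp
next
  assume "x o\<^sub>L level_proj l = x" "length (fst K) \<noteq> l"
  moreover have "ent (x o\<^sub>L level_proj l) J K = (if length (fst K) = l then ent x J K else 0)"
    by (simp add: ent_def level_proj_ket blinfun.zero_right)
  ultimately show "ent x J K = 0" by simp
qed

text \<open>The level conditions make all entries vanish except at indices of length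
  \<open>Suc l\<close>, and each entry there belongs to some block.\<close>

lemma slice_eqI:
  assumes x: "complex_linear x" "level_proj (Suc l) o\<^sub>L x = x" "x o\<^sub>L level_proj (Suc l) = x"
    and y: "complex_linear y" "level_proj (Suc l) o\<^sub>L y = y" "y o\<^sub>L level_proj (Suc l) = y"
    and eq: "\<And>j k. slice j k x = slice j k y"
  shows "x = y"
proof (rule op_eqI[OF x(1) y(1)])
  fix J K :: idx
  show "ent x J K = ent y J K"
  proof (cases "length (fst J) = Suc l \<and> length (fst K) = Suc l")
    case True
    then obtain j ms k ns where "fst J = j # ms" "fst K = k # ns" by (auto simp: length_Suc_conv)
    then have "J = (j # ms, snd J)" "K = (k # ns, snd K)" by (auto intro: prod_eqI)
    then show ?thesis using arg_cong[OF eq[of j k], of "\<lambda>T. ent T (ms, snd J) (ns, snd K)"]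
      by (simp add: ent_slice)
  next
    case False
    then show ?thesis using ent_level_proj(1)[OF x(2), of J K] ent_level_proj(2)[OF x(3), of K J]
        ent_level_proj(1)[OF y(2), of J K] ent_level_proj(2)[OF y(3), of K J] by auto
  qed
qed

lemma embed_level_proj:
  "level_proj l o\<^sub>L b = b \<Longrightarrow> level_proj (Suc l) o\<^sub>L embed j k b = embed j k b"
  "b o\<^sub>L level_proj l = b \<Longrightarrow> embed j k b o\<^sub>L level_proj (Suc l) = embed j k b"
proof -
  have "level_proj (Suc l) o\<^sub>L embed j k b = (level_proj (Suc l) o\<^sub>L ins_op j) o\<^sub>L b o\<^sub>L del_op k"
    by (simp add: embed_def compose_assoc)
  also have "\<dots> = embed j k (level_proj l o\<^sub>L b)"
    by (simp add: embed_def slice_rules(21) compose_assoc)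
  finally show "level_proj l o\<^sub>L b = b \<Longrightarrow> level_proj (Suc l) o\<^sub>L embed j k b = embed j k b" by simp
  have "embed j k b o\<^sub>L level_proj (Suc l) = ins_op j o\<^sub>L b o\<^sub>L (del_op k o\<^sub>L level_proj (Suc l))"
    by (simp add: embed_def compose_assoc)
  also have "\<dots> = embed j k (b o\<^sub>L level_proj l)"
    by (simp add: embed_def slice_rules(20) compose_assoc)
  finally show "b o\<^sub>L level_proj l = b \<Longrightarrow> embed j k b o\<^sub>L level_proj (Suc l) = embed j k b" by simp
qed

lemma slice_level_proj:
  "level_proj (Suc l) o\<^sub>L x = x \<Longrightarrow> level_proj l o\<^sub>L slice j k x = slice j k x"
  "x o\<^sub>L level_proj (Suc l) = x \<Longrightarrow> slice j k x o\<^sub>L level_proj l = slice j k x"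
proof -
  have "level_proj l o\<^sub>L slice j k x = (level_proj l o\<^sub>L del_op j) o\<^sub>L x o\<^sub>L ins_op k"
    by (simp add: slice_def compose_assoc)
  also have "\<dots> = slice j k (level_proj (Suc l) o\<^sub>L x)"
    by (simp add: slice_def slice_rules(20)[symmetric] compose_assoc)
  finally show "level_proj (Suc l) o\<^sub>L x = x \<Longrightarrow> level_proj l o\<^sub>L slice j k x = slice j k x" by simp
  have "slice j k x o\<^sub>L level_proj l = del_op j o\<^sub>L x o\<^sub>L (ins_op k o\<^sub>L level_proj l)"
    by (simp add: slice_def compose_assoc)
  also have "\<dots> = slice j k (x o\<^sub>L level_proj (Suc l))"
    by (simp add: slice_def slice_rules(21)[symmetric] compose_assoc)
  finally show "x o\<^sub>L level_proj (Suc l) = x \<Longrightarrow> slice j k x o\<^sub>L level_proj l = slice j k x" by simp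
qed


section \<open>Summability\<close>

lemma summable_inverse_square_nat: "(\<lambda>n::nat. 1 / (1 + real n) ^ 2) summable_on UNIV"
proof -
  have "summable (\<lambda>n. inverse ((real n) ^ 2))" by (rule inverse_power_summable) simp
  then have "summable (\<lambda>n. inverse ((real (Suc n)) ^ 2))" by (subst summable_Suc_iff)
  then have "summable (\<lambda>n. norm (1 / (1 + real n) ^ 2))" by (simp add: field_simps)
  then show ?thesis by (rule norm_summable_imp_summable_on)
qed

lemma summable_on_int:
  fixes f :: "int \<Rightarrow> 'a :: banach"
  assumes "(\<lambda>n::nat. f (int n)) summable_on UNIV" "(\<lambda>n::nat. f (- int n)) summable_on {0<..}"
  shows "f summable_on UNIV"
proof -
  have 1: "f summable_on range int"
    using assms(1) by (subst summable_on_reindex) (auto simp: o_def)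
  have 2: "f summable_on (\<lambda>n. - int n) ` {0<..}"
    using assms(2) by (subst summable_on_reindex) (auto simp: o_def inj_on_def)
  have "range int \<union> (\<lambda>n. - int n) ` {0<..} = UNIV"
  proof -
    have "n \<in> range int \<union> (\<lambda>n. - int n) ` {0<..}" for n
    proof (cases "0 \<le> n")
      case True then show ?thesis by (metis UnI1 nonneg_int_cases rangeI)
    next
      case False
      then have "n = - int (nat (- n))" "nat (- n) \<in> {0<..}" by auto
      then show ?thesis by blast
    qed
    then show ?thesis by blast
  qed
  then show ?thesis using summable_on_Un_disjoint[OF 1 2] by fastforce
qed

lemma summable_inverse_square_int: "(\<lambda>n::int. 1 / (1 + \<bar>real_of_int n\<bar>) ^ 2) summable_on UNIV"
  using summable_on_subset_banach[OF summable_inverse_square_nat, of "{0<..}"]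
  by (intro summable_on_int) (auto simp: summable_inverse_square_nat)

lemma summable_inverse_pair:
  "(\<lambda>(j, k). 1 / (1 + real j + real k) ^ 4) summable_on UNIV"
proof (rule summable_on_comparison_test)
  have "(\<lambda>(j, k). (1 / (1 + real j) ^ 2) * (1 / (1 + real k) ^ 2)) summable_on UNIV \<times> UNIV"
    by (rule summable_on_SigmaI[where g = "\<lambda>j. (1 / (1 + real j) ^ 2) * (\<Sum>\<^sub>\<infinity>k::nat. 1 / (1 + real k) ^ 2)"])
       (simp_all only: prod.case has_sum_cmult_right[OF has_sum_infsum[OF summable_inverse_square_nat]]
          summable_on_cmult_left[OF summable_inverse_square_nat], simp)
  then show "(\<lambda>(j, k). (1 / (1 + real j) ^ 2) * (1 / (1 + real k) ^ 2)) summable_on UNIV" by simp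
  \<comment> \<open>The exponent 4 is spent as 2 + 2, so that a product of two convergent single
    sums dominates.\<close>
  have "(1 + real j)\<^sup>2 * (1 + real k)\<^sup>2 \<le> (1 + real j + real k) ^ 4" for j k
  proof -
    have "(1 + real j)\<^sup>2 * (1 + real k)\<^sup>2 \<le> (1 + real j + real k)\<^sup>2 * (1 + real j + real k)\<^sup>2"
      by (intro mult_mono power_mono) auto
    then show ?thesis by (simp flip: power_add)
  qed
  then have "1 / (1 + real j + real k) ^ 4 \<le> (1 / (1 + real j) ^ 2) * (1 / (1 + real k) ^ 2)" for j k
    by (simp add: frac_le)
  then show "(case x of (j, k) \<Rightarrow> 1 / (1 + real j + real k) ^ 4)
      \<le> (case x of (j, k) \<Rightarrow> (1 / (1 + real j) ^ 2) * (1 / (1 + real k) ^ 2))" for x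
    by (cases x) auto
qed auto

text \<open>Two additional powers of decay turn a supremum bound into a convergent sum, at the cost
  of the constant sum of 1 / (1 + |n|)^2.\<close>

lemma weight_summable:
  assumes "\<And>n. (1 + \<bar>real_of_int n\<bar>) ^ (m + 2) * cmod (c n) \<le> C"
  shows "(\<lambda>n. (1 + \<bar>real_of_int n\<bar>) ^ m * cmod (c n)) summable_on UNIV"
    and "weighted_sum m c \<le> C * (\<Sum>\<^sub>\<infinity>n::int. 1 / (1 + \<bar>real_of_int n\<bar>) ^ 2)"
proof -
  have b: "(1 + \<bar>real_of_int n\<bar>) ^ m * cmod (c n) \<le> C * (1 / (1 + \<bar>real_of_int n\<bar>) ^ 2)" for n
  proof -
    have "(1 + \<bar>real_of_int n\<bar>) ^ m * cmod (c n) * (1 + \<bar>real_of_int n\<bar>) ^ 2 \<le> C"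
      using assms[of n] by (simp add: power_add power2_eq_square mult_ac)
    then show ?thesis by (simp add: pos_le_divide_eq)
  qed
  have s: "(\<lambda>n. C * (1 / (1 + \<bar>real_of_int n\<bar>) ^ 2)) summable_on UNIV"
    by (intro summable_on_cmult_right summable_inverse_square_int)
  show 1: "(\<lambda>n. (1 + \<bar>real_of_int n\<bar>) ^ m * cmod (c n)) summable_on UNIV"
    by (rule summable_on_comparison_test[OF s b]) auto
  show "weighted_sum m c \<le> C * (\<Sum>\<^sub>\<infinity>n::int. 1 / (1 + \<bar>real_of_int n\<bar>) ^ 2)"
    unfolding weighted_sum_def infsum_cmult_right'[symmetric]
    by (rule infsum_mono[OF 1 s b])
qed

lemma rapidly_decreasing_summable:
  "rapidly_decreasing c \<Longrightarrow> (\<lambda>n. (1 + \<bar>real_of_int n\<bar>) ^ m * cmod (c n)) summable_on UNIV"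
  unfolding rapidly_decreasing_def using weight_summable(1) by metis

lemma rapidly_decreasing_add:
  assumes "rapidly_decreasing c" "rapidly_decreasing d"
  shows "rapidly_decreasing (\<lambda>n. c n + d n)"
  unfolding rapidly_decreasing_def
proof
  fix m
  obtain C D where C: "\<And>n. (1 + \<bar>real_of_int n\<bar>) ^ m * cmod (c n) \<le> C"
    and D: "\<And>n. (1 + \<bar>real_of_int n\<bar>) ^ m * cmod (d n) \<le> D"
    using assms unfolding rapidly_decreasing_def by metis
  have "(1 + \<bar>real_of_int n\<bar>) ^ m * cmod (c n + d n) \<le> C + D" for n
  proof -
    have "(1 + \<bar>real_of_int n\<bar>) ^ m * cmod (c n + d n) \<le> (1 + \<bar>real_of_int n\<bar>) ^ m * (cmod (c n) + cmod (d n))"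
      by (intro mult_left_mono norm_triangle_ineq) auto
    then show ?thesis using C[of n] D[of n] by (simp add: distrib_left)
  qed
  then show "\<exists>C. \<forall>n. (1 + \<bar>real_of_int n\<bar>) ^ m * cmod (c n + d n) \<le> C" by blast
qed

lemma rapidly_decreasing_scale:
  assumes "rapidly_decreasing c"
  shows "rapidly_decreasing (\<lambda>n. a * c n)"
  unfolding rapidly_decreasing_def
proof
  fix m
  obtain C where C: "\<And>n. (1 + \<bar>real_of_int n\<bar>) ^ m * cmod (c n) \<le> C"
    using assms unfolding rapidly_decreasing_def by metis
  have "(1 + \<bar>real_of_int n\<bar>) ^ m * cmod (a * c n) \<le> cmod a * C" for n
    using mult_left_mono[OF C[of n], of "cmod a"] by (simp add: norm_mult mult_ac)
  then show "\<exists>C. \<forall>n. (1 + \<bar>real_of_int n\<bar>) ^ m * cmod (a * c n) \<le> C" by blast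
qed

lemma weighted_sum_add:
  assumes "rapidly_decreasing c" "rapidly_decreasing d"
  shows "weighted_sum m (\<lambda>n. c n + d n) \<le> weighted_sum m c + weighted_sum m d"
  unfolding weighted_sum_def
proof (subst infsum_add[symmetric])
  show "(\<Sum>\<^sub>\<infinity>n. (1 + \<bar>real_of_int n\<bar>) ^ m * cmod (c n + d n))
    \<le> (\<Sum>\<^sub>\<infinity>n. (1 + \<bar>real_of_int n\<bar>) ^ m * cmod (c n) + (1 + \<bar>real_of_int n\<bar>) ^ m * cmod (d n))"
    using assms
    by (intro infsum_mono summable_on_add rapidly_decreasing_summable rapidly_decreasing_add)
       (auto simp flip: distrib_left intro!: mult_left_mono norm_triangle_ineq)
qed (use assms in \<open>auto intro: rapidly_decreasing_summable\<close>)

lemma weighted_sum_scale: "weighted_sum m (\<lambda>n. a * c n) = cmod a * weighted_sum m c"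
  unfolding weighted_sum_def norm_mult mult.left_commute[of _ "cmod a"] by (rule infsum_cmult_right')

lemma weighted_sum_nonneg: "0 \<le> weighted_sum m c"
  unfolding weighted_sum_def by (rule infsum_nonneg) auto

lemma weighted_sum_mono:
  assumes "rapidly_decreasing c" "m \<le> m'"
  shows "weighted_sum m c \<le> weighted_sum m' c"
  unfolding weighted_sum_def using assms
  by (intro infsum_mono rapidly_decreasing_summable mult_right_mono power_increasing) auto

lemma has_sum_single: "(\<And>x. x \<noteq> a \<Longrightarrow> f x = 0) \<Longrightarrow> a \<in> S \<Longrightarrow> (f has_sum f a) S"
  by (rule has_sum_finite_neutralI[where B = "{a}"]) auto


section \<open>Expansions\<close>

lemma coefficient_summable:
  fixes f :: "int \<Rightarrow> idx op"
  assumes "rapidly_decreasing c" "\<And>n. norm (f n) \<le> 1"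
  shows "(\<lambda>n. c n \<cdot>\<^sub>C f n) summable_on UNIV"
proof (rule abs_summable_summable, rule summable_on_comparison_test)
  show "(\<lambda>n. cmod (c n)) summable_on UNIV"
    using rapidly_decreasing_summable[OF assms(1), of 0] by simp
  show "norm (c n \<cdot>\<^sub>C f n) \<le> cmod (c n)" for n
    by (rule order_trans[OF norm_op_scale_le mult_left_le]) (auto intro: assms)
qed auto

lemma fourier_has_sum:
  "fourier_expansion c a \<longleftrightarrow> rapidly_decreasing c \<and> ((\<lambda>n. c n \<cdot>\<^sub>C z_shift n) has_sum a) UNIV"
proof (cases "rapidly_decreasing c")
  case True
  have "((\<lambda>n. c n \<cdot>\<^sub>C z_shift n) has_sum (\<Sum>\<^sub>\<infinity>n. c n \<cdot>\<^sub>C z_shift n)) UNIV"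
    by (rule has_sum_infsum[OF coefficient_summable[OF True norm_z_shift]])
  with True show ?thesis
    unfolding fourier_expansion_def z_pow_eq by (auto dest: infsumI)
qed (simp add: fourier_expansion_def)

lemma ent_z_shift: "ent (z_shift n) ([], m) ([], 0) = (if m = n then 1 else 0)"
  by (simp add: ent_def coord_z_shift coord_ket)

text \<open>The coefficients are visible in the column of e_0. They are therefore unique, which
  gives the THE in the seminorms of level 0 its value.\<close>

lemma fourier_coefficient:
  assumes "fourier_expansion c a"
  shows "c n = ent a ([], n) ([], 0)"
proof -
  have "((\<lambda>k. ent (c k \<cdot>\<^sub>C z_shift k) ([], n) ([], 0)) has_sum ent a ([], n) ([], 0)) UNIV"
    using assms unfolding fourier_has_sum by (intro has_sum_bounded_linear[OF bounded_linear_ent]) simp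
  moreover have "((\<lambda>k. ent (c k \<cdot>\<^sub>C z_shift k) ([], n) ([], 0)) has_sum c n * 1) UNIV"
    using has_sum_single[of n "\<lambda>k. ent (c k \<cdot>\<^sub>C z_shift k) ([], n) ([], 0)" UNIV] by (simp add: ent_z_shift)
  ultimately show ?thesis using has_sum_unique by fastforce
qed

definition toeplitz_sum :: "nat \<Rightarrow> (nat \<Rightarrow> nat \<Rightarrow> idx op) \<Rightarrow> (int \<Rightarrow> complex) \<Rightarrow> idx op"
  where "toeplitz_sum l b c = (\<Sum>\<^sub>\<infinity>(j, k). embed j k (b j k)) + (\<Sum>\<^sub>\<infinity>k. c (int k) \<cdot>\<^sub>C down_pow l k)
    + (\<Sum>\<^sub>\<infinity>k\<in>{0<..}. c (- int k) \<cdot>\<^sub>C up_pow l k)"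

definition level_op :: "nat \<Rightarrow> idx op \<Rightarrow> bool"
  where "level_op l b \<longleftrightarrow> complex_linear b \<and> level_proj l o\<^sub>L b = b \<and> b o\<^sub>L level_proj l = b"

lemma toeplitz_expansion_iff:
  assumes "\<And>a. a \<in> A \<Longrightarrow> level_op l a"
  shows "toeplitz_expansion l A nrm b c a \<longleftrightarrow> (\<forall>j k. b j k \<in> A) \<and>
    (\<forall>n m. (\<lambda>(j, k). (1 + real j + real k) ^ n * nrm m (b j k)) summable_on UNIV) \<and>
    rapidly_decreasing c \<and> a = toeplitz_sum l b c"
proof (cases "\<forall>j k. b j k \<in> A")
  case True
  then have "level_op l (b j k)" for j k using assms by blast
  then have "up_pow l j o\<^sub>L (p0 \<otimes>\<^sub>o b j k) o\<^sub>L down_pow l k = embed j k (b j k)" for j k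
    by (intro toeplitz_term_eq) (auto simp: level_op_def)
  then show ?thesis
    by (simp add: toeplitz_expansion_def toeplitz_sum_def unit_op_eq alpha_eq[unfolded unit_op_eq] adj_alpha_eq
        down_pow_def[symmetric] up_pow_def[symmetric] Let_def)
qed (auto simp: toeplitz_expansion_def)

text \<open>Both one-sided series are restrictions of a series over all integers, in which
  \<open>nat\<close> supplies harmless exponents on the other half.\<close>

lemma coefficient_summable_nat:
  assumes "rapidly_decreasing c"
  shows "(\<lambda>k. c (int k) \<cdot>\<^sub>C down_pow l k) summable_on UNIV"
    "(\<lambda>k. c (- int k) \<cdot>\<^sub>C up_pow l k) summable_on {0<..}"
proof -
  have "(\<lambda>n. c n \<cdot>\<^sub>C down_pow l (nat n)) summable_on UNIV" "(\<lambda>n. c n \<cdot>\<^sub>C up_pow l (nat (- n))) summable_on UNIV"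
    by (rule coefficient_summable[OF assms], rule norm_down_pow norm_up_pow)+
  then have "(\<lambda>n. c n \<cdot>\<^sub>C down_pow l (nat n)) summable_on range int"
    "(\<lambda>n. c n \<cdot>\<^sub>C up_pow l (nat (- n))) summable_on (\<lambda>n. - int n) ` {0<..}"
    by (auto intro: summable_on_subset_banach)
  then have "(\<lambda>n. c n \<cdot>\<^sub>C down_pow l (nat n)) \<circ> int summable_on UNIV"
    "(\<lambda>n. c n \<cdot>\<^sub>C up_pow l (nat (- n))) \<circ> (\<lambda>n. - int n) summable_on {0<..}"
    by (subst summable_on_reindex[symmetric]; simp add: inj_on_def)+
  then show "(\<lambda>k. c (int k) \<cdot>\<^sub>C down_pow l k) summable_on UNIV"
    "(\<lambda>k. c (- int k) \<cdot>\<^sub>C up_pow l k) summable_on {0<..}"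
    by (simp_all add: o_def)
qed

text \<open>The scalar series are constant along the diagonals of the block matrix, and exactly one
  of their terms meets a given block: the power k - j of the shift if j \<le> k, the power j - k of
  its adjoint otherwise. This identity later separates b from c.\<close>

lemma toeplitz_sum_slice:
  assumes b: "(\<lambda>(j, k). norm (b j k)) summable_on UNIV" and c: "rapidly_decreasing c"
  shows "slice j k (toeplitz_sum l b c) = b j k + c (int k - int j) \<cdot>\<^sub>C level_proj l"
proof -
  have "(\<lambda>(j, k). embed j k (b j k)) abs_summable_on UNIV"
    by (rule summable_on_comparison_test[OF b]) (auto simp: norm_embed)
  then have "(\<lambda>(j, k). embed j k (b j k)) summable_on UNIV" by (rule abs_summable_summable)
  then have "((\<lambda>(j, k). embed j k (b j k)) has_sum (\<Sum>\<^sub>\<infinity>(j, k). embed j k (b j k))) UNIV" by simp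
  from has_sum_bounded_linear[OF bounded_linear_slice this, of j k]
  have "((\<lambda>x. slice j k (case x of (j, k) \<Rightarrow> embed j k (b j k))) has_sum slice j k (\<Sum>\<^sub>\<infinity>(j, k). embed j k (b j k))) UNIV" .
  moreover have "((\<lambda>x. slice j k (case x of (j, k) \<Rightarrow> embed j k (b j k))) has_sum b j k) UNIV"
    using has_sum_single[of "(j, k)" "\<lambda>x. slice j k (case x of (j, k) \<Rightarrow> embed j k (b j k))" UNIV]
    by (auto simp: slice_embed split: prod.splits)
  ultimately have 1: "slice j k (\<Sum>\<^sub>\<infinity>(j, k). embed j k (b j k)) = b j k" by (rule has_sum_unique)
  have "((\<lambda>n. slice j k (c (int n) \<cdot>\<^sub>C down_pow l n)) has_sum slice j k (\<Sum>\<^sub>\<infinity>n. c (int n) \<cdot>\<^sub>C down_pow l n)) UNIV"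
    by (intro has_sum_bounded_linear[OF bounded_linear_slice] has_sum_infsum coefficient_summable_nat c)
  moreover have "((\<lambda>n. slice j k (c (int n) \<cdot>\<^sub>C down_pow l n)) has_sum (if j \<le> k then c (int k - int j) \<cdot>\<^sub>C level_proj l else 0)) UNIV"
  proof (cases "j \<le> k")
    case True
    then show ?thesis
      using has_sum_single[of "k - j" "\<lambda>n. slice j k (c (int n) \<cdot>\<^sub>C down_pow l n)" UNIV]
      by (fastforce simp: slice_scale slice_down_pow of_nat_diff)
  next
    case False
    then show ?thesis by (auto simp: slice_scale slice_down_pow intro!: has_sum_0)
  qed
  ultimately have 2: "slice j k (\<Sum>\<^sub>\<infinity>n. c (int n) \<cdot>\<^sub>C down_pow l n) = (if j \<le> k then c (int k - int j) \<cdot>\<^sub>C level_proj l else 0)"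
    by (rule has_sum_unique)
  have "((\<lambda>n. slice j k (c (- int n) \<cdot>\<^sub>C up_pow l n)) has_sum slice j k (\<Sum>\<^sub>\<infinity>n\<in>{0<..}. c (- int n) \<cdot>\<^sub>C up_pow l n)) {0<..}"
    by (intro has_sum_bounded_linear[OF bounded_linear_slice] has_sum_infsum coefficient_summable_nat c)
  moreover have "((\<lambda>n. slice j k (c (- int n) \<cdot>\<^sub>C up_pow l n)) has_sum (if j \<le> k then 0 else c (int k - int j) \<cdot>\<^sub>C level_proj l)) {0<..}"
  proof (cases "j \<le> k")
    case True
    then show ?thesis by (auto simp: slice_scale slice_up_pow intro!: has_sum_0)
  next
    case False
    then show ?thesis
      using has_sum_single[of "j - k" "\<lambda>n. slice j k (c (- int n) \<cdot>\<^sub>C up_pow l n)" "{0<..}"]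
      by (fastforce simp: slice_scale slice_up_pow of_nat_diff)
  qed
  ultimately have 3: "slice j k (\<Sum>\<^sub>\<infinity>n\<in>{0<..}. c (- int n) \<cdot>\<^sub>C up_pow l n) = (if j \<le> k then 0 else c (int k - int j) \<cdot>\<^sub>C level_proj l)"
    by (rule has_sum_unique)
  show ?thesis unfolding toeplitz_sum_def slice_linear(1) 1 2 3 by simp
qed

lemma closed_level_op: "closed {b. level_op l b}"
proof -
  have e: "continuous_on UNIV (\<lambda>x. level_proj l o\<^sub>L x)" "continuous_on UNIV (\<lambda>x. x o\<^sub>L level_proj l)"
    by (intro linear_continuous_on bounded_linear_compose_left bounded_linear_compose_right)+
  have "closed ({x. complex_linear x} \<inter> {x. level_proj l o\<^sub>L x = x} \<inter> {x. x o\<^sub>L level_proj l = x})"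
    by (intro closed_Int closed_complex_linear closed_Collect_eq e continuous_intros)
  moreover have "{b. level_op l b} = {x. complex_linear x} \<inter> {x. level_proj l o\<^sub>L x = x} \<inter> {x. x o\<^sub>L level_proj l = x}"
    by (auto simp: level_op_def)
  ultimately show ?thesis by (simp only:)
qed

lemma level_op_simps:
  "level_op l 0" "level_op l (level_proj l)" "level_op (Suc l) (down_pow l n)" "level_op (Suc l) (up_pow l n)"
  "level_op l x \<Longrightarrow> level_op l y \<Longrightarrow> level_op l (x + y)"
  "level_op l x \<Longrightarrow> level_op l y \<Longrightarrow> level_op l (x - y)"
  "level_op l x \<Longrightarrow> level_op l (c \<cdot>\<^sub>C x)"
  "level_op l x \<Longrightarrow> level_op (Suc l) (embed j k x)"
  "level_op (Suc l) x \<Longrightarrow> level_op l (slice j k x)"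
  by (auto simp: level_op_def compose_distrib level_proj_rules down_pow_level_proj up_pow_level_proj embed_level_proj slice_level_proj
      op_scale_compose_left op_scale_compose_right)

lemma level_op_has_sum:
  assumes "(f has_sum a) S" "\<And>k. k \<in> S \<Longrightarrow> level_op l (f k)"
  shows "level_op l a"
proof (rule sum_in_closed[OF closed_level_op assms(1)])
  fix T assume "finite T" "T \<subseteq> S"
  then show "level_op l (sum f T)"
    using assms(2) by (induction T rule: finite_induct) (auto intro: level_op_simps)
qed

lemma level_op_infsum:
  assumes "f summable_on S" "\<And>k. k \<in> S \<Longrightarrow> level_op l (f k)"
  shows "level_op l (infsum f S)"
  using level_op_has_sum[OF has_sum_infsum[OF assms(1)]] assms(2) by blast

lemma embed_summable:
  assumes "(\<lambda>(j, k). norm (b j k)) summable_on UNIV"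
  shows "(\<lambda>(j, k). embed j k (b j k)) summable_on UNIV"
  by (rule abs_summable_summable, rule summable_on_comparison_test[OF assms]) (auto simp: norm_embed)

lemma level_op_toeplitz_sum:
  assumes "(\<lambda>(j, k). norm (b j k)) summable_on UNIV" "rapidly_decreasing c" "\<And>j k. level_op l (b j k)"
  shows "level_op (Suc l) (toeplitz_sum l b c)"
  unfolding toeplitz_sum_def
  by (intro level_op_simps(5) level_op_infsum embed_summable coefficient_summable_nat assms)
     (auto intro: level_op_simps assms)

lemma toeplitz_sum_eqI:
  assumes "(\<lambda>(j, k). norm (b j k)) summable_on UNIV" "rapidly_decreasing c" "\<And>j k. level_op l (b j k)"
    and "level_op (Suc l) x" "\<And>j k. slice j k x = b j k + c (int k - int j) \<cdot>\<^sub>C level_proj l"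
  shows "x = toeplitz_sum l b c"
  using assms(4) level_op_toeplitz_sum[OF assms(1-3)] unfolding level_op_def
  by (intro slice_eqI[of x l]) (simp_all add: toeplitz_sum_slice assms)


section \<open>Commutator bounds for the building blocks\<close>

text \<open>A commutator with a truncated number operator keeps h and multiplies the weight by a
  difference of two truncations. The Lipschitz property bounds that difference by \<omega> for every
  truncation, and m commutators give \<omega>^m.\<close>

lemma ideal_bound_weighted_comp:
  assumes "weighted_comp_ok w h" "\<And>J. cmod (w J) \<le> B" "1 \<le> \<omega>"
    and "\<And>i J. w J \<noteq> 0 \<Longrightarrow> \<bar>real_of_int (leg i J) - real_of_int (leg i (h J))\<bar> \<le> \<omega>"
  shows "ideal_bound 0 m (\<omega> ^ m * B) (weighted_comp w h)"
  using assms
proof (induction m arbitrary: w B)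
  case 0
  then show ?case by (simp add: norm_weighted_comp)
next
  case (Suc m)
  have B0: "0 \<le> B" using Suc.prems(2) norm_ge_zero order_trans by blast
  have "norm (weighted_comp w h) \<le> 1 * B" using norm_weighted_comp[OF Suc.prems(1,2)] by simp
  also have "\<dots> \<le> \<omega> ^ Suc m * B"
    using Suc.prems(3) B0 by (intro mult_right_mono one_le_power) auto
  finally have n: "norm (weighted_comp w h) \<le> \<omega> ^ Suc m * B" .
  have "ideal_bound 0 m (\<omega> ^ Suc m * B) (commutator (num_op i M) (weighted_comp w h))" for i M
  proof -
    define w' where "w' J = of_real (clip M (leg i J) - clip M (leg i (h J))) * w J" for J
    have w'B: "cmod (w' J) \<le> \<omega> * B" for J
    proof (cases "w J = 0")
      case False
      have "\<bar>clip M (leg i J) - clip M (leg i (h J))\<bar> \<le> \<omega>"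
        using clip_diff Suc.prems(4)[OF False] order_trans by blast
      then show ?thesis
        using Suc.prems(2)[of J] Suc.prems(3) by (auto simp: w'_def norm_mult simp flip: of_real_diff intro!: mult_mono)
    qed (use B0 Suc.prems(3) in \<open>auto simp: w'_def\<close>)
    have ok: "weighted_comp_ok w' h"
      using Suc.prems(1) w'B unfolding weighted_comp_ok_def
      by (auto simp: bounded_iff w'_def intro: inj_on_subset)
    have "commutator (num_op i M) (weighted_comp w h) = weighted_comp w' h"
      by (rule blinfun_eqI, rule coord_eqI)
         (simp add: commutator_def blinfun.diff_left coord_basic coord_weighted_comp[OF ok] coord_weighted_comp[OF Suc.prems(1)] w'_def algebra_simps)
    moreover have "ideal_bound 0 m (\<omega> ^ m * (\<omega> * B)) (weighted_comp w' h)"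
      by (rule Suc.IH[OF ok w'B Suc.prems(3)]) (use Suc.prems(4) in \<open>auto simp: w'_def\<close>)
    ultimately show ?thesis by (simp add: mult_ac)
  qed
  with n show ?case by (simp add: ideal_bound_Suc)
qed

lemma coord_down_pow: "coord (down_pow l n x) J =
    (if length (fst J) = Suc l then coord x ((hd (fst J) + n) # tl (fst J), snd J) else 0)"
proof (induction n arbitrary: J)
  case 0
  show ?case by (cases J, cases "fst J") (auto simp: down_pow_0 coord_basic)
next
  case (Suc n)
  show ?case by (cases J, cases "fst J") (auto simp: down_pow_Suc coord_basic Suc)
qed

lemma ideal_bound_down_pow: "ideal_bound 0 m ((1 + real n) ^ m) (down_pow l n)"
proof -
  let ?w = "\<lambda>J::idx. if length (fst J) = Suc l then 1 else 0 :: complex"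
  let ?h = "\<lambda>J::idx. ((hd (fst J) + n) # tl (fst J), snd J)"
  have ok: "weighted_comp_ok ?w ?h"
    by (rule weighted_comp_okI[where B = 1]) (auto split: if_splits simp: length_Suc_conv intro: prod_eqI)
  have "down_pow l n = weighted_comp ?w ?h"
    by (rule blinfun_eqI, rule coord_eqI) (simp add: coord_down_pow coord_weighted_comp[OF ok])
  moreover have "ideal_bound 0 m ((1 + real n) ^ m * 1) (weighted_comp ?w ?h)"
    by (rule ideal_bound_weighted_comp[OF ok]) (auto simp: leg_def length_Suc_conv nth_Cons split: if_splits nat.splits)
  ultimately show ?thesis by simp
qed

lemma ideal_bound_z_shift: "ideal_bound 0 m ((1 + \<bar>real_of_int n\<bar>) ^ m) (z_shift n)"
  using ideal_bound_weighted_comp[OF weighted_comp_ok_z_shift, of 1 "1 + \<bar>real_of_int n\<bar>" n m]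
  by (auto simp: z_shift_def leg_def split: if_splits)

text \<open>At level 0 no leg carries a weight, so the bound of order m on the commutator with the
  number operator is part of the bound of order m + 1 on the shift itself; hence the exponent
  \<open>Suc m\<close>.\<close>

lemma smooth_bound_z_shift: "smooth_bound 0 m ((1 + \<bar>real_of_int n\<bar>) ^ Suc m) (z_shift n)"
proof (rule smooth_bound_I)
  have S: "ideal_bound 0 (Suc m) ((1 + \<bar>real_of_int n\<bar>) ^ Suc m) (z_shift n)" by (rule ideal_bound_z_shift)
  then show "ideal_bound 0 m ((1 + \<bar>real_of_int n\<bar>) ^ Suc m) (z_shift n)" by (rule ideal_bound_le) simp
  show "ideal_bound 0 m ((1 + \<bar>real_of_int n\<bar>) ^ Suc m) (commutator (num_op 0 M) (z_shift n))" for M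
    using S by (simp add: ideal_bound_Suc)
  show "commutator z_up (z_shift n) = 0" "commutator z_down (z_shift n) = 0"
    by (rule blinfun_eqI, rule coord_eqI, simp add: commutator_def blinfun.diff_left coord_basic coord_z_shift algebra_simps)+
  show "level_proj 0 o\<^sub>L z_shift n = z_shift n" "z_shift n o\<^sub>L level_proj 0 = z_shift n"
    by (simp_all add: z_shift_mult flip: z_shift_0)
qed auto

section \<open>Commutators of blocks and bounds for single terms of an expansion\<close>

lemma commutator_embed:
  "commutator (num_op 0 M) (embed j k b) = (clip M (int j) - clip M (int k)) *\<^sub>R embed j k b"
  "commutator (num_op (Suc i) M) (embed j k b) = embed j k (commutator (num_op i M) b)"
  "commutator (raise_op (Suc r)) (embed j k b) = embed j k (commutator (raise_op r) b)"
  "commutator (lower_op (Suc r)) (embed j k b) = embed j k (commutator (lower_op r) b)"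
  "commutator z_up (embed j k b) = embed j k (commutator z_up b)"
  "commutator z_down (embed j k b) = embed j k (commutator z_down b)"
  "commutator (raise_op 0) (embed j k b) = embed (Suc j) k b - (if k = 0 then 0 else embed j (k - 1) b)"
  "commutator (lower_op 0) (embed j k b) = (if j = 0 then 0 else embed (j - 1) k b) - embed j (Suc k) b"
  "left_mult (num_op 0 M) (embed j k b) = clip M (int j) *\<^sub>R embed j k b"
  "left_mult (num_op (Suc i) M) (embed j k b) = embed j k (left_mult (num_op i M) b)"
proof -
  have l: "g o\<^sub>L embed j k b = (g o\<^sub>L ins_op j) o\<^sub>L b o\<^sub>L del_op k" and r: "embed j k b o\<^sub>L g = ins_op j o\<^sub>L b o\<^sub>L (del_op k o\<^sub>L g)" for g
    by (simp_all add: embed_def compose_assoc)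
  show "commutator (num_op 0 M) (embed j k b) = (clip M (int j) - clip M (int k)) *\<^sub>R embed j k b"
    "commutator (num_op (Suc i) M) (embed j k b) = embed j k (commutator (num_op i M) b)"
    "commutator (raise_op (Suc r)) (embed j k b) = embed j k (commutator (raise_op r) b)"
    "commutator (lower_op (Suc r)) (embed j k b) = embed j k (commutator (lower_op r) b)"
    "commutator z_up (embed j k b) = embed j k (commutator z_up b)"
    "commutator z_down (embed j k b) = embed j k (commutator z_down b)"
    "left_mult (num_op 0 M) (embed j k b) = clip M (int j) *\<^sub>R embed j k b"
    "left_mult (num_op (Suc i) M) (embed j k b) = embed j k (left_mult (num_op i M) b)"
    unfolding commutator_def left_mult_def l r
    by (simp_all add: slice_rules embed_def compose_distrib compose_assoc scaleR_diff_left)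
  show "commutator (raise_op 0) (embed j k b) = embed (Suc j) k b - (if k = 0 then 0 else embed j (k - 1) b)"
    unfolding commutator_def l r by (cases k) (simp_all add: slice_rules embed_def compose_distrib)
  show "commutator (lower_op 0) (embed j k b) = (if j = 0 then 0 else embed (j - 1) k b) - embed j (Suc k) b"
    unfolding commutator_def l r by (cases j) (simp_all add: slice_rules embed_def compose_distrib)
qed

text \<open>The last identity turns an estimate for the commutator with \<open>raise_op 0\<close>
  into control of the difference of neighbouring blocks on a diagonal, the source of the limits
  below.\<close>

lemma commutator_slice:
  "slice j k (commutator (num_op 0 M) x) = (clip M (int j) - clip M (int k)) *\<^sub>R slice j k x"
  "slice j k (left_mult (num_op 0 M) x) = clip M (int j) *\<^sub>R slice j k x"
  "commutator (num_op i M) (slice j k x) = slice j k (commutator (num_op (Suc i) M) x)"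
  "left_mult (num_op i M) (slice j k x) = slice j k (left_mult (num_op (Suc i) M) x)"
  "commutator (raise_op r) (slice j k x) = slice j k (commutator (raise_op (Suc r)) x)"
  "commutator (lower_op r) (slice j k x) = slice j k (commutator (lower_op (Suc r)) x)"
  "commutator z_up (slice j k x) = slice j k (commutator z_up x)"
  "commutator z_down (slice j k x) = slice j k (commutator z_down x)"
  "slice (Suc j) k (commutator (raise_op 0) x) = slice j k x - slice (Suc j) (Suc k) x"
proof -
  have l: "slice j k (g o\<^sub>L x) = (del_op j o\<^sub>L g) o\<^sub>L x o\<^sub>L ins_op k" and r: "slice j k (x o\<^sub>L g) = del_op j o\<^sub>L x o\<^sub>L (g o\<^sub>L ins_op k)" for g j k
    by (simp_all add: slice_def compose_assoc)
  have l': "g o\<^sub>L slice j k x = (g o\<^sub>L del_op j) o\<^sub>L x o\<^sub>L ins_op k" and r': "slice j k x o\<^sub>L g = del_op j o\<^sub>L x o\<^sub>L (ins_op k o\<^sub>L g)" for g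
    by (simp_all add: slice_def compose_assoc)
  show "slice j k (commutator (num_op 0 M) x) = (clip M (int j) - clip M (int k)) *\<^sub>R slice j k x"
    "slice j k (left_mult (num_op 0 M) x) = clip M (int j) *\<^sub>R slice j k x"
    "commutator (num_op i M) (slice j k x) = slice j k (commutator (num_op (Suc i) M) x)"
    "left_mult (num_op i M) (slice j k x) = slice j k (left_mult (num_op (Suc i) M) x)"
    "commutator (raise_op r) (slice j k x) = slice j k (commutator (raise_op (Suc r)) x)"
    "commutator (lower_op r) (slice j k x) = slice j k (commutator (lower_op (Suc r)) x)"
    "commutator z_up (slice j k x) = slice j k (commutator z_up x)"
    "commutator z_down (slice j k x) = slice j k (commutator z_down x)"
    "slice (Suc j) k (commutator (raise_op 0) x) = slice j k x - slice (Suc j) (Suc k) x"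
    unfolding commutator_def left_mult_def slice_linear(2) l r l' r'
    by (simp_all add: slice_rules compose_distrib scaleR_diff_left slice_def compose_assoc)
qed

text \<open>Letters of leg 0 act on E_jk \<otimes> b as the truncations of j or as their difference
  for j and k, scalars of modulus at most 1 + j + k; all other letters act on b. A block thus lies
  in an ideal with one more weighted leg.\<close>

lemma ideal_bound_embed:
  assumes "ideal_bound r m C b"
  shows "ideal_bound (Suc r) m ((1 + real j + real k) ^ m * C) (embed j k b)"
  unfolding ideal_bound_def
proof (rule iter_bound_transfer[where L = "num_commutators \<union> num_left_mults r" and \<psi> = "embed j k"])
  fix \<phi> assume "\<phi> \<in> num_commutators \<union> num_left_mults (Suc r)"
  then consider i M where "\<phi> = commutator (num_op i M)" | i M where "i < Suc r" "\<phi> = left_mult (num_op i M)"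
    by (auto simp: num_commutators_def num_left_mults_def)
  then show "(\<exists>\<phi>'\<in>num_commutators \<union> num_left_mults r. \<forall>x. \<phi> (embed j k x) = embed j k (\<phi>' x)) \<or>
      (\<exists>c. cmod c \<le> 1 + real j + real k \<and> (\<forall>x. \<phi> (embed j k x) = c \<cdot>\<^sub>C embed j k x))"
  proof cases
    case 1
    show ?thesis
    proof (cases i)
      case 0
      have "\<bar>clip M (int j) - clip M (int k)\<bar> \<le> 1 + real j + real k"
        using clip_diff[of M "int j" "int k"] by simp
      then show ?thesis unfolding 1 0
        by (intro disjI2 exI[of _ "of_real (clip M (int j) - clip M (int k))"])
           (simp only: norm_of_real op_scale_of_real commutator_embed, simp)
    next
      case (Suc i')
      have "commutator (num_op i' M) \<in> num_commutators \<union> num_left_mults r" by (auto simp: num_commutators_def)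
      then show ?thesis unfolding 1 Suc using commutator_embed(2) by blast
    qed
  next
    case 2
    show ?thesis
    proof (cases i)
      case 0
      have "\<bar>clip M (int j)\<bar> \<le> 1 + real j + real k" by (auto simp: clip_def)
      then show ?thesis unfolding 2 0
        by (intro disjI2 exI[of _ "of_real (clip M (int j))"])
           (simp only: norm_of_real op_scale_of_real commutator_embed, simp)
    next
      case (Suc i')
      have "left_mult (num_op i' M) \<in> num_commutators \<union> num_left_mults r" using 2 Suc by (auto simp: num_left_mults_def)
      then show ?thesis unfolding 2 Suc using commutator_embed(10) by blast
    qed
  qed
qed (use assms in \<open>auto simp: ideal_bound_def norm_embed intro: op_linear_letters\<close>)

lemma ideal_bound_slice:
  assumes "ideal_bound (Suc r) m C x"
  shows "ideal_bound r m C (slice j k x)"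
proof -
  have "iter_bound (num_commutators \<union> num_left_mults r) m (1 ^ m * C) (slice j k x)"
  proof (rule iter_bound_transfer[where L = "num_commutators \<union> num_left_mults (Suc r)" and \<psi> = "slice j k"])
    fix \<phi> assume "\<phi> \<in> num_commutators \<union> num_left_mults r"
    then consider i M where "\<phi> = commutator (num_op i M)" | i M where "i < r" "\<phi> = left_mult (num_op i M)"
      by (auto simp: num_commutators_def num_left_mults_def)
    then have "\<exists>\<phi>'\<in>num_commutators \<union> num_left_mults (Suc r). \<forall>x. \<phi> (slice j k x) = slice j k (\<phi>' x)"
    proof cases
      case 1
      have "commutator (num_op (Suc i) M) \<in> num_commutators \<union> num_left_mults (Suc r)" by (auto simp: num_commutators_def)
      then show ?thesis unfolding 1 using commutator_slice(3) by blast
    next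
      case 2
      then have "left_mult (num_op (Suc i) M) \<in> num_commutators \<union> num_left_mults (Suc r)" by (auto simp: num_left_mults_def)
      then show ?thesis unfolding 2 using commutator_slice(4) by blast
    qed
    then show "(\<exists>\<phi>'\<in>num_commutators \<union> num_left_mults (Suc r). \<forall>x. \<phi> (slice j k x) = slice j k (\<phi>' x)) \<or>
      (\<exists>c. cmod c \<le> 1 \<and> (\<forall>x. \<phi> (slice j k x) = c \<cdot>\<^sub>C slice j k x))" ..
  qed (use assms in \<open>auto simp: ideal_bound_def norm_slice intro: op_linear_letters\<close>)
  then show ?thesis by (simp add: ideal_bound_def)
qed

lemma smooth_bound_down_pow: "smooth_bound (Suc l) m ((1 + real n) ^ m) (down_pow l n)"
proof (rule smooth_bound_I)
  have z: "commutator (lower_op 0) (down_pow l n) = 0" "commutator (raise_op (Suc r)) (down_pow l n) = 0" "commutator (lower_op (Suc r)) (down_pow l n) = 0"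
     "commutator z_up (down_pow l n) = 0" "commutator z_down (down_pow l n) = 0" "commutator (num_op (Suc l) M) (down_pow l n) = 0" for r M
    by (rule blinfun_eqI, rule coord_eqI,
        (auto simp: commutator_def blinfun.diff_left coord_basic coord_down_pow leg_def length_Suc_conv)[1])+
  show "commutator z_up (down_pow l n) = 0" "commutator z_down (down_pow l n) = 0"
    "ideal_bound (Suc l) m ((1 + real n) ^ m) (commutator (num_op (Suc l) M) (down_pow l n))" for M
    by (simp_all add: z ideal_bound_zero)
  show "ideal_bound (Suc r) m ((1 + real n) ^ m) (commutator (lower_op r) (down_pow l n))" for r
    by (cases r) (simp_all add: z ideal_bound_zero)
  show "ideal_bound (Suc r) m ((1 + real n) ^ m) (commutator (raise_op r) (down_pow l n))" for r
  proof (cases r)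
    case 0
    show ?thesis
    proof (cases n)
      case 0
      then show ?thesis using \<open>r = 0\<close> by (simp add: down_pow_0 commutator_level_proj ideal_bound_zero)
    next
      case (Suc k)
      \<comment> \<open>On the first leg the adjoint shift times the shift is 1 - p0. Only the
        defect p0 times a power of the shift remains, a matrix unit that decays in leg 0; all other
        outer commutators vanish by z.\<close>
      have e: "commutator (raise_op 0) (down_pow l (Suc k)) = - embed 0 k (level_proj l)"
      proof (rule blinfun_eqI, rule coord_eqI)
        fix v :: "idx ell2" and J :: idx
        show "coord (commutator (raise_op 0) (down_pow l (Suc k)) v) J = coord ((- embed 0 k (level_proj l)) v) J"
          by (cases J, cases "fst J")
             (auto simp: commutator_def embed_def blinfun.diff_left blinfun.minus_left coord_basic coord_down_pow)
      qed
      have "ideal_bound 1 m ((1 + real 0 + real k) ^ m * 1) (embed 0 k (level_proj l))"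
        using ideal_bound_embed[OF ideal_bound_level_proj, of m 0 k l] by simp
      then have "ideal_bound 1 m ((1 + real n) ^ m) (embed 0 k (level_proj l))"
        by (rule ideal_bound_mono) (use Suc in \<open>auto intro!: power_mono\<close>)
      then show ?thesis using \<open>r = 0\<close> Suc e by (simp add: ideal_bound_minus)
    qed
  qed (simp add: z ideal_bound_zero)
qed (use ideal_bound_down_pow in \<open>auto simp: down_pow_level_proj\<close>)

lemma slice_adj: "complex_linear x \<Longrightarrow> slice j k (adj x) = adj (slice k j x)"
  by (simp add: slice_def adj_compose compose_assoc)

text \<open>Both sides have the unit of level l along one diagonal of blocks and zero elsewhere. The
  bounds for \<open>down_pow\<close> carry over to \<open>up_pow\<close> in this way.\<close>

lemma up_pow_eq_adj: "up_pow l n = adj (down_pow l n)"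
proof -
  have "level_op (Suc l) (adj (down_pow l n))"
    using smooth_bound_adj[OF smooth_bound_down_pow[of l 0 n]] by (auto simp: level_op_def dest: smooth_bound_D)
  moreover have "slice j k (up_pow l n) = slice j k (adj (down_pow l n))" for j k
    by (simp add: slice_adj slice_up_pow slice_down_pow)
  ultimately show ?thesis
    using slice_eqI[of "up_pow l n" l "adj (down_pow l n)"] level_op_simps(4)[of l n] by (simp add: level_op_def)
qed

lemma smooth_bound_up_pow: "smooth_bound (Suc l) m (2 ^ m * (1 + real n) ^ m) (up_pow l n)"
  unfolding up_pow_eq_adj by (rule smooth_bound_adj[OF smooth_bound_down_pow])

lemma smooth_bound_embed:
  assumes b: "smooth_bound l m C b"
  shows "smooth_bound (Suc l) m (2 ^ Suc m * (1 + real j + real k) ^ m * C) (embed j k b)"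
proof (rule smooth_bound_I)
  note b' = smooth_bound_D[OF b]
  have C: "0 \<le> C" using b by (rule smooth_bound_nonneg)
  let ?D = "2 ^ Suc m * (1 + real j + real k) ^ m * C"
  \<comment> \<open>Shifts on leg 0 lead to blocks with j' + k' \<le> j + k + 1, and 2 + j + k \<le>
    2 (1 + j + k) costs 2^m. One half of ?D is aimed at because such a commutator is a difference of
    two blocks.\<close>
  have pw: "(1 + real j' + real k') ^ m * C \<le> ?D / 2" if "j' + k' \<le> Suc (j + k)" for j' k'
  proof -
    have "real j' + real k' \<le> 1 + real j + real k" using that by linarith
    then have "(1 + real j' + real k') ^ m \<le> (2 * (1 + real j + real k)) ^ m" by (intro power_mono) auto
    then have "(1 + real j' + real k') ^ m * C \<le> 2 ^ m * (1 + real j + real k) ^ m * C"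
      unfolding power_mult_distrib by (rule mult_right_mono[OF _ C])
    then show ?thesis by simp
  qed
  have D: "ideal_bound r' m (?D / 2) x \<Longrightarrow> ideal_bound r' m ?D x" for r' x
    by (rule ideal_bound_mono) (use C in auto)
  have e: "ideal_bound (Suc r') m (?D / 2) (embed j' k' x)" if "ideal_bound r' m C x" "j' + k' \<le> Suc (j + k)" for r' x j' k'
    by (rule ideal_bound_mono[OF ideal_bound_embed[OF that(1)] pw[OF that(2)]])
  have e2: "ideal_bound (Suc r') m ?D (embed j' k' x)" if "ideal_bound r' m C x" "j' + k' \<le> Suc (j + k)" for r' x j' k'
    by (rule D[OF e[OF that]])
  have e0: "ideal_bound (Suc 0) m (?D / 2) 0" using C by (intro ideal_bound_zero) auto
  show "complex_linear (embed j k b)" using b' by auto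
  show "level_proj (Suc l) o\<^sub>L embed j k b = embed j k b" "embed j k b o\<^sub>L level_proj (Suc l) = embed j k b"
    using b' by (auto simp: embed_level_proj)
  show "commutator z_up (embed j k b) = 0" "commutator z_down (embed j k b) = 0"
    using b' by (simp_all add: commutator_embed linear_simps(3)[OF bounded_linear_embed])
  show "ideal_bound 0 m ?D (embed j k b)" using e2[OF b'(6), of j k] by (rule ideal_bound_less[where r = 1, simplified]) auto
  show "ideal_bound (Suc r) m ?D (commutator (raise_op r) (embed j k b))" if "r < Suc l" for r
  proof (cases r)
    case 0
    have "ideal_bound (Suc 0) m (?D / 2) (if k = 0 then 0 else embed j (k - 1) b)"
      using e0 e[OF b'(6), of j "k - 1"] by (cases "k = 0") simp_all
    from ideal_bound_diff[OF e[OF b'(6), of "Suc j" k] this]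
    have "ideal_bound (Suc 0) m (?D / 2 + ?D / 2) (commutator (raise_op 0) (embed j k b))"
      unfolding commutator_embed by simp
    then show ?thesis by (simp only: 0 field_sum_of_halves)
  next
    case (Suc r')
    show ?thesis unfolding Suc commutator_embed by (intro e2 b'(7)) (use Suc that in auto)
  qed
  show "ideal_bound (Suc r) m ?D (commutator (lower_op r) (embed j k b))" if "r < Suc l" for r
  proof (cases r)
    case 0
    have "ideal_bound (Suc 0) m (?D / 2) (if j = 0 then 0 else embed (j - 1) k b)"
      using e0 e[OF b'(6), of "j - 1" k] by (cases "j = 0") simp_all
    from ideal_bound_diff[OF this e[OF b'(6), of j "Suc k"]]
    have "ideal_bound (Suc 0) m (?D / 2 + ?D / 2) (commutator (lower_op 0) (embed j k b))"
      unfolding commutator_embed by simp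
    then show ?thesis by (simp only: 0 field_sum_of_halves)
  next
    case (Suc r')
    show ?thesis unfolding Suc commutator_embed by (intro e2 b'(8)) (use Suc that in auto)
  qed
  show "ideal_bound (Suc l) m ?D (commutator (num_op (Suc l) M) (embed j k b))" for M
    unfolding commutator_embed by (intro e2 b'(9)) auto
qed


section \<open>Asymptotics of the matrix entries\<close>

text \<open>The weight 1 + j + k equals 1 + 2 j - (j - k), so it is produced on the block by y + 2 N
  y - [N, y] with N the number operator of leg 0; these terms give the factor 1 + 2 + 1 = 4 for
  every power.\<close>

lemma ideal_bound_slice_weight:
  "ideal_bound (Suc r) (p + m) C y \<Longrightarrow> ideal_bound r m (4 ^ p * C) ((1 + real j + real k) ^ p *\<^sub>R slice j k y)"
proof (induction p arbitrary: y C)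
  case 0
  then show ?case by (simp add: ideal_bound_slice)
next
  case (Suc p)
  \<comment> \<open>Truncation at j + k is exact on both indices of the block.\<close>
  define g where "g = num_op 0 (j + k)"
  define y' where "y' = y + 2 *\<^sub>R left_mult g y - commutator g y"
  have y: "ideal_bound (Suc r) (p + m) C y" using Suc.prems by (rule ideal_bound_le) simp
  have L: "ideal_bound (Suc r) (p + m) C (left_mult g y)" and K: "ideal_bound (Suc r) (p + m) C (commutator g y)"
    using Suc.prems by (simp_all add: ideal_bound_Suc g_def)
  have "ideal_bound (Suc r) (p + m) (C + \<bar>2\<bar> * C + C) y'"
    unfolding y'_def by (intro ideal_bound_add ideal_bound_diff ideal_bound_scaleR y L K)
  then have "ideal_bound (Suc r) (p + m) (4 * C) y'" by simp
  from Suc.IH[OF this] have IH: "ideal_bound r m (4 ^ p * (4 * C)) ((1 + real j + real k) ^ p *\<^sub>R slice j k y')" .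
  have "slice j k y' = slice j k y + (2 * real j) *\<^sub>R slice j k y - (real j - real k) *\<^sub>R slice j k y"
    by (simp add: y'_def g_def slice_linear commutator_slice clip_eq)
  also have "\<dots> = (1 + real j + real k) *\<^sub>R slice j k y"
  proof -
    have "1 + real j + real k = 1 + 2 * real j - (real j - real k)" by simp
    then show ?thesis by (simp only: scaleR_add_left scaleR_diff_left scaleR_one)
  qed
  finally show ?case using IH by (simp add: mult_ac)
qed

lemma ideal_bound_slice_decay:
  assumes "ideal_bound (Suc r) (p + m) C y"
  shows "ideal_bound r m (4 ^ p * C / (1 + real j + real k) ^ p) (slice j k y)"
proof -
  have "ideal_bound r m (\<bar>1 / (1 + real j + real k) ^ p\<bar> * (4 ^ p * C))
     ((1 / (1 + real j + real k) ^ p) *\<^sub>R (1 + real j + real k) ^ p *\<^sub>R slice j k y)"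
    by (rule ideal_bound_scaleR[OF ideal_bound_slice_weight[OF assms]])
  moreover have "1 + real j + real k \<noteq> 0" by linarith
  ultimately show ?thesis by simp
qed

section \<open>Decay of matrix entries, and operators that act as scalars\<close>

lemma ent_commutator_num_op:
  assumes "complex_linear x"
  shows "ent (commutator (num_op i M) x) J K = of_real (clip M (leg i J) - clip M (leg i K)) * ent x J K"
proof -
  have "num_op i M (ket K) = cscale (of_real (clip M (leg i K))) (ket K)"
    by (rule coord_eqI) (auto simp: coord_basic coord_ket)
  then show ?thesis
    by (simp add: commutator_def ent_def blinfun.diff_left coord_basic complex_linearD[OF assms] algebra_simps)
qed

text \<open>A commutator with a number operator multiplies the entry by the difference d of the two
  legs, up to sign. Writing (1 + d)^(m+1) as (1 + d)^m plus (1 + d)^m d adds two bounds of order m,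
  hence the power of 2.\<close>

lemma ent_weight:
  "complex_linear x \<Longrightarrow> ideal_bound 0 m C x \<Longrightarrow>
    (1 + \<bar>real_of_int (leg i J - leg i K)\<bar>) ^ m * cmod (ent x J K) \<le> 2 ^ m * C"
proof (induction m arbitrary: x)
  case 0
  then show ?case using norm_ent_le[of x J K] by simp
next
  case (Suc m)
  define d where "d = \<bar>real_of_int (leg i J - leg i K)\<bar>"
  define M where "M = nat \<bar>leg i J\<bar> + nat \<bar>leg i K\<bar>"
  have c: "clip M (leg i J) = real_of_int (leg i J)" "clip M (leg i K) = real_of_int (leg i K)"
    by (rule clip_eq; simp add: M_def)+
  have e: "cmod (ent (commutator (num_op i M) x) J K) = d * cmod (ent x J K)"
    unfolding ent_commutator_num_op[OF Suc.prems(1)] norm_mult norm_of_real c d_def by simp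
  have "ideal_bound 0 m C (commutator (num_op i M) x)" using Suc.prems by (simp add: ideal_bound_Suc)
  from Suc.IH[OF complex_linear_commutator[OF complex_linear_basic(1) Suc.prems(1)] this]
  have 1: "(1 + d) ^ m * (d * cmod (ent x J K)) \<le> 2 ^ m * C" unfolding e d_def[symmetric] .
  have 2: "(1 + d) ^ m * cmod (ent x J K) \<le> 2 ^ m * C"
    using Suc.IH[OF Suc.prems(1) ideal_bound_le[OF Suc.prems(2)]] unfolding d_def by simp
  have "(1 + d) ^ Suc m * cmod (ent x J K) = (1 + d) ^ m * cmod (ent x J K) + (1 + d) ^ m * (d * cmod (ent x J K))"
    by (simp add: algebra_simps)
  also have "\<dots> \<le> 2 ^ m * C + 2 ^ m * C" by (rule add_mono[OF 2 1])
  finally show ?case unfolding d_def by (simp add: mult_ac)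
qed

definition base_idx :: "nat \<Rightarrow> idx"
  where "base_idx l = (replicate l 0, 0)"

lemma leg_base_idx: "leg i (base_idx l) = 0"
  by (simp add: base_idx_def leg_def)

text \<open>The basis vector at \<open>base_idx l\<close> is killed by all lowering operators and by
  the number operator of the last leg, hence so is its image under X; within the level only its
  multiples have this property.\<close>

lemma scalar_vector:
  assumes X: "level_op l X" and lower_op: "\<And>r. r < l \<Longrightarrow> commutator (lower_op r) X = 0" and Gz: "\<And>M. commutator (num_op l M) X = 0"
  shows "X (ket (base_idx l)) = cscale (ent X (base_idx l) (base_idx l)) (ket (base_idx l))"
proof -
  define v where "v = X (ket (base_idx l))"
  have "coord v J = 0" if J: "J \<noteq> base_idx l" for J
  proof (cases "length (fst J) = l")
    case False
    then show ?thesis using X ent_level_proj(1)[of l X J "base_idx l"] by (simp add: level_op_def ent_def v_def)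
  next
    case len: True
    show ?thesis
    proof (cases "\<exists>r<l. 0 < fst J ! r")
      case True
      then obtain r where r: "r < l" "0 < fst J ! r" by blast
      have "lower_op r (ket (base_idx l)) = 0"
      proof (rule coord_eqI)
        fix K :: idx
        have "(fst K)[r := Suc (fst K ! r)] \<noteq> replicate l 0" if "r < length (fst K)"
          using that r(1) by (metis nat.distinct(1) nth_list_update_eq nth_replicate)
        then show "coord (lower_op r (ket (base_idx l))) K = coord 0 K"
          by (auto simp: coord_basic coord_ket base_idx_def)
      qed
      then have "(X o\<^sub>L lower_op r) (ket (base_idx l)) = 0" by (simp add: blinfun.zero_right)
      then have "lower_op r v = 0"
        using lower_op[OF r(1)] by (simp add: commutator_def v_def) (metis blinfun_apply_blinfun_compose)
      then have "coord (lower_op r v) ((fst J)[r := fst J ! r - 1], snd J) = 0" by simp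
      then show ?thesis using r len by (simp add: coord_basic)
    next
      case False
      then have "fst J = replicate l 0" using len by (auto intro: nth_equalityI)
      then have nz: "snd J \<noteq> 0" using J by (auto simp: base_idx_def prod_eq_iff)
      \<comment> \<open>Truncation at 1 is enough, as \<open>clip 1\<close> vanishes only at
        0.\<close>
      have "num_op l 1 (ket (base_idx l)) = 0"
        by (rule coord_eqI) (auto simp: coord_basic coord_ket leg_base_idx clip_def)
      then have "(X o\<^sub>L num_op l 1) (ket (base_idx l)) = 0" by (simp add: blinfun.zero_right)
      then have "num_op l 1 v = 0"
        using Gz[of 1] by (simp add: commutator_def v_def) (metis blinfun_apply_blinfun_compose)
      then have "coord (num_op l 1 v) J = 0" by simp
      moreover have "clip 1 (leg l J) \<noteq> 0"
        using nz len by (auto simp: leg_def clip_def max_def min_def)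
      ultimately show ?thesis by (simp add: coord_basic)
    qed
  qed
  then show ?thesis by (intro coord_eqI) (auto simp: coord_ket ent_def v_def)
qed

lemma commutator_0_apply: "commutator g X = 0 \<Longrightarrow> X (g v) = g (X v)"
  unfolding commutator_def by (metis blinfun_apply_blinfun_compose right_minus_eq)

text \<open>The scalar action spreads from \<open>base_idx l\<close> to every basis vector of the
  level along the raising operators and the two shifts of the integer leg, all of which commute with
  X.\<close>

lemma scalar_op:
  assumes X: "level_op l X" and lower_op: "\<And>r. r < l \<Longrightarrow> commutator (lower_op r) X = 0" and Gz: "\<And>M. commutator (num_op l M) X = 0"
    and raise_op: "\<And>r. r < l \<Longrightarrow> commutator (raise_op r) X = 0" and Z: "commutator z_up X = 0" "commutator z_down X = 0"
  shows "X = ent X (base_idx l) (base_idx l) \<cdot>\<^sub>C level_proj l"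
proof -
  define c where "c = ent X (base_idx l) (base_idx l)"
  have cl: "complex_linear X" using X by (simp add: level_op_def)
  have a: "X (ket (ns, 0)) = cscale c (ket (ns, 0))" if "length ns = l" for ns
    using that
  proof (induction "sum_list ns" arbitrary: ns rule: less_induct)
    case less
    show ?case
    proof (cases "\<exists>r<l. 0 < ns ! r")
      case False
      then have "ns = replicate l 0" using less.prems by (auto intro: nth_equalityI)
      then show ?thesis using scalar_vector[OF X lower_op Gz] by (simp add: base_idx_def c_def)
    next
      case True
      then obtain r where r: "r < l" "0 < ns ! r" by blast
      define ns' where "ns' = ns[r := ns ! r - Suc 0]"
      have l': "length ns' = l" using less.prems by (simp add: ns'_def)
      have "sum_list ns' < sum_list ns"
        unfolding ns'_def using r less.prems
        by (subst sum_list_update) (auto simp: member_le_sum_list elem_le_sum_list Suc_le_eq less_le_trans)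
      from less.hyps[OF this l'] have IH: "X (ket (ns', 0)) = cscale c (ket (ns', 0))" .
      have u: "ket (ns, 0) = raise_op r (ket (ns', 0))"
      proof (rule coord_eqI)
        fix K :: idx
        have "(r < length (fst K) \<and> 0 < fst K ! r \<and> (fst K)[r := fst K ! r - Suc 0] = ns') \<longleftrightarrow> fst K = ns"
          using r less.prems list_update_pred_inj[of r "fst K" ns]
          by (auto simp: ns'_def dest: arg_cong[of _ _ length])
        then show "coord (ket (ns, 0)) K = coord (raise_op r (ket (ns', 0))) K"
          by (auto simp: coord_ket coord_basic prod_eq_iff)
      qed
      have "X (ket (ns, 0)) = raise_op r (X (ket (ns', 0)))"
        unfolding u by (rule commutator_0_apply[OF raise_op[OF r(1)]])
      also have "\<dots> = cscale c (ket (ns, 0))"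
        unfolding IH u by (rule complex_linearD) simp
      finally show ?thesis .
    qed
  qed
  have b: "X (ket (ns, z)) = cscale c (ket (ns, z))" if "length ns = l" for ns z
  proof (induction z rule: int_induct[where k = 0])
    case base
    show ?case by (rule a[OF that])
  next
    case (step1 i)
    have u: "ket (ns, i + 1) = z_up (ket (ns, i))" by (rule coord_eqI) (auto simp: coord_ket coord_basic)
    show ?case unfolding u commutator_0_apply[OF Z(1)] step1 by (rule complex_linearD) simp
  next
    case (step2 i)
    have u: "ket (ns, i - 1) = z_down (ket (ns, i))" by (rule coord_eqI) (auto simp: coord_ket coord_basic)
    show ?case unfolding u commutator_0_apply[OF Z(2)] step2 by (rule complex_linearD) simp
  qed
  show ?thesis
  proof (rule op_ket_eqI[OF cl])
    fix J :: idx
    show "X (ket J) = (ent X (base_idx l) (base_idx l) \<cdot>\<^sub>C level_proj l) (ket J)"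
    proof (cases "length (fst J) = l")
      case True
      then show ?thesis using b[of "fst J" "snd J"] by (simp add: level_proj_ket c_def)
    next
      case False
      have "X (ket J) = (X o\<^sub>L level_proj l) (ket J)" using X by (simp add: level_op_def)
      then show ?thesis using False by (simp add: level_proj_ket blinfun.zero_right)
    qed
  qed auto
qed

text \<open>The coefficient \<lambda>_n read off as a limit along the diagonal k - j = n, started at
  its block on the border. One entry is enough since the limits of the blocks turn out to be
  scalars.\<close>

definition symbol_coeff :: "nat \<Rightarrow> idx op \<Rightarrow> int \<Rightarrow> complex"
  where "symbol_coeff l x n = lim (\<lambda>t. ent (slice (t + nat (- n)) (t + nat n) x) (base_idx l) (base_idx l))"

lemma symbol_coeff_eqI:
  assumes "(\<lambda>t. ent (slice (j + t) (k + t) x) (base_idx l) (base_idx l)) \<longlonglongrightarrow> c"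
  shows "symbol_coeff l x (int k - int j) = c"
proof -
  \<comment> \<open>The block (j, k) lies s steps down its diagonal, and dropping s terms does not
    change the limit.\<close>
  define s where "s = min j k"
  have e: "(\<lambda>t. ent (slice (j + t) (k + t) x) (base_idx l) (base_idx l)) =
     (\<lambda>t. (\<lambda>t. ent (slice (t + nat (- (int k - int j))) (t + nat (int k - int j)) x) (base_idx l) (base_idx l)) (t + s))"
    by (rule ext) (auto simp: s_def min_def nat_diff_distrib' add_ac intro!: arg_cong2[where f = "\<lambda>a b. ent (slice a b x) (base_idx l) (base_idx l)"])
  show ?thesis
    unfolding symbol_coeff_def by (rule limI, rule LIMSEQ_offset[where k = s]) (use assms e in simp)
qed

definition inverse_square_sum :: real
  where "inverse_square_sum = (\<Sum>\<^sub>\<infinity>t::nat. 1 / (1 + real t) ^ 2)"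

lemma inverse_square_sum_nonneg: "0 \<le> inverse_square_sum"
  unfolding inverse_square_sum_def by (rule infsum_nonneg) auto

text \<open>The order q + 2 + m is spent in three portions: q powers become decay in j + k, two
  powers make the differences along a diagonal summable, and m is the order left for the
  conclusion.\<close>

lemma slice_limit:
  assumes x: "smooth_bound (Suc l) (q + 2 + m) C x"
  shows "(\<lambda>t. slice (j + t) (k + t) x) \<longlonglongrightarrow> symbol_coeff l x (int k - int j) \<cdot>\<^sub>C level_proj l" (is ?lim)
    and "smooth_bound l m (4 ^ (q + 2) * (1 + inverse_square_sum) * C / (1 + real j + real k) ^ q)
      (slice j k x - symbol_coeff l x (int k - int j) \<cdot>\<^sub>C level_proj l)" (is ?smooth_bound)
proof -
  note x' = smooth_bound_D[OF x]
  have C: "0 \<le> C" using x by (rule smooth_bound_nonneg)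
  note W0 = inverse_square_sum_nonneg
  define P where "P = 1 + real j + real k"
  have P: "P \<ge> 1" "P > 0" by (simp_all add: P_def)
  define d where "d t = slice (Suc (j + t)) (k + t) (commutator (raise_op 0) x)" for t
  \<comment> \<open>The q + 2 powers fall on P + 1 + 2 t: of these, q are estimated from below by P
    and two by 1 + t.\<close>
  define \<beta> where "\<beta> t = 4 ^ (q + 2) * C / P ^ q * (1 / (1 + real t) ^ 2)" for t :: nat
  have dsl: "d t = slice (j + t) (k + t) x - slice (Suc (j + t)) (Suc (k + t)) x" for t
    by (simp add: d_def commutator_slice)
  have dII: "ideal_bound 0 m (\<beta> t) (d t)" for t
  proof -
    have "ideal_bound 1 (q + 2 + m) C (commutator (raise_op 0) x)" using x'(7)[of 0] by simp
    then have "ideal_bound 0 m (4 ^ (q + 2) * C / (1 + real (Suc (j + t)) + real (k + t)) ^ (q + 2)) (d t)"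
      unfolding d_def by (intro ideal_bound_slice_decay) simp
    then show ?thesis
    proof (rule ideal_bound_mono)
      have "P ^ q * (1 + real t) ^ 2 \<le> (1 + real (Suc (j + t)) + real (k + t)) ^ q * (1 + real (Suc (j + t)) + real (k + t)) ^ 2"
        by (intro mult_mono power_mono) (auto simp: P_def)
      then have "P ^ q * (1 + real t) ^ 2 \<le> (1 + real (Suc (j + t)) + real (k + t)) ^ (q + 2)"
        by (subst power_add)
      then have "4 ^ (q + 2) * C / (1 + real (Suc (j + t)) + real (k + t)) ^ (q + 2) \<le> 4 ^ (q + 2) * C / (P ^ q * (1 + real t) ^ 2)"
        using C P by (intro divide_left_mono mult_pos_pos) auto
      then show "4 ^ (q + 2) * C / (1 + real (Suc (j + t)) + real (k + t)) ^ (q + 2) \<le> \<beta> t"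
        by (simp add: \<beta>_def)
    qed
  qed
  have \<beta>: "(\<beta> has_sum 4 ^ (q + 2) * C / P ^ q * inverse_square_sum) UNIV"
    unfolding \<beta>_def[abs_def] inverse_square_sum_def by (intro has_sum_cmult_right has_sum_infsum summable_inverse_square_nat)
  have "d abs_summable_on UNIV"
    by (rule summable_on_comparison_test[OF has_sum_imp_summable[OF \<beta>]]) (use ideal_bound_norm[OF dII] in auto)
  then have "d summable_on UNIV" by (rule abs_summable_summable)
  then obtain s where s: "(d has_sum s) UNIV" by (auto simp: summable_on_def)
  have sII: "ideal_bound 0 m (4 ^ (q + 2) * C / P ^ q * inverse_square_sum) s"
    by (rule ideal_bound_has_sum[OF s \<beta> dII])
  have tele: "(\<Sum>t<n. d t) = slice j k x - slice (j + n) (k + n) x" for n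
    by (induction n) (auto simp: dsl)
  define \<Lambda> where "\<Lambda> = slice j k x - s"
  have "(\<lambda>n. \<Sum>t<n. d t) \<longlonglongrightarrow> s"
    using has_sum_imp_sums[OF s] by (simp add: sums_def)
  then have "(\<lambda>n. slice j k x - (\<Sum>t<n. d t)) \<longlonglongrightarrow> \<Lambda>"
    unfolding \<Lambda>_def by (intro tendsto_intros)
  then have lim: "(\<lambda>n. slice (j + n) (k + n) x) \<longlonglongrightarrow> \<Lambda>" by (simp add: tele)
  have lx: "level_op (Suc l) x" using x' by (simp add: level_op_def)
  have \<Lambda>l: "level_op l \<Lambda>"
    using Lim_in_closed_set[OF closed_level_op, of "\<lambda>n. slice (j + n) (k + n) x" l sequentially \<Lambda>] lim
      level_op_simps(9)[OF lx] by simp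
  \<comment> \<open>The commutator of g with the diagonal limit is the limit of the blocks of y, and
    a single weight on leg 0 makes these O(1/n).\<close>
  have zero: "commutator g \<Lambda> = 0"
    if g: "complex_linear g" "\<And>n. commutator g (slice (j + n) (k + n) x) = slice (j + n) (k + n) y" "ideal_bound 1 (Suc 0) C y" for g y
  proof -
    have "(\<lambda>n. commutator g (slice (j + n) (k + n) x)) \<longlonglongrightarrow> commutator g \<Lambda>"
      using bounded_linear.tendsto[OF op_linear_bounded_linear[OF op_linear_commutator[OF g(1)]] lim] .
    then have 1: "(\<lambda>n. slice (j + n) (k + n) y) \<longlonglongrightarrow> commutator g \<Lambda>" by (simp add: g(2))
    have b: "norm (slice (j + n) (k + n) y) \<le> 4 * C * inverse (real (Suc n))" for n
    proof -
      have "ideal_bound 0 0 (4 ^ 1 * C / (1 + real (j + n) + real (k + n)) ^ 1) (slice (j + n) (k + n) y)"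
        by (rule ideal_bound_slice_decay) (use g(3) in simp)
      then have "norm (slice (j + n) (k + n) y) \<le> 4 * C / (1 + real (j + n) + real (k + n))"
        by (simp only: ideal_bound_0 power_one_right)
      also have "\<dots> \<le> 4 * C / real (Suc n)" using C by (intro divide_left_mono) auto
      finally show ?thesis by (simp only: divide_inverse)
    qed
    have "(\<lambda>n. 4 * C * inverse (real (Suc n))) \<longlonglongrightarrow> 0"
      by (rule tendsto_mult_right_zero[OF LIMSEQ_inverse_real_of_nat])
    from Lim_null_comparison[OF always_eventually[OF allI[OF b]] this]
    have "(\<lambda>n. slice (j + n) (k + n) y) \<longlonglongrightarrow> 0" .
    from LIMSEQ_unique[OF 1 this] show ?thesis .
  qed
  have low: "ideal_bound 1 (Suc 0) C y" if "ideal_bound (Suc r) (q + 2 + m) C y" for r y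
    by (rule ideal_bound_less[OF ideal_bound_le[OF that]]) auto
  have \<Lambda>s: "\<Lambda> = ent \<Lambda> (base_idx l) (base_idx l) \<cdot>\<^sub>C level_proj l"
  proof (rule scalar_op[OF \<Lambda>l])
    show "commutator (lower_op r) \<Lambda> = 0" if "r < l" for r
      by (rule zero[OF _ commutator_slice(6)]) (use x'(8)[of "Suc r"] that low in auto)
    show "commutator (raise_op r) \<Lambda> = 0" if "r < l" for r
      by (rule zero[OF _ commutator_slice(5)]) (use x'(7)[of "Suc r"] that low in auto)
    show "commutator (num_op l M) \<Lambda> = 0" for M
      by (rule zero[OF _ commutator_slice(3)]) (use x'(9) low in auto)
    show "commutator z_up \<Lambda> = 0" "commutator z_down \<Lambda> = 0"
      by (rule zero[OF _ commutator_slice(7)], use x' C in \<open>auto simp: ideal_bound_zero\<close>)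
         (rule zero[OF _ commutator_slice(8)], use x' C in \<open>auto simp: ideal_bound_zero\<close>)
  qed
  have "(\<lambda>n. ent (slice (j + n) (k + n) x) (base_idx l) (base_idx l)) \<longlonglongrightarrow> ent \<Lambda> (base_idx l) (base_idx l)"
    by (rule bounded_linear.tendsto[OF bounded_linear_ent lim])
  then have sy: "symbol_coeff l x (int k - int j) = ent \<Lambda> (base_idx l) (base_idx l)" by (rule symbol_coeff_eqI)
  show ?lim using lim \<Lambda>s sy by simp
  have bs: "slice j k x - symbol_coeff l x (int k - int j) \<cdot>\<^sub>C level_proj l = s"
    unfolding sy \<Lambda>s[symmetric] by (simp add: \<Lambda>_def)
  \<comment> \<open>This constant has to dominate two bounds: the one for s, which is obtained by
    summing differences, and the one for its commutators, which comes from a single block. Hence 1 +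
    \<open>inverse_square_sum\<close>.\<close>
  let ?B = "4 ^ (q + 2) * (1 + inverse_square_sum) * C / P ^ q"
  have B1: "4 ^ (q + 2) * C / P ^ q * inverse_square_sum \<le> ?B"
  proof -
    have "4 ^ (q + 2) * C * inverse_square_sum \<le> 4 ^ (q + 2) * (1 + inverse_square_sum) * C"
      using C by (simp add: distrib_left distrib_right mult_ac)
    then have "4 ^ (q + 2) * C * inverse_square_sum / P ^ q \<le> ?B" using P by (intro divide_right_mono) auto
    then show ?thesis by simp
  qed
  have "4 ^ q * C \<le> 4 ^ (q + 2) * (1 + inverse_square_sum) * C"
  proof (rule mult_right_mono[OF _ C])
    have "4 ^ q * 1 \<le> 4 ^ (q + 2) * (1 + inverse_square_sum)"
      using W0 by (intro mult_mono power_increasing) auto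
    then show "4 ^ q \<le> 4 ^ (q + 2) * (1 + inverse_square_sum)" by simp
  qed
  then have B2: "4 ^ q * C / P ^ q \<le> ?B" using P by (intro divide_right_mono) auto
  have dec: "ideal_bound r m ?B (slice j k y)" if "ideal_bound (Suc r) (q + 2 + m) C y" for r y
  proof -
    have "ideal_bound (Suc r) (q + m) C y" using that by (rule ideal_bound_le) simp
    from ideal_bound_slice_decay[OF this, of j k] show ?thesis
      by (rule ideal_bound_mono) (use B2 in \<open>simp add: P_def\<close>)
  qed
  have ls: "level_op l s"
    unfolding bs[symmetric] by (intro level_op_simps lx)
  \<comment> \<open>The diagonal limit is a scalar and commutes with g, so the commutators of s are
    those of the block itself and decay without any summation.\<close>
  have Cs: "commutator g s = commutator g (slice j k x)" if "complex_linear g" "commutator g (level_proj l) = 0" for g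
    unfolding bs[symmetric] using that by (simp add: commutator_diff commutator_scale)
  have "smooth_bound l m ?B s"
  proof (rule smooth_bound_I)
    show "ideal_bound 0 m ?B s" using sII B1 by (rule ideal_bound_mono)
    show "commutator z_up s = 0" "commutator z_down s = 0"
      using x' by (simp_all add: Cs commutator_level_proj commutator_slice slice_linear)
    have e: "commutator (raise_op r) s = slice j k (commutator (raise_op (Suc r)) x)" "commutator (lower_op r) s = slice j k (commutator (lower_op (Suc r)) x)"
       "commutator (num_op l M) s = slice j k (commutator (num_op (Suc l) M) x)" for r M
      by (simp_all add: Cs commutator_level_proj commutator_slice)
    show "ideal_bound (Suc r) m ?B (commutator (raise_op r) s)" "ideal_bound (Suc r) m ?B (commutator (lower_op r) s)" if "r < l" for r
      unfolding e by (intro dec x'(7,8); use that in simp)+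
    show "ideal_bound l m ?B (commutator (num_op l M) s)" for M
      unfolding e by (intro dec x'(9))
  qed (use ls in \<open>auto simp: level_op_def\<close>)
  then show ?smooth_bound by (simp add: bs P_def)
qed

text \<open>\<open>ent_weight\<close> bounds the entries uniformly along the diagonal, on which the
  difference of the first legs is constant, and the bound passes to the limit; the two further
  orders guarantee that the limit exists.\<close>

lemma symbol_coeff_weight:
  assumes "smooth_bound (Suc l) (p + 2) C x"
  shows "(1 + \<bar>real_of_int n\<bar>) ^ p * cmod (symbol_coeff l x n) \<le> 2 ^ p * C"
proof -
  define j k where "j = nat (- n)" and "k = nat n"
  have n: "int k - int j = n" by (auto simp: j_def k_def)
  have "smooth_bound (Suc l) (p + 2 + 0) C x" using assms by simp
  from slice_limit(1)[OF this, of j k]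
  have "(\<lambda>t. ent (slice (j + t) (k + t) x) (base_idx l) (base_idx l)) \<longlonglongrightarrow> ent (symbol_coeff l x n \<cdot>\<^sub>C level_proj l) (base_idx l) (base_idx l)"
    unfolding n by (rule bounded_linear.tendsto[OF bounded_linear_ent])
  moreover have "ent (level_proj l) (base_idx l) (base_idx l) = 1" by (simp add: ent_def level_proj_ket coord_ket base_idx_def)
  ultimately have "(\<lambda>t. (1 + \<bar>real_of_int n\<bar>) ^ p * cmod (ent (slice (j + t) (k + t) x) (base_idx l) (base_idx l)))
     \<longlonglongrightarrow> (1 + \<bar>real_of_int n\<bar>) ^ p * cmod (symbol_coeff l x n)"
    by (intro tendsto_intros) simp
  then show ?thesis
  proof (rule LIMSEQ_le_const2, intro exI allI impI)
    fix t
    have x: "complex_linear x" "ideal_bound 0 p C x" using smooth_bound_D(1,6)[OF assms] by (auto intro: ideal_bound_le)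
    have "\<bar>real_of_int (leg 0 ((j + t) # fst (base_idx l), snd (base_idx l)) - leg 0 ((k + t) # fst (base_idx l), snd (base_idx l)))\<bar> = \<bar>real_of_int n\<bar>"
      by (simp add: leg_def flip: n)
    then show "(1 + \<bar>real_of_int n\<bar>) ^ p * cmod (ent (slice (j + t) (k + t) x) (base_idx l) (base_idx l)) \<le> 2 ^ p * C"
      using ent_weight[OF x, of 0 "((j + t) # fst (base_idx l), snd (base_idx l))" "((k + t) # fst (base_idx l), snd (base_idx l))"]
      by (simp add: ent_slice)
  qed
qed


section \<open>The smooth algebras are the operators with bounded iterated commutators\<close>

text \<open>The statement proved by induction on the level. Its last three assumptions say that
  seminorms and commutator bounds describe the same algebra with the same topology; K has to be
  chosen before the element.\<close>

locale smooth_level =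
  fixes l :: nat and A :: "idx op set" and nrm :: "nat \<Rightarrow> idx op \<Rightarrow> real"
  assumes nrm_nonneg: "a \<in> A \<Longrightarrow> 0 \<le> nrm m a"
    and nrm_mono: "a \<in> A \<Longrightarrow> m \<le> m' \<Longrightarrow> nrm m a \<le> nrm m' a"
    and nrm_add: "a \<in> A \<Longrightarrow> b \<in> A \<Longrightarrow> nrm m (a + b) \<le> nrm m a + nrm m b"
    and nrm_scale: "a \<in> A \<Longrightarrow> nrm m (c \<cdot>\<^sub>C a) = cmod c * nrm m a"
    and smooth_bound_of_nrm: "\<exists>m K. 0 \<le> K \<and> (\<forall>a\<in>A. smooth_bound l M (K * nrm m a) a)"
    and mem_of_smooth_bound: "(\<And>M. \<exists>C. smooth_bound l M C a) \<Longrightarrow> a \<in> A"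
    and nrm_of_smooth_bound: "\<exists>M K. 0 \<le> K \<and> (\<forall>a\<in>A. \<forall>C. smooth_bound l M C a \<longrightarrow> nrm m a \<le> K * C)"
begin

lemma mem_iff: "a \<in> A \<longleftrightarrow> (\<forall>M. \<exists>C. smooth_bound l M C a)"
proof
  show "\<forall>M. \<exists>C. smooth_bound l M C a" if a: "a \<in> A"
  proof
    fix M show "\<exists>C. smooth_bound l M C a" using smooth_bound_of_nrm[of M] a by blast
  qed
qed (auto intro: mem_of_smooth_bound)

lemma level: "a \<in> A \<Longrightarrow> level_op l a"
  unfolding mem_iff level_op_def using smooth_bound_D(1-3) by blast

lemma zero_mem: "0 \<in> A"
  unfolding mem_iff using smooth_bound_zero[of 0] by blast

lemma add_mem: "a \<in> A \<Longrightarrow> b \<in> A \<Longrightarrow> a + b \<in> A"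
  unfolding mem_iff using smooth_bound_add by blast

lemma scale_mem: "a \<in> A \<Longrightarrow> c \<cdot>\<^sub>C a \<in> A"
  unfolding mem_iff using smooth_bound_scale by blast

lemma level_proj_mem: "level_proj l \<in> A"
  unfolding mem_iff using smooth_bound_level_proj by blast

lemma norm_le_nrm: "\<exists>m K. 0 \<le> K \<and> (\<forall>a\<in>A. norm a \<le> K * nrm m a)"
  using smooth_bound_of_nrm[of 0] smooth_bound_norm by blast

end

text \<open>An operator of level 0 that commutes with both shifts is determined by its column at
  e_0, since the shifts reach every other basis vector from there.\<close>

lemma fourier_unique:
  assumes x: "level_op 0 x" "commutator z_up x = 0" "commutator z_down x = 0"
    and y: "level_op 0 y" "commutator z_up y = 0" "commutator z_down y = 0"
    and eq: "\<And>n. ent x ([], n) ([], 0) = ent y ([], n) ([], 0)"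
  shows "x = y"
proof -
  have 0: "x (ket ([], 0)) = y (ket ([], 0))"
  proof (rule coord_eqI)
    fix J :: idx
    show "coord (x (ket ([], 0))) J = coord (y (ket ([], 0))) J"
    proof (cases "fst J = []")
      case True
      then have "J = ([], snd J)" by (simp add: prod_eq_iff)
      then show ?thesis using eq[of "snd J"] by (simp add: ent_def)
    next
      case False
      then show ?thesis using ent_level_proj(1)[of 0 x J "([], 0)"] ent_level_proj(1)[of 0 y J "([], 0)"] x(1) y(1)
        by (simp add: ent_def level_op_def)
    qed
  qed
  have 1: "x (ket ([], z)) = y (ket ([], z))" for z
  proof (induction z rule: int_induct[where k = 0])
    case (step1 i)
    have u: "ket ([], i + 1) = z_up (ket ([], i))" by (rule coord_eqI) (auto simp: coord_ket coord_basic)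
    show ?case unfolding u commutator_0_apply[OF x(2)] commutator_0_apply[OF y(2)] step1 ..
  next
    case (step2 i)
    have u: "ket ([], i - 1) = z_down (ket ([], i))" by (rule coord_eqI) (auto simp: coord_ket coord_basic)
    show ?case unfolding u commutator_0_apply[OF x(3)] commutator_0_apply[OF y(3)] step2 ..
  qed (rule 0)
  show ?thesis
  proof (rule op_ket_eqI)
    fix J :: idx
    show "x (ket J) = y (ket J)"
    proof (cases "fst J = []")
      case True
      then have "J = ([], snd J)" by (simp add: prod_eq_iff)
      then show ?thesis using 1 by metis
    next
      case False
      have "(x o\<^sub>L level_proj 0) (ket J) = (y o\<^sub>L level_proj 0) (ket J)" using False by (simp add: level_proj_ket blinfun.zero_right)
      then show ?thesis using x(1) y(1) by (simp only: level_op_def)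
    qed
  qed (use x y in \<open>auto simp: level_op_def\<close>)
qed

lemma smooth_norm_0: "fourier_expansion c a \<Longrightarrow> smooth_norm 0 m a = weighted_sum m c"
proof -
  assume c: "fourier_expansion c a"
  have "d = c" if d: "fourier_expansion d a" for d
    by (rule ext) (simp only: fourier_coefficient[OF c] fourier_coefficient[OF d])
  then have "(THE r. \<exists>c. fourier_expansion c a \<and> r = weighted_sum m c) = weighted_sum m c"
    using c by (intro the_equality) blast+
  then show ?thesis by (simp add: smooth_norm_def)
qed

lemma smooth_algebra_0: "a \<in> smooth_algebra 0 \<longleftrightarrow> (\<exists>c. fourier_expansion c a)"
  by (simp add: smooth_algebra_def)

lemma fourier_smooth_bound:
  assumes "fourier_expansion c a"
  shows "smooth_bound 0 M (weighted_sum (Suc M) c) a"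
proof (rule smooth_bound_has_sum)
  show "((\<lambda>n. c n \<cdot>\<^sub>C z_shift n) has_sum a) UNIV" "((\<lambda>n. (1 + \<bar>real_of_int n\<bar>) ^ Suc M * cmod (c n)) has_sum weighted_sum (Suc M) c) UNIV"
    using assms has_sum_infsum[OF rapidly_decreasing_summable[of c "Suc M"]]
    unfolding fourier_has_sum weighted_sum_def by auto
  show "smooth_bound 0 M ((1 + \<bar>real_of_int k\<bar>) ^ Suc M * cmod (c k)) (c k \<cdot>\<^sub>C z_shift k)" for k
    using smooth_bound_scale[OF smooth_bound_z_shift, of M "c k" k] by (simp only: mult.commute)
qed

lemma fourier_weight:
  assumes "smooth_bound 0 m C a"
  shows "(1 + \<bar>real_of_int n\<bar>) ^ m * cmod (ent a ([], n) ([], 0)) \<le> 2 ^ m * C"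
  using ent_weight[OF smooth_bound_D(1,6)[OF assms], of 0 "([], n)" "([], 0)"] by (simp add: leg_def)

lemma fourier_of_smooth_bound:
  assumes "\<And>M. \<exists>C. smooth_bound 0 M C a"
  shows "fourier_expansion (\<lambda>n. ent a ([], n) ([], 0)) a"
proof -
  define c where "c n = ent a ([], n) ([], 0)" for n
  have rd: "rapidly_decreasing c"
    unfolding rapidly_decreasing_def c_def
  proof
    fix m
    obtain C where C: "smooth_bound 0 m C a" using assms by blast
    show "\<exists>C. \<forall>n. (1 + \<bar>real_of_int n\<bar>) ^ m * cmod (ent a ([], n) ([], 0)) \<le> C"
      by (rule exI, rule allI, rule fourier_weight[OF C])
  qed
  define s where "s = (\<Sum>\<^sub>\<infinity>n. c n \<cdot>\<^sub>C z_pow n)"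
  have s: "fourier_expansion c s" using rd by (simp add: fourier_expansion_def s_def)
  obtain C where C: "smooth_bound 0 0 C a" using assms by blast
  have "a = s"
  proof (rule fourier_unique)
    show "level_op 0 a" "level_op 0 s"
      using smooth_bound_D(1-3)[OF C] smooth_bound_D(1-3)[OF fourier_smooth_bound[OF s, of 0]] by (simp_all add: level_op_def)
    show "ent a ([], n) ([], 0) = ent s ([], n) ([], 0)" for n
      using fourier_coefficient[OF s, of n] by (simp only: c_def)
  qed (fact smooth_bound_D(4,5)[OF C] smooth_bound_D(4,5)[OF fourier_smooth_bound[OF s, of 0]])+
  then show ?thesis using s by (simp add: c_def[abs_def])
qed

lemma fourier_expansion_add:
  "fourier_expansion c a \<Longrightarrow> fourier_expansion d b \<Longrightarrow> fourier_expansion (\<lambda>n. c n + d n) (a + b)"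
  unfolding fourier_has_sum op_scale_distrib 
  by (intro conjI; elim conjE) (rule rapidly_decreasing_add, assumption+, rule has_sum_add, assumption+)

lemma fourier_expansion_scale:
  "fourier_expansion c a \<Longrightarrow> fourier_expansion (\<lambda>n. k * c n) (k \<cdot>\<^sub>C a)"
  unfolding fourier_has_sum
  using has_sum_bounded_linear[OF bounded_linear_op_scale[of k], where f = "\<lambda>n. c n \<cdot>\<^sub>C z_shift n"]
  by (simp add: rapidly_decreasing_scale)

lemma smooth_level_0: "smooth_level 0 (smooth_algebra 0) (smooth_norm 0)"
proof
  fix a b and m m' :: nat and k
  assume a: "a \<in> smooth_algebra 0"
  then obtain c where c: "fourier_expansion c a" by (auto simp: smooth_algebra_0)
  show "0 \<le> smooth_norm 0 m a" by (simp add: smooth_norm_0[OF c] weighted_sum_nonneg)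
  show "smooth_norm 0 m a \<le> smooth_norm 0 m' a" if "m \<le> m'"
    using c that unfolding smooth_norm_0[OF c] fourier_expansion_def by (blast intro: weighted_sum_mono)
  show "smooth_norm 0 m (k \<cdot>\<^sub>C a) = cmod k * smooth_norm 0 m a"
    by (simp add: smooth_norm_0[OF c] smooth_norm_0[OF fourier_expansion_scale[OF c]] weighted_sum_scale)
  assume "b \<in> smooth_algebra 0"
  then obtain d where d: "fourier_expansion d b" by (auto simp: smooth_algebra_0)
  show "smooth_norm 0 m (a + b) \<le> smooth_norm 0 m a + smooth_norm 0 m b"
    using c d unfolding smooth_norm_0[OF c] smooth_norm_0[OF d] smooth_norm_0[OF fourier_expansion_add[OF c d]]
      fourier_expansion_def by (blast intro: weighted_sum_add)
next
  fix M
  show "\<exists>m K. 0 \<le> K \<and> (\<forall>a\<in>smooth_algebra 0. smooth_bound 0 M (K * smooth_norm 0 m a) a)"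
    by (rule exI[of _ "Suc M"], rule exI[of _ 1]) (auto simp: smooth_algebra_0 smooth_norm_0 fourier_smooth_bound)
next
  fix a assume "\<And>M. \<exists>C. smooth_bound 0 M C a"
  then show "a \<in> smooth_algebra 0" unfolding smooth_algebra_0 using fourier_of_smooth_bound by blast
next
  fix m
  let ?W = "\<Sum>\<^sub>\<infinity>n::int. 1 / (1 + \<bar>real_of_int n\<bar>) ^ 2"
  have "smooth_norm 0 m a \<le> 2 ^ (m + 2) * ?W * C" if a: "a \<in> smooth_algebra 0" and smooth_bound: "smooth_bound 0 (m + 2) C a" for a C
  proof -
    obtain c where c: "fourier_expansion c a" using a by (auto simp: smooth_algebra_0)
    have "weighted_sum m c \<le> 2 ^ (m + 2) * C * ?W"
      by (rule weight_summable(2)) (use fourier_weight[OF smooth_bound] fourier_coefficient[OF c] in simp)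
    then show ?thesis by (simp add: smooth_norm_0[OF c] mult_ac)
  qed
  moreover have "0 \<le> ?W" by (rule infsum_nonneg) auto
  ultimately show "\<exists>M K. 0 \<le> K \<and> (\<forall>a\<in>smooth_algebra 0. \<forall>C. smooth_bound 0 M C a \<longrightarrow> smooth_norm 0 m a \<le> K * C)"
    by (intro exI[of _ "m + 2"] exI[of _ "2 ^ (m + 2) * ?W"]) auto
qed

section \<open>The inductive step from level l to level l + 1\<close>

context smooth_level
begin

abbreviation toep :: "(nat \<Rightarrow> nat \<Rightarrow> idx op) \<Rightarrow> (int \<Rightarrow> complex) \<Rightarrow> idx op \<Rightarrow> bool"
  where "toep \<equiv> toeplitz_expansion l A nrm"

definition next_algebra :: "idx op set"
  where "next_algebra = {a. \<exists>b c. toep b c a}"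

definition next_norm :: "nat \<Rightarrow> idx op \<Rightarrow> real"
  where "next_norm m a = (THE r. \<exists>b c. toep b c a \<and>
         r = Max {double_sum nrm r s b | r s. r \<le> m \<and> s \<le> m} + weighted_sum m c)"

lemma toep_iff: "toep b c a \<longleftrightarrow> (\<forall>j k. b j k \<in> A) \<and>
    (\<forall>n m. (\<lambda>(j, k). (1 + real j + real k) ^ n * nrm m (b j k)) summable_on UNIV) \<and>
    rapidly_decreasing c \<and> a = toeplitz_sum l b c"
  by (rule toeplitz_expansion_iff) (rule level)

lemma toepD:
  assumes "toep b c a"
  shows "b j k \<in> A" "(\<lambda>(j, k). (1 + real j + real k) ^ n * nrm m (b j k)) summable_on UNIV"
    "rapidly_decreasing c" "a = toeplitz_sum l b c"
  using assms by (auto simp: toep_iff)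

lemma toep_norm_summable:
  assumes "toep b c a"
  shows "(\<lambda>(j, k). norm (b j k)) summable_on UNIV"
proof -
  obtain m K where K: "0 \<le> K" "\<And>a. a \<in> A \<Longrightarrow> norm a \<le> K * nrm m a" using norm_le_nrm by blast
  have "(\<lambda>x. K * (case x of (j, k) \<Rightarrow> (1 + real j + real k) ^ 0 * nrm m (b j k))) summable_on UNIV"
    by (intro summable_on_cmult_right toepD[OF assms])
  then show ?thesis
    by (rule summable_on_comparison_test) (auto intro!: K toepD(1)[OF assms])
qed

lemma toep_level: "toep b c a \<Longrightarrow> level_op (Suc l) a"
  using level_op_toeplitz_sum[OF toep_norm_summable _ level] toepD by metis

lemma toep_slice: "toep b c a \<Longrightarrow> slice j k a = b j k + c (int k - int j) \<cdot>\<^sub>C level_proj l"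
  using toeplitz_sum_slice[OF toep_norm_summable toepD(3), of b c a] toepD(4) by metis

text \<open>The blocks b are summable in norm, so they tend to zero along every diagonal and only
  the constant c n survives in the limit.\<close>

lemma toep_symbol_coeff:
  assumes "toep b c a"
  shows "symbol_coeff l a n = c n"
proof -
  define j k where "j = nat (- n)" and "k = nat n"
  have n: "int k - int j = n" by (auto simp: j_def k_def)
  have inj: "inj (\<lambda>t. (j + t, k + t))" by (auto simp: inj_on_def)
  have "(\<lambda>(j, k). norm (b j k)) summable_on range (\<lambda>t. (j + t, k + t))"
    by (rule summable_on_subset_banach[OF toep_norm_summable[OF assms]]) simp
  then have "(\<lambda>t. norm (b (j + t) (k + t))) summable_on UNIV"
    by (subst (asm) summable_on_reindex[OF inj]) (simp add: o_def)
  then have "summable (\<lambda>t. norm (b (j + t) (k + t)))" by (rule summable_on_imp_summable)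
  then have "(\<lambda>t. norm (b (j + t) (k + t))) \<longlonglongrightarrow> 0" by (rule summable_LIMSEQ_zero)
  then have "(\<lambda>t. b (j + t) (k + t)) \<longlonglongrightarrow> 0" by (rule tendsto_norm_zero_cancel)
  then have "(\<lambda>t. ent (b (j + t) (k + t)) (base_idx l) (base_idx l)) \<longlonglongrightarrow> ent 0 (base_idx l) (base_idx l)"
    by (rule bounded_linear.tendsto[OF bounded_linear_ent])
  then have "(\<lambda>t. ent (b (j + t) (k + t)) (base_idx l) (base_idx l) + c n) \<longlonglongrightarrow> 0 + c n"
    by (intro tendsto_intros) simp
  moreover have "ent (slice (j + t) (k + t) a) (base_idx l) (base_idx l) = ent (b (j + t) (k + t)) (base_idx l) (base_idx l) + c n" for t
  proof -
    have "ent (level_proj l) (base_idx l) (base_idx l) = 1" by (simp add: ent_def level_proj_ket coord_ket base_idx_def)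
    moreover have "int (k + t) - int (j + t) = n" using n by simp
    ultimately show ?thesis by (simp add: toep_slice[OF assms])
  qed
  ultimately show ?thesis using symbol_coeff_eqI[of j k a l "c n"] n by simp
qed

text \<open>Both families of coefficients are expressed through a alone. This is the uniqueness that
  gives the THE in \<open>next_norm\<close> its value.\<close>

lemma toep_coeffs:
  assumes "toep b c a"
  shows "c = symbol_coeff l a" "b j k = slice j k a - symbol_coeff l a (int k - int j) \<cdot>\<^sub>C level_proj l"
  using toep_symbol_coeff[OF assms] toep_slice[OF assms] by auto

lemma double_sum_mono:
  assumes "toep b c a" "r \<le> r'" "s \<le> s'"
  shows "double_sum nrm r s b \<le> double_sum nrm r' s' b"
  unfolding double_sum_def
  by (rule infsum_mono[OF toepD(2)[OF assms(1)] toepD(2)[OF assms(1)]])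
     (use assms(2,3) toepD(1)[OF assms(1)] in \<open>auto intro!: mult_mono power_increasing nrm_mono nrm_nonneg\<close>)

lemma double_sum_nonneg: "toep b c a \<Longrightarrow> 0 \<le> double_sum nrm r s b"
  unfolding double_sum_def by (rule infsum_nonneg) (auto simp: toepD(1) nrm_nonneg)

lemma next_norm_eq:
  assumes t: "toep b c a"
  shows "next_norm m a = double_sum nrm m m b + weighted_sum m c"
proof -
  \<comment> \<open>The double sums increase in both indices, so the maximum is attained at the
    corner (m, m).\<close>
  have mx: "Max {double_sum nrm r s b | r s. r \<le> m \<and> s \<le> m} = double_sum nrm m m b"
  proof (rule Max_eqI)
    have "{double_sum nrm r s b | r s. r \<le> m \<and> s \<le> m} = (\<lambda>(r, s). double_sum nrm r s b) ` ({..m} \<times> {..m})"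
      by auto
    then show "finite {double_sum nrm r s b | r s. r \<le> m \<and> s \<le> m}" by simp
  qed (use double_sum_mono[OF t] in auto)
  have uniq: "b' = b \<and> c' = c" if "toep b' c' a" for b' c'
    using toep_coeffs[OF t] toep_coeffs[OF that] by (simp add: fun_eq_iff)
  show ?thesis
    unfolding next_norm_def mx[symmetric]
    by (rule the_equality) (use t uniq in blast)+
qed

lemma toep_add:
  assumes "toep b c a" "toep b' c' a'"
  shows "toep (\<lambda>j k. b j k + b' j k) (\<lambda>n. c n + c' n) (a + a')"
proof -
  have s: "(\<lambda>(j, k). (1 + real j + real k) ^ n * nrm m (b j k + b' j k)) summable_on UNIV" for n m
  proof (rule summable_on_comparison_test[OF summable_on_add[OF toepD(2)[OF assms(1), of n m] toepD(2)[OF assms(2), of n m]]])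
    show "(case x of (j, k) \<Rightarrow> (1 + real j + real k) ^ n * nrm m (b j k + b' j k))
      \<le> (case x of (j, k) \<Rightarrow> (1 + real j + real k) ^ n * nrm m (b j k)) +
         (case x of (j, k) \<Rightarrow> (1 + real j + real k) ^ n * nrm m (b' j k))" for x
      using toepD(1)[OF assms(1)] toepD(1)[OF assms(2)]
      by (cases x) (auto simp flip: distrib_left intro!: mult_left_mono nrm_add)
  qed (auto intro!: mult_nonneg_nonneg nrm_nonneg add_mem toepD(1)[OF assms(1)] toepD(1)[OF assms(2)])
  have n: "(\<lambda>(j, k). norm (b j k + b' j k)) summable_on UNIV"
    by (rule summable_on_comparison_test[OF summable_on_add[OF toep_norm_summable[OF assms(1)] toep_norm_summable[OF assms(2)]]])
       (auto intro: norm_triangle_ineq)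
  have "a + a' = toeplitz_sum l (\<lambda>j k. b j k + b' j k) (\<lambda>n. c n + c' n)"
    using toep_level[OF assms(1)] toep_level[OF assms(2)]
    by (intro toeplitz_sum_eqI n rapidly_decreasing_add toepD(3)[OF assms(1)] toepD(3)[OF assms(2)] level_op_simps level
        toepD(1)[OF assms(1)] toepD(1)[OF assms(2)])
       (simp_all add: slice_linear toep_slice[OF assms(1)] toep_slice[OF assms(2)] op_scale_distrib)
  then show ?thesis
    unfolding toep_iff using s toepD(1,3)[OF assms(1)] toepD(1,3)[OF assms(2)]
    by (auto intro: add_mem rapidly_decreasing_add)
qed

lemma toep_scale:
  assumes "toep b c a"
  shows "toep (\<lambda>j k. z \<cdot>\<^sub>C b j k) (\<lambda>n. z * c n) (z \<cdot>\<^sub>C a)"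
proof -
  have e: "(1 + real j + real k) ^ n * nrm m (z \<cdot>\<^sub>C b j k) = cmod z * ((1 + real j + real k) ^ n * nrm m (b j k))" for j k n m
    using nrm_scale[OF toepD(1)[OF assms]] by simp
  have s: "(\<lambda>(j, k). (1 + real j + real k) ^ n * nrm m (z \<cdot>\<^sub>C b j k)) summable_on UNIV" for n m
    unfolding e using summable_on_cmult_right[OF toepD(2)[OF assms, of n m], of "cmod z"]
    by (simp add: case_prod_unfold)
  have n: "(\<lambda>(j, k). norm (z \<cdot>\<^sub>C b j k)) summable_on UNIV"
    by (rule summable_on_comparison_test[OF summable_on_cmult_right[OF toep_norm_summable[OF assms], of "cmod z"]])
       (auto intro: norm_op_scale_le)
  have "z \<cdot>\<^sub>C a = toeplitz_sum l (\<lambda>j k. z \<cdot>\<^sub>C b j k) (\<lambda>n. z * c n)"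
    using toep_level[OF assms]
    by (intro toeplitz_sum_eqI n rapidly_decreasing_scale toepD(3)[OF assms] level_op_simps level toepD(1)[OF assms])
       (simp_all add: slice_scale toep_slice[OF assms] op_scale_distrib)
  then show ?thesis
    unfolding toep_iff using s toepD(1,3)[OF assms] by (auto intro: scale_mem rapidly_decreasing_scale)
qed

text \<open>The three series contribute the factor 2^(M+1) K of \<open>smooth_bound_embed\<close>,
  the factor 1 for the powers of \<open>\<alpha>\<^sub>1\<close>, and 2^M for the powers of its
  adjoint.\<close>

lemma toep_smooth_bound:
  assumes t: "toep b c a" and K: "0 \<le> K" "\<And>a. a \<in> A \<Longrightarrow> smooth_bound l M (K * nrm m a) a"
  shows "smooth_bound (Suc l) M (2 ^ Suc M * K * double_sum nrm M m b + (1 + 2 ^ M) * weighted_sum M c) a"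
proof -
  have rd: "rapidly_decreasing c" by (rule toepD(3)[OF t])
  let ?f = "\<lambda>n. (1 + \<bar>real_of_int n\<bar>) ^ M * cmod (c n)"
  have f: "?f summable_on UNIV" by (rule rapidly_decreasing_summable[OF rd])
  have 1: "smooth_bound (Suc l) M (2 ^ Suc M * K * double_sum nrm M m b) (\<Sum>\<^sub>\<infinity>(j, k). embed j k (b j k))"
  proof (rule smooth_bound_has_sum)
    show "((\<lambda>(j, k). embed j k (b j k)) has_sum (\<Sum>\<^sub>\<infinity>(j, k). embed j k (b j k))) UNIV"
      by (rule has_sum_infsum[OF embed_summable[OF toep_norm_summable[OF t]]])
    show "((\<lambda>x. 2 ^ Suc M * K * (case x of (j, k) \<Rightarrow> (1 + real j + real k) ^ M * nrm m (b j k)))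
        has_sum 2 ^ Suc M * K * double_sum nrm M m b) UNIV"
      unfolding double_sum_def by (intro has_sum_cmult_right has_sum_infsum toepD(2)[OF t])
    fix x :: "nat \<times> nat"
    obtain j k where x: "x = (j, k)" by (cases x)
    show "smooth_bound (Suc l) M (2 ^ Suc M * K * (case x of (j, k) \<Rightarrow> (1 + real j + real k) ^ M * nrm m (b j k)))
        (case x of (j, k) \<Rightarrow> embed j k (b j k))"
      using smooth_bound_embed[OF K(2)[OF toepD(1)[OF t]], of j k j k] by (simp add: x mult_ac)
  qed
  have inj: "inj int" "inj_on (\<lambda>n. - int n) {0<..}" by (auto simp: inj_on_def)
  have 2: "smooth_bound (Suc l) M (weighted_sum M c) (\<Sum>\<^sub>\<infinity>k. c (int k) \<cdot>\<^sub>C down_pow l k)"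
  proof (rule smooth_bound_mono[OF smooth_bound_has_sum])
    show "((\<lambda>k. c (int k) \<cdot>\<^sub>C down_pow l k) has_sum (\<Sum>\<^sub>\<infinity>k. c (int k) \<cdot>\<^sub>C down_pow l k)) UNIV"
      by (rule has_sum_infsum[OF coefficient_summable_nat(1)[OF rd]])
    have "?f summable_on range int" by (rule summable_on_subset_banach[OF f]) simp
    then have "(?f has_sum infsum ?f (range int)) (range int)" by (rule has_sum_infsum)
    then show "((?f \<circ> int) has_sum infsum ?f (range int)) UNIV" by (simp only: has_sum_reindex[OF inj(1)])
    show "infsum ?f (range int) \<le> weighted_sum M c"
      unfolding weighted_sum_def by (rule infsum_mono2[OF _ f]) (auto intro: summable_on_subset_banach[OF f])
    show "smooth_bound (Suc l) M ((?f \<circ> int) k) (c (int k) \<cdot>\<^sub>C down_pow l k)" for k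
      using smooth_bound_scale[OF smooth_bound_down_pow, of l M "c (int k)" k] by (simp add: mult.commute)
  qed
  have 3: "smooth_bound (Suc l) M (2 ^ M * weighted_sum M c) (\<Sum>\<^sub>\<infinity>k\<in>{0<..}. c (- int k) \<cdot>\<^sub>C up_pow l k)"
  proof (rule smooth_bound_mono[OF smooth_bound_has_sum])
    let ?R = "(\<lambda>n. - int n) ` {0<..}"
    show "((\<lambda>k. c (- int k) \<cdot>\<^sub>C up_pow l k) has_sum (\<Sum>\<^sub>\<infinity>k\<in>{0<..}. c (- int k) \<cdot>\<^sub>C up_pow l k)) {0<..}"
      by (rule has_sum_infsum[OF coefficient_summable_nat(2)[OF rd]])
    have "?f summable_on ?R" by (rule summable_on_subset_banach[OF f]) simp
    then have "(?f has_sum infsum ?f ?R) ?R" by (rule has_sum_infsum)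
    then have "((?f \<circ> (\<lambda>n. - int n)) has_sum infsum ?f ?R) {0<..}" by (simp only: has_sum_reindex[OF inj(2)])
    then show "((\<lambda>n. 2 ^ M * (?f \<circ> (\<lambda>n. - int n)) n) has_sum 2 ^ M * infsum ?f ?R) {0<..}"
      by (rule has_sum_cmult_right)
    have "infsum ?f ?R \<le> weighted_sum M c"
      unfolding weighted_sum_def by (rule infsum_mono2[OF _ f]) (auto intro: summable_on_subset_banach[OF f])
    then show "2 ^ M * infsum ?f ?R \<le> 2 ^ M * weighted_sum M c" by simp
    show "smooth_bound (Suc l) M (2 ^ M * (?f \<circ> (\<lambda>n. - int n)) k) (c (- int k) \<cdot>\<^sub>C up_pow l k)" for k
      using smooth_bound_scale[OF smooth_bound_up_pow, of l M "c (- int k)" k] by (simp add: mult_ac)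
  qed
  have "smooth_bound (Suc l) M (2 ^ Suc M * K * double_sum nrm M m b + weighted_sum M c + 2 ^ M * weighted_sum M c) a"
    unfolding toepD(4)[OF t] toeplitz_sum_def by (intro smooth_bound_add 1 2 3)
  then show ?thesis by (simp add: algebra_simps)
qed

lemma toep_of_smooth_bound:
  assumes smooth_bound: "\<And>M. \<exists>C. smooth_bound (Suc l) M C x"
  shows "toep (\<lambda>j k. slice j k x - symbol_coeff l x (int k - int j) \<cdot>\<^sub>C level_proj l) (symbol_coeff l x) x"
proof -
  define b where "b j k = slice j k x - symbol_coeff l x (int k - int j) \<cdot>\<^sub>C level_proj l" for j k
  have bA: "b j k \<in> A" for j k
  proof (rule mem_of_smooth_bound)
    fix M
    obtain C where "smooth_bound (Suc l) (0 + 2 + M) C x" using smooth_bound by blast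
    from slice_limit(2)[OF this, of j k] show "\<exists>C. smooth_bound l M C (b j k)" unfolding b_def by blast
  qed
  have rd: "rapidly_decreasing (symbol_coeff l x)"
    unfolding rapidly_decreasing_def
  proof
    fix m
    obtain C where "smooth_bound (Suc l) (m + 2) C x" using smooth_bound by blast
    from symbol_coeff_weight[OF this] show "\<exists>C. \<forall>n. (1 + \<bar>real_of_int n\<bar>) ^ m * cmod (symbol_coeff l x n) \<le> C" by blast
  qed
  have s: "(\<lambda>(j, k). (1 + real j + real k) ^ n * nrm m (b j k)) summable_on UNIV" for n m
  proof -
    obtain M K where K: "0 \<le> K" "\<And>a C. a \<in> A \<Longrightarrow> smooth_bound l M C a \<Longrightarrow> nrm m a \<le> K * C"
      using nrm_of_smooth_bound[of m] by blast
    \<comment> \<open>The orders are spent as follows: n on the weight, 4 on summability over pairs,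
      2 on the diagonal limit and M on the seminorm of a block.\<close>
    obtain C where C: "smooth_bound (Suc l) ((n + 4) + 2 + M) C x" using smooth_bound by blast
    define D where "D = K * (4 ^ (n + 4 + 2) * (1 + inverse_square_sum) * C)"
    have "(1 + real j + real k) ^ n * nrm m (b j k) \<le> D * (1 / (1 + real j + real k) ^ 4)" for j k
    proof -
      have P: "0 < 1 + real j + real k" by linarith
      have "nrm m (b j k) \<le> K * (4 ^ (n + 4 + 2) * (1 + inverse_square_sum) * C / (1 + real j + real k) ^ (n + 4))"
        using K(2)[OF bA slice_limit(2)[OF C, of j k, folded b_def]] .
      then have "nrm m (b j k) \<le> D / (1 + real j + real k) ^ (n + 4)" by (simp add: D_def)
      then have "(1 + real j + real k) ^ n * nrm m (b j k) \<le> (1 + real j + real k) ^ n * (D / (1 + real j + real k) ^ (n + 4))"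
        using P by (intro mult_left_mono) auto
      also have "\<dots> = D * (1 / (1 + real j + real k) ^ 4)" using P by (simp add: power_add)
      finally show ?thesis .
    qed
    then show ?thesis
      by (intro summable_on_comparison_test[OF summable_on_cmult_right[OF summable_inverse_pair, of D]])
         (auto intro!: mult_nonneg_nonneg nrm_nonneg bA)
  qed
  obtain m K where K: "0 \<le> K" "\<And>a. a \<in> A \<Longrightarrow> norm a \<le> K * nrm m a" using norm_le_nrm by blast
  have n: "(\<lambda>(j, k). norm (b j k)) summable_on UNIV"
    by (rule summable_on_comparison_test[OF summable_on_cmult_right[OF s[of 0 m], of K]]) (auto intro!: K bA)
  obtain C where "smooth_bound (Suc l) 0 C x" using smooth_bound by blast
  then have lx: "level_op (Suc l) x" using smooth_bound_D(1-3) by (auto simp: level_op_def)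
  have "x = toeplitz_sum l b (symbol_coeff l x)"
    by (rule toeplitz_sum_eqI[OF n rd level[OF bA] lx]) (simp add: b_def)
  then have "toep b (symbol_coeff l x) x" using bA s rd by (simp add: toep_iff)
  then show ?thesis by (simp add: b_def[abs_def])
qed

text \<open>By uniqueness any given expansion is the one built from diagonal limits, so
  \<open>slice_limit\<close> and \<open>symbol_coeff_weight\<close> bound its coefficients with
  constants that depend on l and m only.\<close>

lemma next_norm_of_smooth_bound:
  "\<exists>M K. 0 \<le> K \<and> (\<forall>a\<in>next_algebra. \<forall>C. smooth_bound (Suc l) M C a \<longrightarrow> next_norm m a \<le> K * C)"
proof -
  obtain M K where K: "0 \<le> K" "\<And>a C. a \<in> A \<Longrightarrow> smooth_bound l M C a \<Longrightarrow> nrm m a \<le> K * C"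
    using nrm_of_smooth_bound[of m] by blast
  let ?W = "\<Sum>\<^sub>\<infinity>n::int. 1 / (1 + \<bar>real_of_int n\<bar>) ^ 2"
  let ?V = "\<Sum>\<^sub>\<infinity>(j, k). 1 / (1 + real j + real k) ^ 4"
  have W0: "0 \<le> inverse_square_sum" "0 \<le> ?W" by (rule inverse_square_sum_nonneg) (rule infsum_nonneg, simp)
  have V0: "0 \<le> ?V" by (rule infsum_nonneg) auto
  define D where "D = K * (4 ^ (m + 4 + 2) * (1 + inverse_square_sum))"
  have "next_norm m a \<le> (D * ?V + 2 ^ (m + 2) * ?W) * C"
    if a: "a \<in> next_algebra" and smooth_bound: "smooth_bound (Suc l) (m + 4 + 2 + M) C a" for a C
  proof -
    obtain b c where t: "toep b c a" using a by (auto simp: next_algebra_def)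
    have C0: "0 \<le> C" using smooth_bound by (rule smooth_bound_nonneg)
    have "smooth_bound (Suc l) (m + 2 + 2) C a" by (rule smooth_bound_le[OF smooth_bound]) simp
    from symbol_coeff_weight[OF this] have "(1 + \<bar>real_of_int n\<bar>) ^ (m + 2) * cmod (c n) \<le> 2 ^ (m + 2) * C" for n
      using toep_symbol_coeff[OF t] by metis
    from weight_summable(2)[OF this] have 1: "weighted_sum m c \<le> 2 ^ (m + 2) * C * ?W" .
    have b: "(1 + real j + real k) ^ m * nrm m (b j k) \<le> D * C * (1 / (1 + real j + real k) ^ 4)" for j k
    proof -
      have P: "0 < 1 + real j + real k" by linarith
      have "nrm m (b j k) \<le> K * (4 ^ (m + 4 + 2) * (1 + inverse_square_sum) * C / (1 + real j + real k) ^ (m + 4))"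
        using K(2)[OF toepD(1)[OF t] slice_limit(2)[OF smooth_bound, of j k, folded toep_coeffs(2)[OF t]]] .
      then have "nrm m (b j k) \<le> D * C / (1 + real j + real k) ^ (m + 4)" by (simp add: D_def)
      then have "(1 + real j + real k) ^ m * nrm m (b j k) \<le> (1 + real j + real k) ^ m * (D * C / (1 + real j + real k) ^ (m + 4))"
        using P by (intro mult_left_mono) auto
      also have "\<dots> = D * C * (1 / (1 + real j + real k) ^ 4)" using P by (simp add: power_add)
      finally show ?thesis .
    qed
    have "double_sum nrm m m b \<le> (\<Sum>\<^sub>\<infinity>x. D * C * (case x of (j, k) \<Rightarrow> 1 / (1 + real j + real k) ^ 4))"
      unfolding double_sum_def
      by (rule infsum_mono[OF toepD(2)[OF t] summable_on_cmult_right[OF summable_inverse_pair]]) (use b in auto)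
    also have "\<dots> = D * C * ?V" by (rule infsum_cmult_right')
    finally have "double_sum nrm m m b \<le> D * C * ?V" .
    with 1 show ?thesis by (simp add: next_norm_eq[OF t] algebra_simps)
  qed
  moreover have "0 \<le> D * ?V + 2 ^ (m + 2) * ?W"
    using W0 V0 K(1) by (auto simp: D_def intro!: add_nonneg_nonneg mult_nonneg_nonneg)
  ultimately show ?thesis by blast
qed

lemma smooth_level_Suc: "smooth_level (Suc l) next_algebra next_norm"
proof
  fix a b and m m' :: nat and k
  assume "a \<in> next_algebra"
  then obtain \<beta> c where c: "toep \<beta> c a" by (auto simp: next_algebra_def)
  show "0 \<le> next_norm m a" by (simp add: next_norm_eq[OF c] weighted_sum_nonneg double_sum_nonneg[OF c])
  show "next_norm m a \<le> next_norm m' a" if "m \<le> m'"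
    using that toepD(3)[OF c] by (auto simp: next_norm_eq[OF c] intro!: add_mono weighted_sum_mono double_sum_mono[OF c])
  show "next_norm m (k \<cdot>\<^sub>C a) = cmod k * next_norm m a"
  proof -
    have e: "(case x of (i, j) \<Rightarrow> (1 + real i + real j) ^ m * nrm m (k \<cdot>\<^sub>C \<beta> i j)) =
        cmod k * (case x of (i, j) \<Rightarrow> (1 + real i + real j) ^ m * nrm m (\<beta> i j))" for x
      using nrm_scale[OF toepD(1)[OF c]] by (cases x) simp
    have "double_sum nrm m m (\<lambda>i j. k \<cdot>\<^sub>C \<beta> i j) = cmod k * double_sum nrm m m \<beta>"
      unfolding double_sum_def e by (rule infsum_cmult_right')
    then show ?thesis
      by (simp add: next_norm_eq[OF c] next_norm_eq[OF toep_scale[OF c]] weighted_sum_scale distrib_left)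
  qed
  assume "b \<in> next_algebra"
  then obtain \<beta>' c' where c': "toep \<beta>' c' b" by (auto simp: next_algebra_def)
  have "double_sum nrm m m (\<lambda>i j. \<beta> i j + \<beta>' i j) \<le> double_sum nrm m m \<beta> + double_sum nrm m m \<beta>'"
    unfolding double_sum_def infsum_add[OF toepD(2)[OF c] toepD(2)[OF c'], symmetric]
    by (rule infsum_mono[OF toepD(2)[OF toep_add[OF c c']] summable_on_add[OF toepD(2)[OF c] toepD(2)[OF c']]])
       (auto simp flip: distrib_left intro!: mult_left_mono nrm_add toepD(1)[OF c] toepD(1)[OF c'])
  then show "next_norm m (a + b) \<le> next_norm m a + next_norm m b"
    using weighted_sum_add[OF toepD(3)[OF c] toepD(3)[OF c'], of m]
    by (simp add: next_norm_eq[OF c] next_norm_eq[OF c'] next_norm_eq[OF toep_add[OF c c']])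
next
  fix M
  obtain m K where K: "0 \<le> K" "\<And>a. a \<in> A \<Longrightarrow> smooth_bound l M (K * nrm m a) a" using smooth_bound_of_nrm by blast
  \<comment> \<open>The estimate needs weights of order M and seminorms of order m, whereas
    \<open>next_norm\<close> has one index for both.\<close>
  define \<mu> where "\<mu> = max M m"
  define D where "D = 2 ^ Suc M * K + (1 + 2 ^ M)"
  have "smooth_bound (Suc l) M (D * next_norm \<mu> a) a" if "a \<in> next_algebra" for a
  proof -
    obtain b c where t: "toep b c a" using \<open>a \<in> next_algebra\<close> by (auto simp: next_algebra_def)
    have d: "double_sum nrm M m b \<le> double_sum nrm \<mu> \<mu> b" by (rule double_sum_mono[OF t]) (auto simp: \<mu>_def)
    have w: "weighted_sum M c \<le> weighted_sum \<mu> c" by (rule weighted_sum_mono[OF toepD(3)[OF t]]) (auto simp: \<mu>_def)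
    have "2 ^ Suc M * K * double_sum nrm M m b + (1 + 2 ^ M) * weighted_sum M c
       \<le> D * double_sum nrm \<mu> \<mu> b + D * weighted_sum \<mu> c"
      using d w K(1) double_sum_nonneg[OF t, of M m] weighted_sum_nonneg[of M c]
      by (intro add_mono mult_mono) (auto simp: D_def)
    with toep_smooth_bound[OF t K] show ?thesis
      by (auto simp: next_norm_eq[OF t] distrib_left intro: smooth_bound_mono)
  qed
  moreover have "0 \<le> D" using K(1) by (simp add: D_def)
  ultimately show "\<exists>m K. 0 \<le> K \<and> (\<forall>a\<in>next_algebra. smooth_bound (Suc l) M (K * next_norm m a) a)" by blast
next
  fix a assume "\<And>M. \<exists>C. smooth_bound (Suc l) M C a"
  then show "a \<in> next_algebra" unfolding next_algebra_def using toep_of_smooth_bound by blast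
next
  fix m show "\<exists>M K. 0 \<le> K \<and> (\<forall>a\<in>next_algebra. \<forall>C. smooth_bound (Suc l) M C a \<longrightarrow> next_norm m a \<le> K * C)" by (rule next_norm_of_smooth_bound)
qed

end

lemma smooth_data_eq: "smooth_data l = (smooth_algebra l, smooth_norm l)"
  by (simp add: smooth_algebra_def smooth_norm_def)

lemma smooth_level_smooth: "smooth_level l (smooth_algebra l) (smooth_norm l)"
proof (induction l)
  case 0
  show ?case by (rule smooth_level_0)
next
  case (Suc l)
  then interpret smooth_level l "smooth_algebra l" "smooth_norm l" .
  have "smooth_algebra (Suc l) = next_algebra" "smooth_norm (Suc l) = next_norm"
    unfolding smooth_algebra_def[of "Suc l"] smooth_norm_def[of "Suc l"] smooth_data.simps(2) smooth_data_eq[of l]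
    by (simp_all add: next_algebra_def next_norm_def fun_eq_iff)
  then show ?case using smooth_level_Suc by simp
qed


section \<open>The smooth algebras are Frechet algebras\<close>

context smooth_level
begin

lemma complex_linear_mem: "a \<in> A \<Longrightarrow> complex_linear a"
  using level by (simp add: level_op_def)

lemma ex_smooth_bound: "a \<in> A \<Longrightarrow> \<exists>C. smooth_bound l M C a"
  by (simp add: mem_iff)

lemma diff_mem: "a \<in> A \<Longrightarrow> b \<in> A \<Longrightarrow> a - b \<in> A"
  using add_mem[OF _ scale_mem[of b "-1"], of a] by (simp add: op_scale_distrib)

lemma mult_mem:
  assumes "a \<in> A" "b \<in> A"
  shows "a o\<^sub>L b \<in> A"
proof (rule mem_of_smooth_bound)
  fix M
  obtain C C' where "smooth_bound l M C a" "smooth_bound l M C' b" using ex_smooth_bound assms by metis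
  from smooth_bound_mult[OF this] show "\<exists>C. smooth_bound l M C (a o\<^sub>L b)" ..
qed

lemma adj_mem:
  assumes "a \<in> A"
  shows "adj a \<in> A"
proof (rule mem_of_smooth_bound)
  fix M
  obtain C where "smooth_bound l M C a" using ex_smooth_bound[OF assms] by blast
  from smooth_bound_adj[OF this] show "\<exists>C. smooth_bound l M C (adj a)" ..
qed

lemma star_subalgebra: "star_subalgebra A"
  unfolding star_subalgebra_def
  by (intro conjI ballI allI complex_linear_mem zero_mem add_mem mult_mem scale_mem adj_mem)

lemma limit_smooth_bound:
  assumes "X \<longlonglongrightarrow> x" "\<And>i. i \<ge> N \<Longrightarrow> smooth_bound l M C (X i)"
  shows "smooth_bound l M C x"
proof -
  have "x \<in> {x. smooth_bound l M C x}"
    by (rule Lim_in_closed_set[OF closed_smooth_bound _ _ assms(1)])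
       (use assms(2) in \<open>auto simp: eventually_sequentially\<close>)
  then show ?thesis by simp
qed

text \<open>A Cauchy sequence converges in operator norm. The commutator bounds hold on closed sets,
  so they pass to the limit and are then translated back into seminorms.\<close>

lemma complete:
  assumes X: "range X \<subseteq> A"
    and cauchy: "\<And>m e. e > 0 \<Longrightarrow> \<exists>M. \<forall>i\<ge>M. \<forall>j\<ge>M. nrm m (X i - X j) < e"
  shows "\<exists>a\<in>A. \<forall>m. (\<lambda>i. nrm m (X i - a)) \<longlonglongrightarrow> 0"
proof -
  have XA: "X i \<in> A" for i using X by auto
  have dA: "X i - X j \<in> A" for i j using XA by (intro diff_mem)
  have "Cauchy X"
  proof (rule metric_CauchyI)
    fix e :: real assume e: "e > 0"
    obtain m K where K: "0 \<le> K" "\<And>a. a \<in> A \<Longrightarrow> norm a \<le> K * nrm m a" using norm_le_nrm by blast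
    have "e / (K + 1) > 0" using e K(1) by simp
    from cauchy[OF this, of m] obtain N where N: "\<And>i j. i \<ge> N \<Longrightarrow> j \<ge> N \<Longrightarrow> nrm m (X i - X j) < e / (K + 1)"
      by blast
    have "dist (X i) (X j) < e" if "i \<ge> N" "j \<ge> N" for i j
    proof -
      have "dist (X i) (X j) \<le> K * nrm m (X i - X j)" using K(2)[OF dA] by (simp add: dist_norm)
      also have "\<dots> \<le> (K + 1) * nrm m (X i - X j)" using nrm_nonneg[OF dA] by (simp add: distrib_right)
      also have "\<dots> < (K + 1) * (e / (K + 1))" using N[OF that] K(1) by (intro mult_strict_left_mono) auto
      finally show ?thesis using K(1) by simp
    qed
    then show "\<exists>N. \<forall>m\<ge>N. \<forall>n\<ge>N. dist (X m) (X n) < e" by blast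
  qed
  then obtain x where x: "X \<longlonglongrightarrow> x" by (auto simp: Cauchy_convergent_iff convergent_def)
  have xA: "x \<in> A"
  proof (rule mem_of_smooth_bound)
    fix M
    obtain m K where K: "0 \<le> K" "\<And>a. a \<in> A \<Longrightarrow> smooth_bound l M (K * nrm m a) a" using smooth_bound_of_nrm by blast
    obtain N where N: "\<And>i j. i \<ge> N \<Longrightarrow> j \<ge> N \<Longrightarrow> nrm m (X i - X j) < 1"
      using cauchy[of 1 m] by auto
    have "smooth_bound l M (K * (nrm m (X N) + 1)) (X i)" if "i \<ge> N" for i
    proof (rule smooth_bound_mono[OF K(2)[OF XA]])
      have "nrm m (X i) \<le> nrm m (X N) + nrm m (X i - X N)" using nrm_add[OF XA dA, of m N i N] by simp
      then show "K * nrm m (X i) \<le> K * (nrm m (X N) + 1)" using N[OF that order_refl] K(1) by (intro mult_left_mono) auto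
    qed
    from limit_smooth_bound[OF x this] show "\<exists>C. smooth_bound l M C x" by blast
  qed
  have "(\<lambda>i. nrm m (X i - x)) \<longlonglongrightarrow> 0" for m
  proof (rule metric_LIMSEQ_I)
    fix e :: real assume e: "e > 0"
    obtain M K where K: "0 \<le> K" "\<And>a C. a \<in> A \<Longrightarrow> smooth_bound l M C a \<Longrightarrow> nrm m a \<le> K * C" using nrm_of_smooth_bound by blast
    obtain m' K' where K': "0 \<le> K'" "\<And>a. a \<in> A \<Longrightarrow> smooth_bound l M (K' * nrm m' a) a" using smooth_bound_of_nrm by blast
    \<comment> \<open>The summand 1 keeps the divisor positive and makes the final inequality
      strict.\<close>
    define d where "d = e / (K * K' + 1)"
    have KK: "0 \<le> K * K'" using K K' by simp
    have d: "d > 0" using e KK by (simp add: d_def)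
    obtain N where N: "\<And>i j. i \<ge> N \<Longrightarrow> j \<ge> N \<Longrightarrow> nrm m' (X i - X j) < d"
      using cauchy[OF d, of m'] by blast
    have "nrm m (X i - x) < e" if i: "i \<ge> N" for i
    proof -
      \<comment> \<open>With i fixed, j tends to infinity, and the bound passes to X i - x.\<close>
      have "smooth_bound l M (K' * d) (X i - X j)" if "j \<ge> N" for j
        by (rule smooth_bound_mono[OF K'(2)[OF dA]]) (use N[OF i that] K'(1) in \<open>auto intro!: mult_left_mono\<close>)
      from limit_smooth_bound[OF tendsto_diff[OF tendsto_const x] this] have "smooth_bound l M (K' * d) (X i - x)" .
      from K(2)[OF diff_mem[OF XA xA] this] have "nrm m (X i - x) \<le> (K * K') * d" by (simp add: mult_ac)
      also have "\<dots> < (K * K' + 1) * d" using d by (simp add: distrib_right)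
      also have "\<dots> = e" using KK by (simp add: d_def)
      finally show ?thesis .
    qed
    then show "\<exists>N. \<forall>n\<ge>N. dist (nrm m (X n - x)) 0 < e"
      using nrm_nonneg[OF diff_mem[OF XA xA]] by (intro exI[of _ N]) auto
  qed
  with xA show ?thesis by blast
qed

lemma frechet: "frechet_star_algebra A nrm"
  unfolding frechet_star_algebra_def
proof (intro conjI allI ballI impI)
  show "star_subalgebra A" by (rule star_subalgebra)
  show "nrm m (a + b) \<le> nrm m a + nrm m b" if "a \<in> A" "b \<in> A" for m a b using that by (rule nrm_add)
  show "nrm m (c \<cdot>\<^sub>C a) = cmod c * nrm m a" if "a \<in> A" for m c a using that by (rule nrm_scale)
  show "a = 0" if "a \<in> A" "\<forall>m. nrm m a = 0" for a
  proof -
    obtain m K where "\<And>a. a \<in> A \<Longrightarrow> norm a \<le> K * nrm m a" using norm_le_nrm by blast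
    from this[OF that(1)] that(2) show ?thesis by simp
  qed
  show "\<exists>a\<in>A. \<forall>m. (\<lambda>i. nrm m (X i - a)) \<longlonglongrightarrow> 0"
    if "range X \<subseteq> A" "\<forall>m. \<forall>e>0. \<exists>M. \<forall>i\<ge>M. \<forall>j\<ge>M. nrm m (X i - X j) < e" for X
    using that by (intro complete) blast+
  fix m
  obtain M K where K: "0 \<le> K" "\<And>a C. a \<in> A \<Longrightarrow> smooth_bound l M C a \<Longrightarrow> nrm m a \<le> K * C" using nrm_of_smooth_bound by blast
  obtain m' K' where K': "0 \<le> K'" "\<And>a. a \<in> A \<Longrightarrow> smooth_bound l M (K' * nrm m' a) a" using smooth_bound_of_nrm by blast
  have "nrm m (a o\<^sub>L b) \<le> K * (2 * 2 ^ M * K' * K') * nrm m' a * nrm m' b" if "a \<in> A" "b \<in> A" for a b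
    using K(2)[OF mult_mem[OF that] smooth_bound_mult[OF K'(2)[OF that(1)] K'(2)[OF that(2)]]] by (simp add: mult_ac)
  then show "\<exists>m' C. \<forall>a\<in>A. \<forall>b\<in>A. nrm m (a o\<^sub>L b) \<le> C * nrm m' a * nrm m' b" by blast
  have "nrm m (adj a) \<le> K * (2 ^ M * K') * nrm m' a" if "a \<in> A" for a
    using K(2)[OF adj_mem[OF that] smooth_bound_adj[OF K'(2)[OF that]]] by (simp add: mult_ac)
  then show "\<exists>m' C. \<forall>a\<in>A. nrm m (adj a) \<le> C * nrm m' a" by blast
qed

end


section \<open>The generators\<close>

text \<open>The induction is on a stronger claim, a majorant c whose power series converges for all
  |y| < 1: its termwise derivative has the coefficients (n + 1) c_{n+1}, which majorise the next
  power of 1 + n, and it converges on the same set.\<close>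

lemma poly_geometric_summable:
  fixes x :: real
  assumes "0 \<le> x" "x < 1"
  shows "summable (\<lambda>n. (1 + real n) ^ M * x ^ n)"
proof -
  have "\<exists>c :: nat \<Rightarrow> real. (\<forall>n. (1 + real n) ^ M \<le> c n) \<and> (\<forall>y. norm y < 1 \<longrightarrow> summable (\<lambda>n. c n * y ^ n))"
  proof (induction M)
    case 0
    show ?case by (rule exI[of _ "\<lambda>_. 1"]) (auto intro: summable_geometric)
  next
    case (Suc M)
    then obtain c :: "nat \<Rightarrow> real" where c: "\<And>n. (1 + real n) ^ M \<le> c n"
      "\<And>y. norm y < 1 \<Longrightarrow> summable (\<lambda>n. c n * y ^ n)" by blast
    have "(1 + real n) ^ Suc M \<le> diffs c n" for n
    proof -
      have "(1 + real n) ^ M \<le> (1 + real (Suc n)) ^ M" by (intro power_mono) auto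
      also have "\<dots> \<le> c (Suc n)" by (rule c)
      finally show ?thesis by (simp add: diffs_def mult_left_mono)
    qed
    moreover have "summable (\<lambda>n. diffs c n * y ^ n)" if "norm y < 1" for y
      by (rule termdiff_converges[OF that c(2)])
    ultimately show ?case by blast
  qed
  then obtain c :: "nat \<Rightarrow> real" where c: "\<And>n. (1 + real n) ^ M \<le> c n"
    "\<And>y. norm y < 1 \<Longrightarrow> summable (\<lambda>n. c n * y ^ n)" by blast
  show ?thesis
    by (rule summable_comparison_test'[OF c(2)[of x]])
       (use assms in \<open>auto intro!: mult_right_mono c(1)\<close>)
qed

lemma summable_on_nat:
  fixes f :: "nat \<Rightarrow> real"
  assumes "summable f" "\<And>n. 0 \<le> f n"
  shows "f summable_on UNIV"
  using assms by (intro norm_summable_imp_summable_on) simp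

text \<open>This covers both shapes of generators over the first leg: h n = n for a tensor product
  with q^N, and h n = n + 1 for the deviation of a weighted shift from the plain one. Geometric
  decay beats the polynomial growth of the bounds for blocks.\<close>

lemma embed_series_smooth_bound:
  assumes b: "smooth_bound l M C b" and q: "0 \<le> q" "q < 1" and c: "\<And>n. cmod (c n) \<le> q ^ n"
    and h: "\<And>n. h n \<le> Suc n"
  shows "(\<lambda>n. c n \<cdot>\<^sub>C embed (h n) n b) summable_on UNIV"
    and "\<exists>C'. smooth_bound (Suc l) M C' (\<Sum>\<^sub>\<infinity>n. c n \<cdot>\<^sub>C embed (h n) n b)"
proof -
  have C: "0 \<le> C" using b by (rule smooth_bound_nonneg)
  show s: "(\<lambda>n. c n \<cdot>\<^sub>C embed (h n) n b) summable_on UNIV"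
  proof (rule abs_summable_summable, rule summable_on_comparison_test)
    show "(\<lambda>n. norm b * q ^ n) summable_on UNIV"
      using q by (intro summable_on_cmult_right summable_on_nat) (auto intro: summable_geometric)
    show "norm (c n \<cdot>\<^sub>C embed (h n) n b) \<le> norm b * q ^ n" for n
      using mult_mono[OF c[of n] norm_embed[of "h n" n b]] q norm_op_scale_le[of "c n" "embed (h n) n b"]
      by (simp add: mult.commute)
  qed auto
  \<comment> \<open>The factor 2^M comes from 1 + h n + n \<le> 2 (1 + n), the others from
    \<open>smooth_bound_embed\<close>.\<close>
  define k where "k n = 2 ^ Suc M * 2 ^ M * C * ((1 + real n) ^ M * q ^ n)" for n
  have "(\<lambda>n. (1 + real n) ^ M * q ^ n) summable_on UNIV"
    using q by (intro summable_on_nat poly_geometric_summable) auto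
  then have k: "(k has_sum (\<Sum>\<^sub>\<infinity>n. k n)) UNIV"
    unfolding k_def[abs_def] by (intro has_sum_infsum summable_on_cmult_right)
  have "smooth_bound (Suc l) M (k n) (c n \<cdot>\<^sub>C embed (h n) n b)" for n
  proof (rule smooth_bound_mono[OF smooth_bound_scale[OF smooth_bound_embed[OF b]]])
    have "(1 + real (h n) + real n) ^ M \<le> (2 * (1 + real n)) ^ M"
      using h[of n] by (intro power_mono) auto
    then have "cmod (c n) * (2 ^ Suc M * (1 + real (h n) + real n) ^ M * C) \<le> q ^ n * (2 ^ Suc M * (2 * (1 + real n)) ^ M * C)"
      using c[of n] C q by (intro mult_mono mult_nonneg_nonneg order_refl) auto
    then show "cmod (c n) * (2 ^ Suc M * (1 + real (h n) + real n) ^ M * C) \<le> k n"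
      unfolding k_def power_mult_distrib by (simp only: mult_ac)
  qed
  from smooth_bound_has_sum[OF has_sum_infsum[OF s] k this]
  show "\<exists>C'. smooth_bound (Suc l) M C' (\<Sum>\<^sub>\<infinity>n. c n \<cdot>\<^sub>C embed (h n) n b)" by blast
qed

lemma embed_series_ket:
  assumes "(\<lambda>n. c n \<cdot>\<^sub>C embed (h n) n b) summable_on UNIV"
  shows "(\<Sum>\<^sub>\<infinity>n. c n \<cdot>\<^sub>C embed (h n) n b) (ket (k # ms, z)) = cscale (c k) (ins_op (h k) (b (ket (ms, z))))"
    and "(\<Sum>\<^sub>\<infinity>n. c n \<cdot>\<^sub>C embed (h n) n b) (ket ([], z)) = 0"
proof -
  let ?s = "\<Sum>\<^sub>\<infinity>n. c n \<cdot>\<^sub>C embed (h n) n b"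
  have 1: "((\<lambda>n. (c n \<cdot>\<^sub>C embed (h n) n b) v) has_sum ?s v) UNIV" for v
    by (rule has_sum_bounded_linear[OF blinfun.bounded_linear_left has_sum_infsum[OF assms]])
  have "(c n \<cdot>\<^sub>C embed (h n) n b) (ket (k # ms, z)) = (if n = k then cscale (c k) (ins_op (h k) (b (ket (ms, z)))) else 0)" for n
    by (auto simp: embed_def del_op_ket blinfun.zero_right)
  then have "((\<lambda>n. (c n \<cdot>\<^sub>C embed (h n) n b) (ket (k # ms, z))) has_sum cscale (c k) (ins_op (h k) (b (ket (ms, z))))) UNIV"
    using has_sum_single[of k "\<lambda>n. (c n \<cdot>\<^sub>C embed (h n) n b) (ket (k # ms, z))" UNIV] by simp
  with 1 show "?s (ket (k # ms, z)) = cscale (c k) (ins_op (h k) (b (ket (ms, z))))" by (rule has_sum_unique)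
  have "(c n \<cdot>\<^sub>C embed (h n) n b) (ket ([], z)) = 0" for n
    by (simp add: embed_def del_op_ket blinfun.zero_right)
  with 1[of "ket ([], z)"] have "((\<lambda>n::nat. 0 :: idx ell2) has_sum ?s (ket ([], z))) UNIV" by simp
  then show "?s (ket ([], z)) = 0" by (rule has_sum_unique) simp
qed

lemma complex_linear_infsum:
  fixes f :: "'k \<Rightarrow> 'i op"
  assumes "f summable_on S" "\<And>k. k \<in> S \<Longrightarrow> complex_linear (f k)"
  shows "complex_linear (infsum f S)"
  by (rule sum_in_closed[OF closed_complex_linear has_sum_infsum[OF assms(1)]]) (use assms(2) in auto)

lemma Y_0: "Y 0 q 1 = z_shift 1"
  by (simp add: Y_def tensor_list_def z_eq)

lemma Y_Suc_Suc:
  assumes "1 \<le> k" "k \<le> l + 1"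
  shows "Y (Suc l) q (Suc k) = q_pow_N q \<otimes>\<^sub>o Y l q k"
  using assms by (cases k) (auto simp: Y_def tensor_list_def Suc_le_eq)

lemma Y_Suc_1: "Y (Suc l) q 1 = (sqrt_one_minus_q_2N q o\<^sub>L adj S_nat) \<otimes>\<^sub>o level_proj l"
  by (simp add: Y_def tensor_list_def flip: unit_op_eq) (simp add: unit_op_def tensor_list_def)

context
  fixes q :: real
  assumes q: "0 \<le> q" "q < 1"
begin

text \<open>The factor with which \<open>sqrt_one_minus_q_2N q o\<^sub>L adj S_nat\<close> sends e_n
  to e_{n+1}; the root acts after the shift, hence \<open>Suc n\<close>.\<close>

definition shift_weight :: "nat \<Rightarrow> real"
  where "shift_weight n = sqrt (1 - q ^ (2 * Suc n))"

lemma shift_weight_bounds: "0 < shift_weight n" "\<bar>shift_weight n - 1\<bar> \<le> q ^ n"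
proof -
  have "q ^ (2 * Suc n) < 1" using q power_Suc_less_one[of q "Suc (2 * n)"] by (cases "q = 0") auto
  then show 0: "0 < shift_weight n" by (simp add: shift_weight_def)
  have l1: "shift_weight n \<le> 1" using q by (simp add: shift_weight_def)
  \<comment> \<open>For a weight between 0 and 1 passing to its square removes the root.\<close>
  have "1 - shift_weight n \<le> 1 - (shift_weight n)\<^sup>2" using 0 l1 by (simp add: power2_eq_square mult_left_le)
  also have "\<dots> = q ^ (2 * Suc n)" using \<open>q ^ (2 * Suc n) < 1\<close> by (simp add: shift_weight_def)
  also have "\<dots> \<le> q ^ n" using q by (intro power_decreasing) auto
  finally show "\<bar>shift_weight n - 1\<bar> \<le> q ^ n" using l1 by simp
qed

lemma Y_Suc_Suc_eq:
  assumes "1 \<le> k" "k \<le> l + 1" and smooth_bound: "smooth_bound l M C (Y l q k)"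
  shows "Y (Suc l) q (Suc k) = (\<Sum>\<^sub>\<infinity>n. of_real (q ^ n) \<cdot>\<^sub>C embed n n (Y l q k))"
    and "(\<lambda>n. of_real (q ^ n) \<cdot>\<^sub>C embed n n (Y l q k)) summable_on UNIV"
proof -
  show s: "(\<lambda>n. of_real (q ^ n) \<cdot>\<^sub>C embed n n (Y l q k)) summable_on UNIV"
    by (rule embed_series_smooth_bound(1)[OF smooth_bound q]) (use q in \<open>auto simp: norm_power\<close>)
  have cl: "complex_linear (\<Sum>\<^sub>\<infinity>n. of_real (q ^ n) \<cdot>\<^sub>C embed n n (Y l q k))"
    by (rule complex_linear_infsum[OF s]) (use smooth_bound_D(1)[OF smooth_bound] in auto)
  show "Y (Suc l) q (Suc k) = (\<Sum>\<^sub>\<infinity>n. of_real (q ^ n) \<cdot>\<^sub>C embed n n (Y l q k))"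
    unfolding Y_Suc_Suc[OF assms(1,2)]
    by (rule tensor_op_eqI[OF ket_values_q(1)[OF q] cl embed_series_ket(2)[OF s] embed_series_ket(1)[OF s]])
qed

lemma shift_weight_series:
  "(\<lambda>n. of_real (shift_weight n - 1) \<cdot>\<^sub>C embed (Suc n) n (level_proj l)) summable_on UNIV"
  "\<exists>C'. smooth_bound (Suc l) M C' (\<Sum>\<^sub>\<infinity>n. of_real (shift_weight n - 1) \<cdot>\<^sub>C embed (Suc n) n (level_proj l))"
  by (rule embed_series_smooth_bound[OF smooth_bound_level_proj q], simp_all only: norm_of_real shift_weight_bounds order_refl)+

text \<open>The first generator is the plain shift plus a weighted shift with geometrically small
  weights. Read backwards, this recovers the plain shift from the generator in
  \<open>up_pow_mem\<close>.\<close>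

lemma Y_Suc_1_eq:
  "Y (Suc l) q 1 = up_pow l 1 + (\<Sum>\<^sub>\<infinity>n. of_real (shift_weight n - 1) \<cdot>\<^sub>C embed (Suc n) n (level_proj l))"
proof -
  let ?s = "\<Sum>\<^sub>\<infinity>n. of_real (shift_weight n - 1) \<cdot>\<^sub>C embed (Suc n) n (level_proj l)"
  have cl: "complex_linear (up_pow l 1 + ?s)"
    by (intro complex_linear_simps complex_linear_sphere complex_linear_infsum shift_weight_series(1)) auto
  have u: "up_pow l 1 (ket ([], z)) = 0" "up_pow l 1 (ket (n # ms, z)) = ins_op (Suc n) (level_proj l (ket (ms, z)))" for n ms z
    by (auto simp: up_pow_Suc up_pow_0 level_proj_ket raise_op_ket ins_op_ket blinfun.zero_right simp del: op_power_simps)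
  have "(up_pow l 1 + ?s) (ket (n # ms, z)) = cscale (of_real (shift_weight n)) (ins_op (Suc n) (level_proj l (ket (ms, z))))" for n ms z
    unfolding blinfun.add_left u embed_series_ket(1)[OF shift_weight_series(1)]
    by (rule coord_eqI) (simp add: algebra_simps)
  moreover have "(up_pow l 1 + ?s) (ket ([], z)) = 0" for z
    unfolding blinfun.add_left u embed_series_ket(2)[OF shift_weight_series(1)] by simp
  ultimately show ?thesis
    unfolding Y_Suc_1
    by (intro tensor_op_eqI[OF ket_values_q(2)[OF q] cl]) (simp_all only: shift_weight_def)
qed

lemma Y_smooth_bound: "1 \<le> k \<Longrightarrow> k \<le> l + 1 \<Longrightarrow> \<exists>C. smooth_bound l M C (Y l q k)"
proof (induction l arbitrary: k)
  case 0
  then have "k = 1" by simp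
  then show ?case unfolding \<open>k = 1\<close> Y_0 using smooth_bound_z_shift by blast
next
  case (Suc l)
  show ?case
  proof (cases "k = 1")
    case True
    obtain C where "smooth_bound (Suc l) M C (\<Sum>\<^sub>\<infinity>n. of_real (shift_weight n - 1) \<cdot>\<^sub>C embed (Suc n) n (level_proj l))"
      using shift_weight_series(2) by blast
    from smooth_bound_add[OF smooth_bound_up_pow this] show ?thesis unfolding True Y_Suc_1_eq by blast
  next
    case False
    then obtain k' where k': "k = Suc k'" "1 \<le> k'" "k' \<le> l + 1" using Suc.prems by (cases k) auto
    obtain C where C: "smooth_bound l M C (Y l q k')" using Suc.IH[OF k'(2,3)] by blast
    show ?thesis unfolding k'(1) Y_Suc_Suc_eq(1)[OF k'(2,3) C]
      by (rule embed_series_smooth_bound(2)[OF C q]) (use q in \<open>auto simp: norm_power\<close>)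
  qed
qed

lemma Y_mem: "k \<in> {1..l + 1} \<Longrightarrow> Y l q k \<in> smooth_algebra l"
  using Y_smooth_bound by (intro smooth_level.mem_of_smooth_bound[OF smooth_level_smooth]) auto

end


section \<open>The C*-algebra generated by the generators\<close>

lemma star_subalgebraD:
  assumes "star_subalgebra B"
  shows "T \<in> B \<Longrightarrow> complex_linear T" "0 \<in> B" "T \<in> B \<Longrightarrow> R \<in> B \<Longrightarrow> T + R \<in> B"
    "T \<in> B \<Longrightarrow> R \<in> B \<Longrightarrow> T o\<^sub>L R \<in> B" "T \<in> B \<Longrightarrow> c \<cdot>\<^sub>C T \<in> B" "T \<in> B \<Longrightarrow> adj T \<in> B"
    "T \<in> B \<Longrightarrow> R \<in> B \<Longrightarrow> T - R \<in> B"
proof -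
  have *: "(\<forall>T\<in>B. complex_linear T)" "0 \<in> B" "(\<forall>T\<in>B. \<forall>T'\<in>B. T + T' \<in> B)" "(\<forall>T\<in>B. \<forall>T'\<in>B. T o\<^sub>L T' \<in> B)"
    "(\<forall>c. \<forall>T\<in>B. c \<cdot>\<^sub>C T \<in> B)" "(\<forall>T\<in>B. adj T \<in> B)"
    using assms unfolding star_subalgebra_def by blast+
  show "T \<in> B \<Longrightarrow> complex_linear T" "0 \<in> B" "T \<in> B \<Longrightarrow> R \<in> B \<Longrightarrow> T + R \<in> B"
    "T \<in> B \<Longrightarrow> R \<in> B \<Longrightarrow> T o\<^sub>L R \<in> B" "T \<in> B \<Longrightarrow> c \<cdot>\<^sub>C T \<in> B" "T \<in> B \<Longrightarrow> adj T \<in> B"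
    using * by simp_all
  assume "T \<in> B" "R \<in> B"
  then have "T + (-1) \<cdot>\<^sub>C R \<in> B" using *(3,5) by simp
  then show "T - R \<in> B" by (simp add: op_scale_distrib)
qed

lemma star_subalgebra_has_sum:
  assumes "star_subalgebra B" "closed B" "(f has_sum a) S" "\<And>k. k \<in> S \<Longrightarrow> f k \<in> B"
  shows "a \<in> B"
proof (rule sum_in_closed[of "\<lambda>x. x \<in> B", OF _ assms(3)])
  fix T assume "finite T" "T \<subseteq> S"
  then show "sum f T \<in> B"
    by (induction T rule: finite_induct) (auto intro: star_subalgebraD[OF assms(1)] assms(4))
qed (use assms(2) in simp)

lemma star_subalgebra_closure:
  fixes A :: "'i op set"
  assumes A: "star_subalgebra A"
  shows "star_subalgebra (closure A)"
  unfolding star_subalgebra_def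
proof (intro conjI ballI allI)
  have cl: "closure A \<subseteq> {T. complex_linear T}"
    using star_subalgebraD(1)[OF A] by (intro closure_minimal closed_complex_linear) auto
  show "complex_linear T" if "T \<in> closure A" for T using cl that by blast
  show "0 \<in> closure A" using star_subalgebraD(2)[OF A] closure_subset by blast
  fix T assume "T \<in> closure A"
  then obtain t where t: "\<And>n::nat. t n \<in> A" "t \<longlonglongrightarrow> T" by (auto simp: closure_sequential)
  show "c \<cdot>\<^sub>C T \<in> closure A" for c
    unfolding closure_sequential
    by (rule exI[of _ "\<lambda>n. c \<cdot>\<^sub>C t n"])
       (auto intro: star_subalgebraD[OF A] t bounded_linear.tendsto[OF bounded_linear_op_scale t(2)])
  show "adj T \<in> closure A"
    unfolding closure_sequential
  proof (intro exI conjI allI)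
    show "adj (t n) \<in> A" for n by (intro star_subalgebraD[OF A] t)
    have tc: "complex_linear (t n)" "complex_linear T" for n
      using star_subalgebraD(1)[OF A t(1)] cl \<open>T \<in> closure A\<close> by auto
    have le: "norm (adj (t n) - adj T) \<le> norm (t n - T)" for n
      using norm_adj_le[of "t n - T"] tc by (simp add: adj_simps)
    have "(\<lambda>n. norm (t n - T)) \<longlonglongrightarrow> 0"
      using t(2) by (simp add: LIM_zero_iff tendsto_norm_zero_iff)
    from Lim_null_comparison[OF always_eventually[OF allI[OF le]] this]
    show "(\<lambda>n. adj (t n)) \<longlonglongrightarrow> adj T" by (simp add: LIM_zero_iff)
  qed
  fix R assume "R \<in> closure A"
  then obtain r where r: "\<And>n::nat. r n \<in> A" "r \<longlonglongrightarrow> R" by (auto simp: closure_sequential)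
  show "T + R \<in> closure A"
    unfolding closure_sequential
    by (rule exI[of _ "\<lambda>n. t n + r n"]) (auto intro: star_subalgebraD[OF A] t r tendsto_add)
  show "T o\<^sub>L R \<in> closure A"
    unfolding closure_sequential
    by (rule exI[of _ "\<lambda>n. t n o\<^sub>L r n"])
       (auto intro: star_subalgebraD[OF A] t r bounded_bilinear.tendsto[OF bounded_bilinear_blinfun_compose])
qed

lemma star_subalgebra_level_op: "star_subalgebra {T. level_op l T}"
proof -
  have "level_op l (T o\<^sub>L R)" if "level_op l T" "level_op l R" for T R
    using that unfolding level_op_def by (metis complex_linear_simps(5) compose_assoc)
  moreover have "level_op l (adj T)" if "level_op l T" for T
  proof -
    have T: "complex_linear T" using that by (simp add: level_op_def)
    have "level_proj l o\<^sub>L adj T = adj (T o\<^sub>L level_proj l)" "adj T o\<^sub>L level_proj l = adj (level_proj l o\<^sub>L T)"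
      by (simp_all add: T adj_compose)
    then show ?thesis using that by (simp add: level_op_def)
  qed
  ultimately show ?thesis
    unfolding star_subalgebra_def by (auto simp: level_op_simps) (simp add: level_op_def)
qed

section \<open>Matrix units and the first generator\<close>

lemma embed_mult: "embed j k b o\<^sub>L embed k' m b' = (if k = k' then embed j m (b o\<^sub>L b') else 0)"
proof -
  have "embed j k b o\<^sub>L embed k' m b' = ins_op j o\<^sub>L b o\<^sub>L (del_op k o\<^sub>L ins_op k') o\<^sub>L b' o\<^sub>L del_op m"
    by (simp add: embed_def compose_assoc)
  then show ?thesis by (auto simp: slice_rules compose_distrib embed_def blinfun_eqI)
qed

lemma adj_embed: "complex_linear b \<Longrightarrow> adj (embed j k b) = embed k j (adj b)"
  by (simp add: embed_def adj_compose compose_assoc)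

text \<open>The diagonal operator f(N) \<otimes> 1 with N the number operator of the first leg, the
  part of the functional calculus of N needed to find projections in the C*-algebra.\<close>

definition leg_diag :: "nat \<Rightarrow> (nat \<Rightarrow> real) \<Rightarrow> idx op"
  where "leg_diag l f = weighted_comp (\<lambda>J. if length (fst J) = Suc l then of_real (f (hd (fst J))) else 0) id"

lemma leg_diag_ok:
  assumes "\<And>n. \<bar>f n\<bar> \<le> 1"
  shows "weighted_comp_ok (\<lambda>J::idx. if length (fst J) = Suc l then of_real (f (hd (fst J))) else 0) id"
  by (rule weighted_comp_okI[where B = 1]) (use assms in auto)

lemma coord_leg_diag:
  "(\<And>n. \<bar>f n\<bar> \<le> 1) \<Longrightarrow> coord (leg_diag l f x) J = (if length (fst J) = Suc l then of_real (f (hd (fst J))) * coord x J else 0)"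
  unfolding leg_diag_def by (simp add: coord_weighted_comp[OF leg_diag_ok])

lemma norm_leg_diag_diff:
  assumes "\<And>n. \<bar>f n\<bar> \<le> 1" "\<And>n. \<bar>g n\<bar> \<le> 1" "\<And>n. \<bar>f n - g n\<bar> \<le> e" "e \<le> 1"
  shows "norm (leg_diag l f - leg_diag l g) \<le> e"
proof -
  \<comment> \<open>The bound e \<le> 1 makes f - g itself an admissible argument of
    \<open>leg_diag\<close>.\<close>
  have fg: "\<bar>f n - g n\<bar> \<le> 1" for n using assms(3)[of n] assms(4) by linarith
  have e0: "0 \<le> e" using assms(3)[of 0] by linarith
  have "leg_diag l f - leg_diag l g = leg_diag l (\<lambda>n. f n - g n)"
    by (rule blinfun_eqI, rule coord_eqI) (simp add: blinfun.diff_left coord_leg_diag assms fg algebra_simps)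
  moreover have "norm (leg_diag l (\<lambda>n. f n - g n)) \<le> e"
    unfolding leg_diag_def by (rule norm_weighted_comp[OF leg_diag_ok[OF fg]]) (use assms(3) e0 in \<open>auto simp flip: of_real_diff\<close>)
  ultimately show ?thesis by simp
qed

lemma embed_0_0_level_proj: "embed 0 0 (level_proj l) = leg_diag l (\<lambda>n. if n = 0 then 1 else 0)"
  by (rule blinfun_eqI, rule coord_eqI)
     (auto simp: embed_def coord_basic coord_leg_diag prod_eq_iff neq_Nil_conv length_Suc_conv)

lemma leg_diag_one: "leg_diag l (\<lambda>_. 1) = level_proj (Suc l)"
  by (rule blinfun_eqI, rule coord_eqI) (auto simp: coord_leg_diag coord_basic)

context
  fixes q :: real
  assumes q: "0 \<le> q" "q < 1"
begin

lemma shift_weight_le_1: "shift_weight q n \<le> 1"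
  using q by (simp add: shift_weight_def[OF q])

lemma shift_weight_sq: "shift_weight q n * shift_weight q n = 1 - q ^ (2 * Suc n)"
  using q_sqrt_bounds(1)[OF q, of "Suc n"] by (simp add: shift_weight_def[OF q])

text \<open>The first generator again, now in coordinates, so that its products with its adjoint can
  be computed and are seen to be diagonal.\<close>

definition first_gen :: "nat \<Rightarrow> idx op"
  where "first_gen l = weighted_comp (\<lambda>J. if length (fst J) = Suc l \<and> 0 < hd (fst J) then of_real (shift_weight q (hd (fst J) - 1)) else 0)
    (\<lambda>J. ((hd (fst J) - 1) # tl (fst J), snd J))"

definition first_gen_adj :: "nat \<Rightarrow> idx op"
  where "first_gen_adj l = weighted_comp (\<lambda>J. if length (fst J) = Suc l then of_real (shift_weight q (hd (fst J))) else 0)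
    (\<lambda>J. (Suc (hd (fst J)) # tl (fst J), snd J))"

lemma first_gen_ok:
  "weighted_comp_ok (\<lambda>J::idx. if length (fst J) = Suc l \<and> 0 < hd (fst J) then complex_of_real (shift_weight q (hd (fst J) - 1)) else 0)
    (\<lambda>J. ((hd (fst J) - 1) # tl (fst J), snd J))"
  "weighted_comp_ok (\<lambda>J::idx. if length (fst J) = Suc l then complex_of_real (shift_weight q (hd (fst J))) else 0)
    (\<lambda>J. (Suc (hd (fst J)) # tl (fst J), snd J))"
  using shift_weight_bounds(1)[OF q] shift_weight_le_1
  by (auto intro!: weighted_comp_okI[where B = 1] prod_eqI simp: abs_of_pos length_Suc_conv split: if_splits)

lemma coord_first_gen:
  "coord (first_gen l x) J = (if length (fst J) = Suc l \<and> 0 < hd (fst J)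
     then of_real (shift_weight q (hd (fst J) - 1)) * coord x ((hd (fst J) - 1) # tl (fst J), snd J) else 0)"
  "coord (first_gen_adj l x) J = (if length (fst J) = Suc l
     then of_real (shift_weight q (hd (fst J))) * coord x (Suc (hd (fst J)) # tl (fst J), snd J) else 0)"
  unfolding first_gen_def first_gen_adj_def coord_weighted_comp[OF first_gen_ok(1)] coord_weighted_comp[OF first_gen_ok(2)] by simp_all

lemma adj_first_gen: "adj (first_gen l) = first_gen_adj l"
  unfolding first_gen_def first_gen_adj_def
proof (rule adj_weighted_comp[OF first_gen_ok])
  fix i j :: idx
  show "(if ((hd (fst j) - 1) # tl (fst j), snd j) = i
      then cnj (if length (fst j) = Suc l \<and> 0 < hd (fst j) then of_real (shift_weight q (hd (fst j) - 1)) else 0) else 0) =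
    (if (Suc (hd (fst i)) # tl (fst i), snd i) = j
      then if length (fst i) = Suc l then of_real (shift_weight q (hd (fst i))) else 0 else 0)"
    by (cases i; cases j; cases "fst i"; cases "fst j"; cases "hd (fst j)") auto
qed

lemma Y_Suc_1_first_gen: "Y (Suc l) q 1 = first_gen l"
  unfolding Y_Suc_1
proof (rule tensor_op_eqI[OF ket_values_q(2)[OF q]])
  show "complex_linear (first_gen l)" unfolding first_gen_def by (rule complex_linear_weighted_comp[OF first_gen_ok(1)])
  show "first_gen l (ket ([], z)) = 0" for z
    by (rule coord_eqI) (simp add: coord_first_gen coord_ket)
  show "first_gen l (ket (n # ms, z)) = cscale (of_real (sqrt (1 - q ^ (2 * Suc n)))) (ins_op (Suc n) (level_proj l (ket (ms, z))))" for n ms z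
    unfolding shift_weight_def[OF q, symmetric]
  proof (rule coord_eqI)
    fix J :: idx
    show "coord (first_gen l (ket (n # ms, z))) J = coord (cscale (of_real (shift_weight q n)) (ins_op (Suc n) (level_proj l (ket (ms, z))))) J"
      by (cases J; cases "fst J"; cases "hd (fst J)")
         (auto simp: coord_first_gen coord_ket coord_basic level_proj_ket ins_op_ket blinfun.zero_right)
  qed
qed

lemma first_gen_products:
  "first_gen_adj l o\<^sub>L first_gen l = leg_diag l (\<lambda>n. 1 - q ^ (2 * Suc n))" "first_gen l o\<^sub>L first_gen_adj l = leg_diag l (\<lambda>n. 1 - q ^ (2 * n))"
proof -
  have b: "\<bar>1 - q ^ (2 * n)\<bar> \<le> 1" for n using q_sqrt_bounds[OF q, of n] by simp
  have s: "of_real (shift_weight q n) * (of_real (shift_weight q n) * c) = of_real (1 - q ^ (2 * Suc n)) * (c::complex)" for n c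
    unfolding shift_weight_sq[symmetric] by simp
  show "first_gen_adj l o\<^sub>L first_gen l = leg_diag l (\<lambda>n. 1 - q ^ (2 * Suc n))"
  proof (rule blinfun_eqI, rule coord_eqI)
    fix x :: "idx ell2" and J :: idx
    show "coord ((first_gen_adj l o\<^sub>L first_gen l) x) J = coord (leg_diag l (\<lambda>n. 1 - q ^ (2 * Suc n)) x) J"
      unfolding coord_leg_diag[OF b] blinfun_apply_blinfun_compose coord_first_gen
      by (cases J; cases "fst J") (simp_all add: s del: power_Suc mult_Suc_right of_real_diff of_real_power)
  qed
  show "first_gen l o\<^sub>L first_gen_adj l = leg_diag l (\<lambda>n. 1 - q ^ (2 * n))"
  proof (rule blinfun_eqI, rule coord_eqI)
    fix x :: "idx ell2" and J :: idx
    have "coord (first_gen l (first_gen_adj l x)) (n # ms, z) = coord (leg_diag l (\<lambda>n. 1 - q ^ (2 * n)) x) (n # ms, z)" for n ms z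
      unfolding coord_leg_diag[OF b] coord_first_gen
      by (cases n) (simp_all add: s del: power_Suc mult_Suc_right of_real_diff of_real_power)
    moreover have "coord (first_gen l (first_gen_adj l x)) ([], z) = coord (leg_diag l (\<lambda>n. 1 - q ^ (2 * n)) x) ([], z)" for z
      unfolding coord_leg_diag[OF b] coord_first_gen by simp
    ultimately show "coord ((first_gen l o\<^sub>L first_gen_adj l) x) J = coord (leg_diag l (\<lambda>n. 1 - q ^ (2 * n)) x) J"
      by (cases J; cases "fst J") simp_all
  qed
qed

lemma sphere_cstar:
  shows "star_subalgebra (sphere_cstar l q)" "closed (sphere_cstar l q)"
    "k \<in> {1..l + 1} \<Longrightarrow> Y l q k \<in> sphere_cstar l q"
proof -
  have "complex_linear T" if "T \<in> Y l q ` {1..l + 1}" for T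
    using that smooth_level.complex_linear_mem[OF smooth_level_smooth Y_mem[OF q]] by auto
  note c = cstar_generated_star_subalgebra[OF this]
  show "star_subalgebra (sphere_cstar l q)" "closed (sphere_cstar l q)"
    unfolding sphere_cstar_def by (rule c; assumption)+
  show "k \<in> {1..l + 1} \<Longrightarrow> Y l q k \<in> sphere_cstar l q"
    unfolding sphere_cstar_def using c(3) by blast
qed

lemma sphere_cstar_level: "T \<in> sphere_cstar l q \<Longrightarrow> level_op l T"
proof -
  have "sphere_cstar l q \<subseteq> {T. level_op l T}"
    unfolding sphere_cstar_def
    by (rule cstar_generated_least[OF star_subalgebra_level_op closed_level_op])
       (use smooth_level.level[OF smooth_level_smooth Y_mem[OF q]] in auto)
  then show "T \<in> sphere_cstar l q \<Longrightarrow> level_op l T" by blast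
qed

lemma sphere_cstar_subset_closure: "sphere_cstar l q \<subseteq> closure (smooth_algebra l)"
  unfolding sphere_cstar_def
proof (rule cstar_generated_least)
  show "star_subalgebra (closure (smooth_algebra l))"
    by (rule star_subalgebra_closure[OF smooth_level.star_subalgebra[OF smooth_level_smooth]])
  show "Y l q ` {1..l + 1} \<subseteq> closure (smooth_algebra l)"
    using Y_mem[OF q] closure_subset by blast
qed simp

lemma first_gen_mem: "first_gen l \<in> sphere_cstar (Suc l) q"
  using sphere_cstar(3)[of 1 "Suc l"] by (simp add: Y_Suc_1_first_gen[unfolded One_nat_def])

lemma q_power_bounds: "0 \<le> q ^ n" "q ^ n \<le> 1"
  using q by (auto simp: power_le_one)

text \<open>The generated algebra is not unital by definition. With P the adjoint of the first
  generator times the generator, 1 - P = q^{2(N+1)} has n-th powers of norm at most q^n, so 1 - (1 -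
  P)^n tends to the unit; these are polynomials in P without constant term.\<close>

lemma level_proj_mem_cstar: "level_proj (Suc l) \<in> sphere_cstar (Suc l) q"
proof -
  note B = star_subalgebraD[OF sphere_cstar(1)[of "Suc l"]]
  define f where "f n k = (q ^ (2 * Suc k)) ^ n" for n k
  have f: "0 \<le> f n k" "f n k \<le> q ^ n" "\<bar>f n k\<bar> \<le> 1" for n k
  proof -
    show "0 \<le> f n k" using q by (simp add: f_def)
    show 1: "f n k \<le> q ^ n"
      unfolding f_def power_mult[symmetric] using q by (intro power_decreasing) auto
    show "\<bar>f n k\<bar> \<le> 1" using 1 q_power_bounds[of n] \<open>0 \<le> f n k\<close> by linarith
  qed
  have f1: "\<bar>1 - q ^ (2 * Suc n)\<bar> \<le> 1" for n using q_sqrt_bounds[OF q, of "Suc n"] by simp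
  have X: "level_proj (Suc l) - leg_diag l (f n) \<in> sphere_cstar (Suc l) q" for n
  proof (induction n)
    case 0
    have "f 0 = (\<lambda>_. 1)" by (simp add: f_def fun_eq_iff)
    then show ?case by (simp add: leg_diag_one B)
  next
    case (Suc n)
    define P where "P = first_gen_adj l o\<^sub>L first_gen l"
    have P: "P \<in> sphere_cstar (Suc l) q"
      unfolding P_def adj_first_gen[symmetric] by (intro B first_gen_mem)
    have s: "f (Suc n) k = q ^ (2 * Suc k) * f n k" for k by (simp add: f_def)
    \<comment> \<open>The recursion X_{n+1} = X_n + P - P X_n for X_n = 1 - (1 - P)^n.\<close>
    have "level_proj (Suc l) - leg_diag l (f (Suc n)) = (level_proj (Suc l) - leg_diag l (f n)) + P - (P o\<^sub>L (level_proj (Suc l) - leg_diag l (f n)))"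
    proof (rule blinfun_eqI, rule coord_eqI)
      fix x :: "idx ell2" and J :: idx
      show "coord ((level_proj (Suc l) - leg_diag l (f (Suc n))) x) J =
        coord ((level_proj (Suc l) - leg_diag l (f n) + P - (P o\<^sub>L (level_proj (Suc l) - leg_diag l (f n)))) x) J"
        unfolding P_def first_gen_products
        by (simp add: blinfun.diff_left blinfun.add_left coord_basic coord_leg_diag[OF f(3)] coord_leg_diag[OF f1] s
            del: power_Suc mult_Suc_right) (simp add: algebra_simps del: power_Suc mult_Suc_right)
    qed
    then show ?case by (simp only:) (intro B Suc.IH P)
  qed
  have "norm (leg_diag l (f n) - leg_diag l (\<lambda>_. 0)) \<le> q ^ n" for n
    by (rule norm_leg_diag_diff) (use f q_power_bounds in auto)
  moreover have "leg_diag l (\<lambda>_. 0) = 0"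
    by (rule blinfun_eqI, rule coord_eqI) (simp add: coord_leg_diag)
  ultimately have le: "norm (leg_diag l (f n)) \<le> q ^ n" for n by simp
  have "(\<lambda>n. q ^ n) \<longlonglongrightarrow> 0" using q by (intro LIMSEQ_power_zero) auto
  from Lim_null_comparison[OF always_eventually[OF allI[OF le]] this]
  have "(\<lambda>n. leg_diag l (f n)) \<longlonglongrightarrow> 0" .
  then have "(\<lambda>n. level_proj (Suc l) - leg_diag l (f n)) \<longlonglongrightarrow> level_proj (Suc l) - 0" by (intro tendsto_intros)
  then show ?thesis using closed_sequentially[OF sphere_cstar(2), of _ "Suc l"] X by (metis diff_zero)
qed

text \<open>The first generator times its adjoint is 1 - q^{2N}. The operator q^{2N} has the
  eigenvalue 1 exactly where N = 0 and all others are at most q^2, so its powers tend to p0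
  \<otimes> 1.\<close>

lemma embed_0_0_level_proj_mem: "embed 0 0 (level_proj l) \<in> sphere_cstar (Suc l) q"
proof -
  note B = star_subalgebraD[OF sphere_cstar(1)[of "Suc l"]]
  define f where "f n k = (q ^ (2 * k)) ^ Suc n" for n k
  define d where "d k = (if k = 0 then 1 else 0 :: real)" for k :: nat
  have f: "0 \<le> f n k" "\<bar>f n k\<bar> \<le> 1" for n k
    using q by (auto simp: f_def power_le_one mult_le_one)
  have fd: "\<bar>f n k - d k\<bar> \<le> q ^ n" for n k
  proof (cases "k = 0")
    case False
    have "n \<le> 1 * Suc n" by simp
    also have "\<dots> \<le> 2 * k * Suc n" using False by (intro mult_le_mono1) simp
    finally have "f n k \<le> q ^ n"
      unfolding f_def power_mult[symmetric] using q by (intro power_decreasing) auto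
    then show ?thesis using f(1)[of n k] False by (simp add: d_def)
  qed (use q in \<open>simp add: f_def d_def\<close>)
  have f1: "\<bar>1 - q ^ (2 * n)\<bar> \<le> 1" "\<bar>q ^ (2 * n)\<bar> \<le> 1" for n using q_sqrt_bounds[OF q, of n] by auto
  define P where "P = level_proj (Suc l) - (first_gen l o\<^sub>L first_gen_adj l)"
  have P: "P \<in> sphere_cstar (Suc l) q"
    unfolding P_def adj_first_gen[symmetric] by (intro B first_gen_mem level_proj_mem_cstar)
  have Pd: "P = leg_diag l (\<lambda>n. q ^ (2 * n))"
    unfolding P_def first_gen_products
    by (rule blinfun_eqI, rule coord_eqI)
       (simp add: blinfun.diff_left coord_basic coord_leg_diag[OF f1(1)] coord_leg_diag[OF f1(2)] left_diff_distrib)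
  have X: "leg_diag l (f n) \<in> sphere_cstar (Suc l) q" for n
  proof (induction n)
    case 0
    have "f 0 = (\<lambda>n. q ^ (2 * n))" by (simp add: f_def fun_eq_iff)
    then show ?case using P Pd by simp
  next
    case (Suc n)
    have s: "f (Suc n) k = q ^ (2 * k) * f n k" for k by (simp add: f_def)
    have "leg_diag l (f (Suc n)) = P o\<^sub>L leg_diag l (f n)"
      unfolding Pd
      by (rule blinfun_eqI, rule coord_eqI) (simp add: coord_leg_diag[OF f1(2)] coord_leg_diag[OF f(2)] s)
    then show ?case by (simp only:) (intro B Suc.IH P)
  qed
  have d: "\<bar>d k\<bar> \<le> 1" for k by (simp add: d_def)
  have le: "norm (leg_diag l (f n) - leg_diag l d) \<le> q ^ n" for n
    by (rule norm_leg_diag_diff[OF f(2) d fd]) (use q_power_bounds in auto)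
  have "(\<lambda>n. q ^ n) \<longlonglongrightarrow> 0" using q by (intro LIMSEQ_power_zero) auto
  from Lim_null_comparison[OF always_eventually[OF allI[OF le]] this]
  have "(\<lambda>n. leg_diag l (f n)) \<longlonglongrightarrow> leg_diag l d" by (simp add: LIM_zero_iff)
  from closed_sequentially[OF sphere_cstar(2) X this] show ?thesis
    by (simp add: embed_0_0_level_proj d_def[abs_def])
qed

lemma first_gen_embed: "first_gen l o\<^sub>L embed j k (level_proj l) = of_real (shift_weight q j) \<cdot>\<^sub>C embed (Suc j) k (level_proj l)"
proof (rule blinfun_eqI, rule coord_eqI)
  fix x :: "idx ell2" and J :: idx
  show "coord ((first_gen l o\<^sub>L embed j k (level_proj l)) x) J = coord ((of_real (shift_weight q j) \<cdot>\<^sub>C embed (Suc j) k (level_proj l)) x) J"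
    by (cases J; cases "fst J"; cases "hd (fst J)") (auto simp: embed_def coord_first_gen coord_basic)
qed

text \<open>The units E_j0 arise from E_00 by the first generator, whose weights are positive and
  can be divided out; the rest are products E_j0 E_0k with E_0k an adjoint.\<close>

lemma embed_level_proj_mem: "embed j k (level_proj l) \<in> sphere_cstar (Suc l) q"
proof -
  note B = star_subalgebraD[OF sphere_cstar(1)[of "Suc l"]]
  have 1: "embed j 0 (level_proj l) \<in> sphere_cstar (Suc l) q" for j
  proof (induction j)
    case (Suc j)
    have "embed (Suc j) 0 (level_proj l) = (1 / of_real (shift_weight q j)) \<cdot>\<^sub>C (first_gen l o\<^sub>L embed j 0 (level_proj l))"
      unfolding first_gen_embed using shift_weight_bounds(1)[OF q, of j] by simp
    then show ?case by (simp only:) (intro B first_gen_mem Suc.IH)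
  qed (rule embed_0_0_level_proj_mem)
  have "adj (embed k 0 (level_proj l)) \<in> sphere_cstar (Suc l) q" by (intro B 1)
  then have "embed 0 k (level_proj l) \<in> sphere_cstar (Suc l) q" by (simp add: adj_embed)
  from B(4)[OF 1 this, of j] show ?thesis by (simp add: embed_mult level_proj_rules)
qed

text \<open>The deviation of the first generator from the plain shift is a norm-convergent series of
  matrix units, hence in the algebra, and subtracting it leaves the plain shift.\<close>

lemma up_pow_mem: "up_pow l n \<in> sphere_cstar (Suc l) q"
proof -
  note B = star_subalgebraD[OF sphere_cstar(1)[of "Suc l"]]
  have "(\<Sum>\<^sub>\<infinity>n. of_real (shift_weight q n - 1) \<cdot>\<^sub>C embed (Suc n) n (level_proj l)) \<in> sphere_cstar (Suc l) q"
    by (rule star_subalgebra_has_sum[OF sphere_cstar(1,2) has_sum_infsum[OF shift_weight_series(1)[OF q]]])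
       (intro B embed_level_proj_mem)
  with first_gen_mem have "first_gen l - (\<Sum>\<^sub>\<infinity>n. of_real (shift_weight q n - 1) \<cdot>\<^sub>C embed (Suc n) n (level_proj l)) \<in> sphere_cstar (Suc l) q"
    by (intro B)
  then have 1: "up_pow l 1 \<in> sphere_cstar (Suc l) q"
    by (simp only: Y_Suc_1_first_gen[symmetric] Y_Suc_1_eq[OF q] add_diff_cancel_right')
  show ?thesis
  proof (induction n)
    case 0
    then show ?case by (simp add: up_pow_0 level_proj_mem_cstar)
  next
    case (Suc n)
    have "up_pow l (Suc n) = up_pow l 1 o\<^sub>L up_pow l n"
      using up_pow_level_proj(2)[of l n] by (simp add: up_pow_Suc up_pow_0 compose_assoc)
    then show ?case by (simp only:) (intro B 1 Suc.IH)
  qed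
qed

lemma down_pow_mem: "down_pow l n \<in> sphere_cstar (Suc l) q"
  using star_subalgebraD(6)[OF sphere_cstar(1) up_pow_mem[of l n]] 
  by (simp add: up_pow_eq_adj adj_adj[OF complex_linear_sphere(3)])

text \<open>The operators b with E_00 \<otimes> b in the larger algebra form a closed
  star-subalgebra, so it is enough to treat generators; there, multiplication by E_00 \<otimes> 1
  isolates E_00 \<otimes> Y_k from Y_{k+1} of the larger level.\<close>

lemma embed_0_0_mem: "b \<in> sphere_cstar l q \<Longrightarrow> embed 0 0 b \<in> sphere_cstar (Suc l) q"
proof -
  note B = star_subalgebraD[OF sphere_cstar(1)[of "Suc l"]]
  \<comment> \<open>Complex-linearity is included because \<open>star_subalgebra\<close> demands it
    of every member.\<close>
  let ?S = "{b. complex_linear b} \<inter> {b. embed 0 0 b \<in> sphere_cstar (Suc l) q}"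
  have "star_subalgebra ?S"
    unfolding star_subalgebra_def
  proof (intro conjI ballI allI IntI CollectI)
    fix T R c assume T: "T \<in> ?S" and R: "R \<in> ?S"
    then have "embed 0 0 T + embed 0 0 R \<in> sphere_cstar (Suc l) q" "embed 0 0 T o\<^sub>L embed 0 0 R \<in> sphere_cstar (Suc l) q"
      by (auto intro: B)
    then show "embed 0 0 (T + R) \<in> sphere_cstar (Suc l) q" "embed 0 0 (T o\<^sub>L R) \<in> sphere_cstar (Suc l) q"
      by (simp_all add: embed_mult linear_simps(1)[OF bounded_linear_embed])
    show "complex_linear (T + R)" "complex_linear (T o\<^sub>L R)" using T R by auto
  next
    fix T and c assume T: "T \<in> ?S"
    then have "adj (embed 0 0 T) \<in> sphere_cstar (Suc l) q" "c \<cdot>\<^sub>C embed 0 0 T \<in> sphere_cstar (Suc l) q" by (auto intro: B)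
    then show "embed 0 0 (adj T) \<in> sphere_cstar (Suc l) q" "embed 0 0 (c \<cdot>\<^sub>C T) \<in> sphere_cstar (Suc l) q"
      using T by (simp_all add: adj_embed embed_scale)
    show "complex_linear T" "complex_linear (adj T)" "complex_linear (c \<cdot>\<^sub>C T)" using T by auto
  next
    show "embed 0 0 0 \<in> sphere_cstar (Suc l) q" by (simp add: linear_simps(3)[OF bounded_linear_embed] B)
  qed auto
  moreover have "closed ?S"
  proof (intro closed_Int closed_complex_linear)
    have "continuous_on UNIV (embed 0 0)" by (rule linear_continuous_on[OF bounded_linear_embed])
    from closed_vimage[OF sphere_cstar(2) this] show "closed {b. embed 0 0 b \<in> sphere_cstar (Suc l) q}"
      by (simp add: vimage_def)
  qed
  moreover have "Y l q k \<in> ?S" if k: "k \<in> {1..l + 1}" for k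
  proof -
    obtain C where C: "smooth_bound l 0 C (Y l q k)" using Y_smooth_bound[OF q, of k l 0] k by auto
    note Y = Y_Suc_Suc_eq[OF q _ _ C]
    have "embed 0 0 (level_proj l) o\<^sub>L Y (Suc l) q (Suc k) = embed 0 0 (Y l q k)"
    proof (rule has_sum_unique)
      have "((\<lambda>n. of_real (q ^ n) \<cdot>\<^sub>C embed n n (Y l q k)) has_sum Y (Suc l) q (Suc k)) UNIV"
        using Y k has_sum_infsum by auto
      from has_sum_bounded_linear[OF bounded_linear_compose_right this]
      show "((\<lambda>n. embed 0 0 (level_proj l) o\<^sub>L (of_real (q ^ n) \<cdot>\<^sub>C embed n n (Y l q k))) has_sum
        embed 0 0 (level_proj l) o\<^sub>L Y (Suc l) q (Suc k)) UNIV" .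
      \<comment> \<open>Only the block n = 0 survives, with weight q^0 = 1 for every q, including q
        = 0.\<close>
      have e: "embed 0 0 (level_proj l) o\<^sub>L (of_real (q ^ n) \<cdot>\<^sub>C embed n n (Y l q k)) = (if n = 0 then embed 0 0 (Y l q k) else 0)" for n
        using smooth_bound_D(2)[OF C] by (simp add: op_scale_compose_right embed_mult)
      show "((\<lambda>n. embed 0 0 (level_proj l) o\<^sub>L (of_real (q ^ n) \<cdot>\<^sub>C embed n n (Y l q k))) has_sum embed 0 0 (Y l q k)) UNIV"
        unfolding e using has_sum_single[of 0 "\<lambda>n::nat. if n = 0 then embed 0 0 (Y l q k) else 0" UNIV] by simp
    qed
    moreover have "embed 0 0 (level_proj l) o\<^sub>L Y (Suc l) q (Suc k) \<in> sphere_cstar (Suc l) q"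
      using k by (intro B embed_0_0_level_proj_mem sphere_cstar(3)) auto
    ultimately show ?thesis using smooth_bound_D(1)[OF C] by simp
  qed
  ultimately have "sphere_cstar l q \<subseteq> ?S"
    unfolding sphere_cstar_def[of l] by (intro cstar_generated_least) auto
  then show "b \<in> sphere_cstar l q \<Longrightarrow> embed 0 0 b \<in> sphere_cstar (Suc l) q" by blast
qed

lemma embed_mem:
  assumes "b \<in> sphere_cstar l q"
  shows "embed j k b \<in> sphere_cstar (Suc l) q"
proof -
  have "embed j 0 (level_proj l) o\<^sub>L embed 0 0 b o\<^sub>L embed 0 k (level_proj l) \<in> sphere_cstar (Suc l) q"
    by (intro star_subalgebraD[OF sphere_cstar(1)] embed_level_proj_mem embed_0_0_mem assms)
  then show ?thesis using sphere_cstar_level[OF assms] by (simp add: embed_mult level_op_def)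
qed

lemma smooth_subset_sphere_cstar: "smooth_algebra l \<subseteq> sphere_cstar l q"
proof (induction l)
  case 0
  note B = star_subalgebraD[OF sphere_cstar(1)[of 0]]
  have 1: "z_shift 1 \<in> sphere_cstar 0 q" using sphere_cstar(3)[of 1 0] by (simp add: Y_0[unfolded One_nat_def])
  \<comment> \<open>The unit of level 0 is obtained as the generator times its adjoint.\<close>
  have 0: "z_shift 0 \<in> sphere_cstar 0 q" using B(4)[OF 1 B(6)[OF 1]] by (simp add: adj_z_shift z_shift_mult)
  have n: "z_shift (int n) \<in> sphere_cstar 0 q" for n
  proof (induction n)
    case (Suc n)
    then show ?case using B(4)[OF 1 Suc] by (simp add: z_shift_mult)
  qed (simp add: 0)
  have z: "z_shift n \<in> sphere_cstar 0 q" for n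
  proof (cases "0 \<le> n")
    case True
    then show ?thesis using n[of "nat n"] by simp
  next
    case False
    then show ?thesis using B(6)[OF n[of "nat (- n)"]] by (simp add: adj_z_shift)
  qed
  show ?case
  proof
    fix a assume "a \<in> smooth_algebra 0"
    then obtain c where "((\<lambda>n. c n \<cdot>\<^sub>C z_shift n) has_sum a) UNIV"
      unfolding smooth_algebra_0 fourier_has_sum by blast
    then show "a \<in> sphere_cstar 0 q"
      by (rule star_subalgebra_has_sum[OF sphere_cstar(1,2)]) (intro B z)
  qed
next
  case (Suc l)
  interpret smooth_level l "smooth_algebra l" "smooth_norm l" by (rule smooth_level_smooth)
  note B = star_subalgebraD[OF sphere_cstar(1)[of "Suc l"]]
  show ?case
  proof
    fix a assume "a \<in> smooth_algebra (Suc l)"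
    then obtain b c where t: "toep b c a"
      unfolding smooth_algebra_def[of "Suc l"] smooth_data.simps(2) smooth_data_eq[of l] by auto
    have "b j k \<in> sphere_cstar l q" for j k using toepD(1)[OF t] Suc.IH by blast
    then have 1: "(\<Sum>\<^sub>\<infinity>(j, k). embed j k (b j k)) \<in> sphere_cstar (Suc l) q"
      by (intro star_subalgebra_has_sum[OF sphere_cstar(1,2) has_sum_infsum[OF embed_summable[OF toep_norm_summable[OF t]]]])
         (auto intro: embed_mem)
    have 2: "(\<Sum>\<^sub>\<infinity>k. c (int k) \<cdot>\<^sub>C down_pow l k) \<in> sphere_cstar (Suc l) q"
      by (intro star_subalgebra_has_sum[OF sphere_cstar(1,2) has_sum_infsum[OF coefficient_summable_nat(1)[OF toepD(3)[OF t]]]] B down_pow_mem)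
    have 3: "(\<Sum>\<^sub>\<infinity>k\<in>{0<..}. c (- int k) \<cdot>\<^sub>C up_pow l k) \<in> sphere_cstar (Suc l) q"
      by (intro star_subalgebra_has_sum[OF sphere_cstar(1,2) has_sum_infsum[OF coefficient_summable_nat(2)[OF toepD(3)[OF t]]]] B up_pow_mem)
    show "a \<in> sphere_cstar (Suc l) q"
      unfolding toepD(4)[OF t] toeplitz_sum_def by (intro B 1 2 3)
  qed
qed

end


section \<open>Holomorphic functional calculus\<close>

lemma bounded_bilinear_op_scale: "bounded_bilinear (op_scale :: complex \<Rightarrow> 'i op \<Rightarrow> 'i op)"
proof
  show "(r *\<^sub>R c) \<cdot>\<^sub>C T = r *\<^sub>R (c \<cdot>\<^sub>C T)" for r c and T :: "'i op"
    by (rule linear_simps(5)[OF bounded_linear_op_scale_left])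
  show "c \<cdot>\<^sub>C (r *\<^sub>R T) = r *\<^sub>R (c \<cdot>\<^sub>C T)" for r c and T :: "'i op"
    by (rule linear_simps(5)[OF bounded_linear_op_scale])
  show "\<exists>K. \<forall>c (T :: 'i op). norm (c \<cdot>\<^sub>C T) \<le> norm c * norm T * K"
    by (rule exI[of _ 1]) (simp add: norm_op_scale_le)
qed (simp_all add: op_scale_distrib)

lemma inverse_in_unique:
  assumes "inverse_in B u a b" "inverse_in B u a b'" "\<And>x. x \<in> B \<Longrightarrow> u o\<^sub>L x = x \<and> x o\<^sub>L u = x"
  shows "b = b'"
proof -
  have "b = b o\<^sub>L (a o\<^sub>L b')" using assms by (simp add: inverse_in_def)
  also have "\<dots> = (b o\<^sub>L a) o\<^sub>L b'" by (simp add: compose_assoc)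
  also have "\<dots> = b'" using assms by (simp add: inverse_in_def)
  finally show ?thesis .
qed

text \<open>The Neumann series at z0 inside B with its own unit: y n is w^n b^(n+1), the hypothesis
  on z makes the ratio of norms at most 1/2, and the sum has norm at most 2 |b|.\<close>

lemma neumann:
  fixes B :: "'i op set"
  assumes B: "star_subalgebra B" "closed B" and u: "u \<in> B" "\<And>x. x \<in> B \<Longrightarrow> u o\<^sub>L x = x \<and> x o\<^sub>L u = x"
    and a: "a \<in> B" and b: "inverse_in B u (z0 \<cdot>\<^sub>C u - a) b" and z: "cmod (z - z0) * norm b \<le> 1 / 2"
  shows "\<exists>x. inverse_in B u (z \<cdot>\<^sub>C u - a) x \<and> norm x \<le> 2 * norm b"
proof -
  note BD = star_subalgebraD[OF B(1)]
  have bB: "b \<in> B" and cb: "(z0 \<cdot>\<^sub>C u - a) o\<^sub>L b = u" "b o\<^sub>L (z0 \<cdot>\<^sub>C u - a) = u"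
    using b by (auto simp: inverse_in_def)
  define w where "w = z0 - z"
  define y where "y = rec_nat b (\<lambda>_ v. w \<cdot>\<^sub>C (b o\<^sub>L v))"
  have y0: "y 0 = b" and ySuc: "y (Suc n) = w \<cdot>\<^sub>C (b o\<^sub>L y n)" for n by (simp_all add: y_def)
  have yB: "y n \<in> B" for n by (induction n) (auto simp: y0 ySuc intro!: BD bB)
  have cl: "complex_linear b" "complex_linear (y n)" for n using BD(1) bB yB by auto
  \<comment> \<open>The same terms with b multiplied on the right; this form yields the left
    inverse, \<open>ySuc\<close> the right one.\<close>
  have yR: "y (Suc n) = w \<cdot>\<^sub>C (y n o\<^sub>L b)" for n
  proof (induction n)
    case (Suc n)
    have "y (Suc (Suc n)) = w \<cdot>\<^sub>C (b o\<^sub>L (w \<cdot>\<^sub>C (y n o\<^sub>L b)))" unfolding ySuc[of "Suc n"] Suc.IH ..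
    also have "\<dots> = w \<cdot>\<^sub>C (y (Suc n) o\<^sub>L b)"
      unfolding ySuc[of n] by (simp add: op_scale_compose_left op_scale_compose_right[OF cl(1)] compose_assoc)
    finally show ?case .
  qed (simp add: y0 ySuc)
  have ny: "norm (y n) \<le> (1 / 2) ^ n * norm b" for n
  proof (induction n)
    case (Suc n)
    have "norm (y (Suc n)) \<le> cmod w * (norm b * norm (y n))"
      unfolding ySuc by (intro order_trans[OF norm_op_scale_le] mult_left_mono norm_compose) auto
    also have "\<dots> = (cmod (z - z0) * norm b) * norm (y n)" by (simp add: w_def norm_minus_commute)
    also have "\<dots> \<le> (1 / 2) * ((1 / 2) ^ n * norm b)" by (intro mult_mono z Suc.IH) auto
    finally show ?case by simp
  qed (simp add: y0)
  have g: "(\<lambda>n. (1 / 2) ^ n * norm b) sums (2 * norm b)"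
    using sums_mult2[OF geometric_sums[of "1 / 2 :: real"], of "norm b"] by simp
  have sn: "summable (\<lambda>n. norm (y n))"
    by (rule summable_comparison_test'[OF sums_summable[OF g]]) (simp add: ny)
  have sy: "summable y" using sn by (rule summable_norm_cancel)
  define x where "x = suminf y"
  have lim: "(\<lambda>n. \<Sum>i<n. y i) \<longlonglongrightarrow> x" using summable_sums[OF sy] by (simp add: sums_def x_def)
  have "(\<Sum>i<n. y i) \<in> B" for n by (induction n) (auto intro!: BD(2,3) yB)
  from closed_sequentially[OF B(2) this lim] have xB: "x \<in> B" .
  have "norm x \<le> (\<Sum>n. norm (y n))" unfolding x_def by (rule summable_norm[OF sn])
  also have "\<dots> \<le> 2 * norm b"
    using suminf_le[OF ny sn sums_summable[OF g]] sums_unique[OF g] by simp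
  finally have nx: "norm x \<le> 2 * norm b" .
  have tail: "(\<lambda>n. y (Suc n)) sums (x - b)"
    using summable_sums[OF sy] by (subst sums_Suc_iff) (simp add: y0 x_def)
  have "(\<lambda>n. w \<cdot>\<^sub>C (b o\<^sub>L y n)) sums (w \<cdot>\<^sub>C (b o\<^sub>L x))"
    unfolding x_def
    by (intro bounded_linear.sums[OF bounded_linear_op_scale] bounded_linear.sums[OF bounded_linear_compose_right] summable_sums sy)
  from iffD1[OF diff_eq_eq sums_unique2[OF tail[unfolded ySuc] this]]
  have 1: "x = w \<cdot>\<^sub>C (b o\<^sub>L x) + b" .
  have "(\<lambda>n. w \<cdot>\<^sub>C (y n o\<^sub>L b)) sums (w \<cdot>\<^sub>C (x o\<^sub>L b))"
    unfolding x_def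
    by (intro bounded_linear.sums[OF bounded_linear_op_scale] bounded_linear.sums[OF bounded_linear_compose_left] summable_sums sy)
  from iffD1[OF diff_eq_eq sums_unique2[OF tail[unfolded yR] this]]
  have 2: "x = w \<cdot>\<^sub>C (x o\<^sub>L b) + b" .
  define c where "c = z0 \<cdot>\<^sub>C u - a"
  have cc: "complex_linear c" unfolding c_def using BD(1) a u(1) by auto
  have zc: "z \<cdot>\<^sub>C u - a = c - w \<cdot>\<^sub>C u" by (simp add: c_def w_def op_scale_distrib)
  have ux: "u o\<^sub>L x = x" "x o\<^sub>L u = x" using u(2)[OF xB] by auto
  have "c o\<^sub>L x = (c o\<^sub>L b) + w \<cdot>\<^sub>C ((c o\<^sub>L b) o\<^sub>L x)"
    by (subst 1, simp only: compose_distrib op_scale_compose_right[OF cc] compose_assoc, rule add.commute)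
  then have "(z \<cdot>\<^sub>C u - a) o\<^sub>L x = u"
    unfolding zc using cb ux by (simp add: c_def[symmetric] compose_distrib op_scale_compose_left)
  moreover have "x o\<^sub>L c = (b o\<^sub>L c) + w \<cdot>\<^sub>C (x o\<^sub>L (b o\<^sub>L c))"
    by (subst 2, simp only: compose_distrib op_scale_compose_left compose_assoc, rule add.commute)
  then have "x o\<^sub>L (z \<cdot>\<^sub>C u - a) = u"
    unfolding zc using cb ux by (simp add: c_def[symmetric] compose_distrib op_scale_compose_right[OF BD(1)[OF xB]])
  ultimately show ?thesis using xB nx by (auto simp: inverse_in_def)
qed

text \<open>The integral is a limit of Riemann sums over tagged divisions, whose weights are
  nonnegative with sum 1. The bound survives such convex combinations with the same C and describes
  a closed set.\<close>

lemma has_integral_smooth_bound: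
  fixes H :: "real \<Rightarrow> idx op"
  assumes H: "(H has_integral I) {0..1}" and smooth_bound: "\<And>t. t \<in> {0..1} \<Longrightarrow> smooth_bound l M C (H t)"
  shows "smooth_bound l M C I"
proof -
  have "I \<in> closure {x. smooth_bound l M C x}"
    unfolding closure_approachable
  proof (intro allI impI)
    fix e :: real assume "0 < e"
    then obtain g where g: "gauge g" "\<And>D. D tagged_division_of cbox 0 1 \<Longrightarrow> g fine D \<Longrightarrow>
        norm ((\<Sum>(x, K)\<in>D. measure lborel K *\<^sub>R H x) - I) < e"
      using H unfolding cbox_interval[symmetric] has_integral by metis
    obtain D where D: "D tagged_division_of cbox (0::real) 1" "g fine D"
      using fine_division_exists[OF g(1)] by blast
    have "smooth_bound l M (\<Sum>z\<in>D. measure lborel (snd z) * C) (\<Sum>z\<in>D. measure lborel (snd z) *\<^sub>R H (fst z))"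
    proof (rule smooth_bound_sum)
      show "finite D" using D(1) by blast
      fix z assume z: "z \<in> D"
      then have "fst z \<in> {0..1}" using tag_in_interval[OF D(1), of "fst z" "snd z"] by simp
      from smooth_bound_scale[OF smooth_bound[OF this], of "of_real (measure lborel (snd z))"]
      show "smooth_bound l M (measure lborel (snd z) * C) (measure lborel (snd z) *\<^sub>R H (fst z))"
        by (simp add: op_scale_of_real)
    qed
    moreover have "(\<Sum>z\<in>D. measure lborel (snd z) * C) = C"
      using additive_content_tagged_division[OF D(1)] by (simp add: case_prod_unfold flip: sum_distrib_right)
    ultimately have "smooth_bound l M C (\<Sum>(x, K)\<in>D. measure lborel K *\<^sub>R H x)" by (simp add: case_prod_unfold)
    then show "\<exists>y\<in>{x. smooth_bound l M C x}. dist y I < e" using g(2)[OF D] by (auto simp: dist_norm)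
  qed
  then show ?thesis using closed_smooth_bound by (simp add: closure_closed)
qed

lemma subset_Diff_disjoint: "S \<subseteq> U - K \<Longrightarrow> S \<inter> K = {}"
  by blast

lemma ex_polynomial_approx:
  fixes \<gamma> :: "real \<Rightarrow> complex"
  assumes "path \<gamma>" "0 < d"
  shows "\<exists>p p'. polynomial_function p \<and> pathstart p = pathstart \<gamma> \<and> pathfinish p = pathfinish \<gamma> \<and>
    (\<forall>t\<in>{0..1}. norm (p t - \<gamma> t) < d) \<and> polynomial_function p' \<and> (\<forall>x. (p has_vector_derivative p' x) (at x))"
proof (rule path_approx_polynomial_function[OF assms])
  fix p assume p: "polynomial_function p" "pathstart p = pathstart \<gamma>" "pathfinish p = pathfinish \<gamma>"
    "\<And>t. t \<in> {0..1} \<Longrightarrow> norm (p t - \<gamma> t) < d"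
  show ?thesis
  proof (rule has_vector_derivative_polynomial_function[OF p(1)])
    fix p' assume "polynomial_function p'" "\<And>x. (p has_vector_derivative p' x) (at x)"
    then show ?thesis using p by (intro exI[of _ p] exI[of _ p']) simp
  qed
qed

section \<open>The resolvent of a smooth element and its contour integrals\<close>

context
  fixes q :: real and l :: nat
  assumes q: "0 \<le> q" "q < 1"
begin

interpretation smooth_level l "smooth_algebra l" "smooth_norm l"
  by (rule smooth_level_smooth)

lemma level_proj_unit:
  "level_proj l \<in> sphere_cstar l q"
  "x \<in> sphere_cstar l q \<Longrightarrow> level_proj l o\<^sub>L x = x \<and> x o\<^sub>L level_proj l = x"
  using smooth_subset_sphere_cstar[OF q] level_proj_mem sphere_cstar_level[OF q] by (auto simp: level_op_def)

context
  fixes a :: "idx op"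
  assumes a: "a \<in> smooth_algebra l"
begin

abbreviation res :: "complex \<Rightarrow> idx op"
  where "res \<equiv> resolvent_in (sphere_cstar l q) (level_proj l) a"

abbreviation spec :: "complex set"
  where "spec \<equiv> spectrum_in (sphere_cstar l q) (level_proj l) a"

lemma a_mem: "a \<in> sphere_cstar l q"
  using a smooth_subset_sphere_cstar[OF q] by blast

lemma res_inverse: "z \<notin> spec \<Longrightarrow> inverse_in (sphere_cstar l q) (level_proj l) (z \<cdot>\<^sub>C level_proj l - a) (res z)"
proof -
  assume "z \<notin> spec"
  then obtain b where b: "inverse_in (sphere_cstar l q) (level_proj l) (z \<cdot>\<^sub>C level_proj l - a) b"
    by (auto simp: spectrum_in_def)
  show ?thesis unfolding resolvent_in_def
    by (rule theI[of "inverse_in (sphere_cstar l q) (level_proj l) (z \<cdot>\<^sub>C level_proj l - a)", OF b])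
       (rule inverse_in_unique[OF _ b level_proj_unit(2)])
qed

lemma res_near:
  assumes z0: "z0 \<notin> spec" and z: "cmod (z - z0) * norm (res z0) \<le> 1 / 2"
  shows "z \<notin> spec" "norm (res z) \<le> 2 * norm (res z0)"
proof -
  obtain x where x: "inverse_in (sphere_cstar l q) (level_proj l) (z \<cdot>\<^sub>C level_proj l - a) x" "norm x \<le> 2 * norm (res z0)"
    using neumann[OF sphere_cstar(1,2)[OF q] level_proj_unit a_mem res_inverse[OF z0] z] by blast
  then show "z \<notin> spec" by (auto simp: spectrum_in_def)
  from inverse_in_unique[OF res_inverse[OF this] x(1) level_proj_unit(2)] x(2)
  show "norm (res z) \<le> 2 * norm (res z0)" by simp
qed

lemma res_mem: "z \<notin> spec \<Longrightarrow> res z \<in> sphere_cstar l q"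
  using res_inverse by (simp add: inverse_in_def)

lemma res_complex_linear: "z \<notin> spec \<Longrightarrow> complex_linear (res z)"
  using sphere_cstar_level[OF q res_mem] by (simp add: level_op_def)

lemma res_identity:
  assumes "z \<notin> spec" "w \<notin> spec"
  shows "res z - res w = (w - z) \<cdot>\<^sub>C (res z o\<^sub>L res w)"
proof -
  have z: "res z o\<^sub>L (z \<cdot>\<^sub>C level_proj l - a) = level_proj l" and w: "(w \<cdot>\<^sub>C level_proj l - a) o\<^sub>L res w = level_proj l"
    using res_inverse assms by (auto simp: inverse_in_def)
  have "res z = res z o\<^sub>L ((w \<cdot>\<^sub>C level_proj l - a) o\<^sub>L res w)"
    unfolding w using level_proj_unit(2)[OF res_mem[OF assms(1)]] by simp
  moreover have "res w = (res z o\<^sub>L (z \<cdot>\<^sub>C level_proj l - a)) o\<^sub>L res w"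
    unfolding z using level_proj_unit(2)[OF res_mem[OF assms(2)]] by simp
  ultimately have "res z - res w = res z o\<^sub>L ((w \<cdot>\<^sub>C level_proj l - a) - (z \<cdot>\<^sub>C level_proj l - a)) o\<^sub>L res w"
    by (simp only: compose_distrib compose_assoc)
  also have "(w \<cdot>\<^sub>C level_proj l - a) - (z \<cdot>\<^sub>C level_proj l - a) = (w - z) \<cdot>\<^sub>C level_proj l"
    by (simp add: op_scale_distrib)
  finally show ?thesis
    using level_proj_unit(2)[OF res_mem[OF assms(1)]]
    by (simp add: op_scale_compose_left op_scale_compose_right[OF res_complex_linear[OF assms(1)]])
qed

lemma res_eventually:
  assumes "z0 \<notin> spec"
  shows "\<forall>\<^sub>F z in at z0. z \<notin> spec \<and> norm (res z) \<le> 2 * norm (res z0)"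
proof -
  \<comment> \<open>The summand 1 avoids a division by zero and still leaves d |res z0| below
    1/2.\<close>
  define d where "d = 1 / (2 * (norm (res z0) + 1))"
  have d: "0 < d" by (simp add: d_def add_nonneg_pos)
  have "cmod (z - z0) * norm (res z0) \<le> 1 / 2" if "dist z z0 < d" for z
  proof -
    have "cmod (z - z0) * norm (res z0) \<le> d * (norm (res z0) + 1)"
      using that d by (intro mult_mono) (auto simp: dist_norm)
    also have "\<dots> = 1 / 2" by (simp add: d_def add_nonneg_pos[THEN less_imp_neq, symmetric])
    finally show ?thesis .
  qed
  then show ?thesis
    using d res_near[OF assms] unfolding eventually_at by blast
qed

lemma spec_closed: "closed spec"
proof -
  have "open (- spec)"
    unfolding open_contains_ball
  proof
    fix z0 assume "z0 \<in> - spec"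
    then have z0: "z0 \<notin> spec" by simp
    from res_eventually[OF z0] obtain d where d: "0 < d" "\<And>z. z \<noteq> z0 \<Longrightarrow> dist z z0 < d \<Longrightarrow> z \<notin> spec"
      unfolding eventually_at by blast
    have "z \<notin> spec" if "dist z0 z < d" for z
      using d(2)[of z] z0 that by (cases "z = z0") (auto simp: dist_commute)
    then show "\<exists>e>0. ball z0 e \<subseteq> - spec"
      using d(1) by (intro exI[of _ d]) auto
  qed
  then show ?thesis by (simp add: open_closed)
qed

lemma res_tendsto: "z0 \<notin> spec \<Longrightarrow> (res \<longlongrightarrow> res z0) (at z0)"
proof -
  assume z0: "z0 \<notin> spec"
  have "((\<lambda>z. cmod (z0 - z) * (2 * norm (res z0) * norm (res z0))) \<longlongrightarrow> cmod (z0 - z0) * (2 * norm (res z0) * norm (res z0))) (at z0)"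
    by (intro tendsto_intros)
  then have lim: "((\<lambda>z. cmod (z0 - z) * (2 * norm (res z0) * norm (res z0))) \<longlongrightarrow> 0) (at z0)" by simp
  have "\<forall>\<^sub>F z in at z0. norm (res z - res z0) \<le> cmod (z0 - z) * (2 * norm (res z0) * norm (res z0))"
    using res_eventually[OF z0]
  proof eventually_elim
    case (elim z)
    have "norm (res z - res z0) \<le> cmod (z0 - z) * norm (res z o\<^sub>L res z0)"
      using elim res_identity[of z z0] z0 by (simp add: norm_op_scale_le)
    also have "\<dots> \<le> cmod (z0 - z) * (norm (res z) * norm (res z0))"
      by (intro mult_left_mono norm_compose) auto
    also have "\<dots> \<le> cmod (z0 - z) * (2 * norm (res z0) * norm (res z0))"
      using elim by (intro mult_left_mono mult_right_mono) auto
    finally show ?case .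
  qed
  from Lim_null_comparison[OF this lim] show ?thesis by (simp add: LIM_zero_iff)
qed

lemma res_continuous_on: "S \<inter> spec = {} \<Longrightarrow> continuous_on S res"
  using res_tendsto by (intro continuous_at_imp_continuous_on) (auto simp: isCont_def)

text \<open>Deformation of contours applies to complex-valued functions, so holomorphy is
  established entry by entry; the resolvent identity turns the difference quotient into a continuous
  expression.\<close>

lemma res_holomorphic:
  assumes "S \<inter> spec = {}"
  shows "(\<lambda>z. ent (res z) J K) holomorphic_on S"
proof -
  have "((\<lambda>z. ent (res z) J K) has_field_derivative - ent (res z0 o\<^sub>L res z0) J K) (at z0)" if z0: "z0 \<in> S" for z0
  proof -
    have n: "z0 \<notin> spec" using z0 assms by auto
    have "((\<lambda>z. - ent (res z o\<^sub>L res z0) J K) \<longlongrightarrow> - ent (res z0 o\<^sub>L res z0) J K) (at z0)"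
      by (intro tendsto_minus bounded_linear.tendsto[OF bounded_linear_ent]
          bounded_linear.tendsto[OF bounded_linear_compose_left] res_tendsto n)
    moreover have "\<forall>\<^sub>F z in at z0. - ent (res z o\<^sub>L res z0) J K = (ent (res z) J K - ent (res z0) J K) / (z - z0)"
      using res_eventually[OF n] eventually_neq_at_within[of z0 z0 UNIV]
    proof eventually_elim
      case (elim z)
      have "ent (res z) J K - ent (res z0) J K = ent (res z - res z0) J K" by simp
      also have "\<dots> = (z0 - z) * ent (res z o\<^sub>L res z0) J K"
        using elim n by (simp add: res_identity del: ent_simps(3))
      finally show ?case using elim by (simp add: field_simps)
    qed
    ultimately show ?thesis
      unfolding has_field_derivative_iff by (rule Lim_transform_eventually)
  qed
  then show ?thesis
    unfolding holomorphic_on_def field_differentiable_def using has_field_derivative_at_within by blast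
qed

definition calc_integrand :: "(complex \<Rightarrow> complex) \<Rightarrow> (real \<Rightarrow> complex) \<Rightarrow> real \<Rightarrow> idx op"
  where "calc_integrand f \<gamma> t = (f (\<gamma> t) * vector_derivative \<gamma> (at t within {0..1})) \<cdot>\<^sub>C res (\<gamma> t)"

text \<open>Entrywise the operator integral is an ordinary contour integral, to which Cauchy's
  theorem applies.\<close>

lemma calc_integrand_contour:
  assumes "(calc_integrand f \<gamma> has_integral I) {0..1}"
  shows "((\<lambda>z. f z * ent (res z) J K) has_contour_integral ent I J K) \<gamma>"
proof -
  have "((\<lambda>t. ent (calc_integrand f \<gamma> t) J K) has_integral ent I J K) {0..1}"
    using has_integral_linear[OF assms bounded_linear_ent[of J K]] by (simp add: o_def)
  then show ?thesis
    unfolding has_contour_integral_def calc_integrand_def by (simp add: mult_ac)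
qed

text \<open>Elements of \<open>'i op\<close> are only real-linear, so this needs an argument: T
  \<mapsto> T (c x) - c (T x) is bounded and linear in T and vanishes on the integrand. It allows
  the two integrals to be compared by their entries later.\<close>

lemma calc_integrand_complex_linear:
  assumes I: "(calc_integrand f \<gamma> has_integral I) {0..1}" and g: "path_image \<gamma> \<inter> spec = {}"
  shows "complex_linear I"
  unfolding complex_linear_def
proof (intro allI)
  fix c x
  have "bounded_linear (\<lambda>T :: idx op. T (cscale c x) - cscale c (T x))"
    by (intro bounded_linear_sub blinfun.bounded_linear_left
        bounded_linear_compose[OF bounded_linear_cscale blinfun.bounded_linear_left])
  from has_integral_linear[OF I this]
  have 1: "((\<lambda>t. calc_integrand f \<gamma> t (cscale c x) - cscale c (calc_integrand f \<gamma> t x)) has_integral I (cscale c x) - cscale c (I x)) {0..1}"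
    by (simp add: o_def)
  have "calc_integrand f \<gamma> t (cscale c x) - cscale c (calc_integrand f \<gamma> t x) = 0" if "t \<in> {0..1}" for t
  proof -
    have "complex_linear (calc_integrand f \<gamma> t)"
    proof -
      have "\<gamma> t \<in> path_image \<gamma>" using that unfolding path_image_def by (rule imageI)
      then have "\<gamma> t \<notin> spec" by (rule g[unfolded disjoint_iff, rule_format])
      then show ?thesis unfolding calc_integrand_def by (intro complex_linear_simps res_complex_linear)
    qed
    then show ?thesis by (simp add: complex_linearD)
  qed
  then have "((\<lambda>t. calc_integrand f \<gamma> t (cscale c x) - cscale c (calc_integrand f \<gamma> t x)) has_integral 0) {0..1}"
    by (intro has_integral_is_0) auto
  from has_integral_unique[OF 1 this] show "I (cscale c x) = cscale c (I x)" by simp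
qed

text \<open>On a compact set the resolvents are bounded in norm and the operators z - a obey a
  common bound; \<open>smooth_bound_inverse\<close> turns these two constants into one constant for
  all resolvents.\<close>

lemma res_smooth_bound:
  assumes S: "compact S" "S \<inter> spec = {}"
  shows "\<exists>C. \<forall>z\<in>S. smooth_bound l M C (res z)"
proof -
  have "bounded (res ` S)"
    by (intro compact_imp_bounded compact_continuous_image res_continuous_on S)
  then obtain \<beta> where \<beta>: "\<And>z. z \<in> S \<Longrightarrow> norm (res z) \<le> \<beta>" by (auto simp: bounded_iff)
  obtain r where r: "\<And>z. z \<in> S \<Longrightarrow> cmod z \<le> r" using compact_imp_bounded[OF S(1)] by (auto simp: bounded_iff)
  obtain C where C: "smooth_bound l M C a" using ex_smooth_bound[OF a] by blast
  obtain C' where C': "\<And>a b. smooth_bound l M (r + C) a \<Longrightarrow> complex_linear b \<Longrightarrow> norm b \<le> \<beta> \<Longrightarrow> a o\<^sub>L b = level_proj l \<Longrightarrow>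
      b o\<^sub>L a = level_proj l \<Longrightarrow> level_proj l o\<^sub>L b = b \<Longrightarrow> b o\<^sub>L level_proj l = b \<Longrightarrow> smooth_bound l M C' b"
    using smooth_bound_inverse[of l M "r + C" \<beta>] by blast
  have "smooth_bound l M C' (res z)" if z: "z \<in> S" for z
  proof -
    have n: "z \<notin> spec" using z S(2) by auto
    have "smooth_bound l M (cmod z * 1 + C) (z \<cdot>\<^sub>C level_proj l - a)" by (intro smooth_bound_diff smooth_bound_scale smooth_bound_level_proj C)
    then have "smooth_bound l M (r + C) (z \<cdot>\<^sub>C level_proj l - a)" by (rule smooth_bound_mono) (use r[OF z] in simp)
    then show ?thesis
      using res_inverse[OF n] level_proj_unit(2)[OF res_mem[OF n]] \<beta>[OF z] res_complex_linear[OF n]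
      by (intro C'[of "z \<cdot>\<^sub>C level_proj l - a"]) (auto simp: inverse_in_def)
  qed
  then show ?thesis by blast
qed

text \<open>A valid path may have an unbounded derivative near its finitely many exceptional points, so
  the integral is first moved to a nearby polynomial loop, where the integrand is bounded for
  each of the estimates defining the smooth algebra.\<close>

lemma calc_integrand_integral_mem:
  assumes U: "open U" and f: "f holomorphic_on U"
    and \<gamma>: "valid_path \<gamma>" "pathfinish \<gamma> = pathstart \<gamma>" "path_image \<gamma> \<subseteq> U - spec"
  shows "integral {0..1} (calc_integrand f \<gamma>) \<in> smooth_algebra l"
proof (cases "calc_integrand f \<gamma> integrable_on {0..1}")
  case False
  \<comment> \<open>The integral of a function that is not integrable is 0 by convention, and 0 lies
    in the algebra.\<close>
  then show ?thesis by (simp add: not_integrable_integral zero_mem)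
next
  case True
  then have I: "(calc_integrand f \<gamma> has_integral integral {0..1} (calc_integrand f \<gamma>)) {0..1}" by (rule integrable_integral)
  have oS: "open (U - spec)" using U spec_closed by (intro open_Diff)
  \<comment> \<open>Loops within distance d of \<gamma> stay in the open set U - spec and give the
    same integrals of functions holomorphic there.\<close>
  from contour_integral_nearby_loops[OF oS valid_path_imp_path[OF \<gamma>(1)] \<gamma>(3)]
  obtain d where d0: "0 < d" and d: "\<forall>g h. valid_path g \<and> valid_path h \<and>
      (\<forall>t\<in>{0..1}. norm (g t - \<gamma> t) < d \<and> norm (h t - \<gamma> t) < d) \<and>
      pathfinish g = pathstart g \<and> pathfinish h = pathstart h \<longrightarrow>
      path_image g \<subseteq> U - spec \<and> path_image h \<subseteq> U - spec \<and>
      (\<forall>f. f holomorphic_on U - spec \<longrightarrow> contour_integral h f = contour_integral g f)"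
    by (elim exE conjE) (rule that)
  from ex_polynomial_approx[OF valid_path_imp_path[OF \<gamma>(1)] d0]
  obtain p p' where p: "polynomial_function p" "pathstart p = pathstart \<gamma>" "pathfinish p = pathfinish \<gamma>"
      "\<forall>t\<in>{0..1}. norm (p t - \<gamma> t) < d"
    and p': "polynomial_function p'" "\<forall>x. (p has_vector_derivative p' x) (at x)"
    by (elim exE conjE) (rule that)
  have vp: "valid_path p" using p(1) by (rule valid_path_polynomial_function)
  have "path_image \<gamma> \<subseteq> U - spec \<and> path_image p \<subseteq> U - spec \<and>
      (\<forall>f. f holomorphic_on U - spec \<longrightarrow> contour_integral p f = contour_integral \<gamma> f)"
    by (rule d[rule_format]) (use \<gamma>(1,2) vp p d0 in simp)
  then have pS: "path_image p \<subseteq> U - spec"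
    and eq: "\<And>f. f holomorphic_on U - spec \<Longrightarrow> contour_integral p f = contour_integral \<gamma> f"
    by simp_all
  have cp: "calc_integrand f p t = (f (p t) * p' t) \<cdot>\<^sub>C res (p t)" if "t \<in> {0..1}" for t
    using vector_derivative_at_within_ivl[OF p'(2)[rule_format], of 0 t 1] that by (simp add: calc_integrand_def)
  have pim: "p ` {0..1} \<subseteq> U - spec" using pS by (simp add: path_image_def)
  have cfp: "continuous_on {0..1} (\<lambda>t. f (p t) * p' t)"
    using pim continuous_on_polymonial_function[OF p(1)] continuous_on_polymonial_function[OF p'(1)]
    by (intro continuous_on_mult continuous_on_compose2[OF holomorphic_on_imp_continuous_on[OF f]]) auto
  have crp: "continuous_on {0..1} (\<lambda>t. res (p t))"
    using pim continuous_on_polymonial_function[OF p(1)]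
    by (intro continuous_on_compose2[OF res_continuous_on[of "p ` {0..1}"]]) auto
  have "continuous_on {0..1} (\<lambda>t. (f (p t) * p' t) \<cdot>\<^sub>C res (p t))"
    by (rule bounded_bilinear.continuous_on[OF bounded_bilinear_op_scale cfp crp])
  then have "continuous_on {0..1} (calc_integrand f p)"
    using continuous_on_cong[of "{0..1}" "{0..1}" "calc_integrand f p" "\<lambda>t. (f (p t) * p' t) \<cdot>\<^sub>C res (p t)"] cp by simp
  then obtain Ip where Ip: "(calc_integrand f p has_integral Ip) {0..1}"
    using integrable_continuous_interval by blast
  \<comment> \<open>On the polynomial loop the scalar factor is continuous, hence bounded by some D,
    and for each order M the resolvents share a bound C; the integral then obeys D C.\<close>
  have IpA: "Ip \<in> smooth_algebra l"
  proof (rule mem_of_smooth_bound)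
    fix M
    from res_smooth_bound[OF compact_path_image[OF valid_path_imp_path[OF vp]] subset_Diff_disjoint[OF pS]]
    obtain C where C: "\<forall>z\<in>path_image p. smooth_bound l M C (res z)" ..
    have "bounded ((\<lambda>t. f (p t) * p' t) ` {0..1})"
      by (intro compact_imp_bounded compact_continuous_image cfp) simp
    then obtain D where D: "\<forall>t\<in>{0..1}. cmod (f (p t) * p' t) \<le> D"
      unfolding bounded_iff ball_simps(9) ..
    have "smooth_bound l M (D * C) (calc_integrand f p t)" if t: "t \<in> {0..1}" for t
    proof -
      have "p t \<in> path_image p" using t unfolding path_image_def by (rule imageI)
      then have "smooth_bound l M C (res (p t))" by (rule C[rule_format])
      from smooth_bound_scale[OF this] have "smooth_bound l M (cmod (f (p t) * p' t) * C) (calc_integrand f p t)" by (simp only: cp[OF t])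
      then show ?thesis
        by (rule smooth_bound_mono) (use D[rule_format, OF t] smooth_bound_nonneg[OF \<open>smooth_bound l M C (res (p t))\<close>] in \<open>intro mult_right_mono\<close>)
    qed
    from has_integral_smooth_bound[OF Ip this] show "\<exists>C. smooth_bound l M C Ip" ..
  qed
  \<comment> \<open>Complex-linear operators agree once their entries do, and entrywise both sides
    are contour integrals of one function holomorphic on U - spec along nearby loops.\<close>
  have "integral {0..1} (calc_integrand f \<gamma>) = Ip"
  proof (rule op_eqI)
    show "complex_linear (integral {0..1} (calc_integrand f \<gamma>))"
      by (rule calc_integrand_complex_linear[OF I subset_Diff_disjoint[OF \<gamma>(3)]])
    show "complex_linear Ip"
      by (rule calc_integrand_complex_linear[OF Ip subset_Diff_disjoint[OF pS]])
    fix J K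
    have "(\<lambda>z. f z * ent (res z) J K) holomorphic_on U - spec"
      by (rule holomorphic_on_mult[OF holomorphic_on_subset[OF f Diff_subset] res_holomorphic[OF subset_Diff_disjoint[OF order_refl]]])
    from eq[OF this] show "ent (integral {0..1} (calc_integrand f \<gamma>)) J K = ent Ip J K"
      unfolding contour_integral_unique[OF calc_integrand_contour[OF I]] contour_integral_unique[OF calc_integrand_contour[OF Ip]]
      by (rule sym)
  qed
  then show ?thesis using IpA by simp
qed

lemma calculus_mem:
  assumes "open U" "f holomorphic_on U" "surrounding_cycle U spec \<Gamma>"
  shows "holomorphic_calculus (sphere_cstar l q) (level_proj l) a f \<Gamma> \<in> smooth_algebra l"
proof -
  have "integral {0..1} (calc_integrand f \<gamma>) \<in> smooth_algebra l" if "\<gamma> \<in> set \<Gamma>" for \<gamma>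
    by (rule calc_integrand_integral_mem[OF assms(1,2)]) (use assms(3) that in \<open>simp_all add: surrounding_cycle_def\<close>)
  then have "(\<Sum>\<gamma>\<leftarrow>\<Gamma>. integral {0..1} (calc_integrand f \<gamma>)) \<in> smooth_algebra l"
    by (induction \<Gamma>) (auto intro: zero_mem add_mem)
  from scale_mem[OF this] show ?thesis
    unfolding holomorphic_calculus_def calc_integrand_def[abs_def] .
qed

end

lemma closed_under_calculus:
  "closed_under_holomorphic_calculus (sphere_cstar l q) (level_proj l) (smooth_algebra l)"
  unfolding closed_under_holomorphic_calculus_def using calculus_mem by blast

end

theorem proposition3p4:
  fixes l :: nat and q :: real
  assumes "0 \<le> q" and "q < 1"
  shows "(smooth_algebra l \<subseteq> sphere_cstar l q \<and>
          sphere_cstar l q \<subseteq> closure (smooth_algebra l) \<and>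
          frechet_star_algebra (smooth_algebra l) (smooth_norm l) \<and>
          closed_under_holomorphic_calculus (sphere_cstar l q) (unit_op l) (smooth_algebra l)) \<and>
         (\<forall>k\<in>{1..l + 1}. Y l q k \<in> smooth_algebra l)"
  using smooth_subset_sphere_cstar[OF assms] sphere_cstar_subset_closure[OF assms]
    smooth_level.frechet[OF smooth_level_smooth] closed_under_calculus[OF assms] Y_mem[OF assms]
  by (simp add: unit_op_eq)

end
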